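(* Let $k\geq1$ be an integer and $1<p<2$. There is a constant $c_k$ depending only on $k$ such that for every $n\in\mathbb{N}$ and every $f:\Omega_n\to\mathbb{C}$, $$\left\|\left(\sum_{j_1,\dots,j_k=1}^n|D_{j_1}\cdots D_{j_k}f|^2\right)^{1/2}\right\|_{L_p(\Omega_n)}\leq c_k(p-1)^{-2k}\|\Delta^{k/p}f\|_{L_p(\Omega_n)}.$$ Moreover, the exponent $\frac kp$ is optimal even if the sum on the left is restricted to pairwise distinct indices: for no $\gamma$ with $0<\gamma<\frac kp$ does there exist a constant $C<\infty$, independent of $n$ and $f$, such that $$\left\|\left(\sum_{\substack{j_1,\dots,j_k\in[n]\\ j_1,\dots,j_k\text{ pairwise distinct}}}|D_{j_1}\cdots D_{j_k}f|^2\right)^{1/2}\right\|_{L_p(\Omega_n)}\leq C\|\Delta^{\gamma}f\|_{L_p(\Omega_n)}$$ for every $n\in\mathbb{N}$ and every $f:\Omega_n\to\mathbb{C}$.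
   Context: For $n\in\mathbb{N}=\{1,2,\dots\}$ let $[n]=\{1,\dots,n\}$ and let $\Omega_n=\{-1,1\}^n$ carry the uniform probability measure $\mu_n$; $L_p(\Omega_n)$ is the usual space of complex-valued functions with norm taken with respect to $\mu_n$. For $x\in\Omega_n$, $x^{(j)}$ is $x$ with $x_j$ replaced by $-x_j$, and $(D_jf)(x)=\frac{f(x)-f(x^{(j)})}{2}$. For $A\subseteq[n]$, $w_A(x)=\prod_{j\in A}x_j$ and $\widehat f(A)=\int_{\Omega_n} f\,w_A\,d\mu_n$. $\Delta=\sum_{j=1}^nD_j$, so that $\Delta w_A=|A|w_A$, and for $z\in\mathbb{C}$, $\Delta^zf=\sum_{\emptyset\neq A\subseteq[n]}|A|^z\widehat f(A)w_A$. *)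

theory Defs
  imports "HOL-Probability.Probability"
begin

text \<open>
  Points of \<open>\<Omega>\<^sub>n\<close> are extensional functions on \<open>{1..n}\<close>. A function \<open>f : \<Omega>\<^sub>n \<rightarrow> \<complex>\<close> is represented
  by a total function on \<^typ>\<open>nat \<Rightarrow> real\<close>; every notion below, evaluated at points of \<open>\<Omega>\<^sub>n\<close>
  and for indices in \<open>{1..n}\<close>, depends only on the values of \<open>f\<close> on \<open>\<Omega>\<^sub>n\<close>.
\<close>

definition cube :: "nat \<Rightarrow> (nat \<Rightarrow> real) set" where
  "cube n = {1..n} \<rightarrow>\<^sub>E {-1, 1}"

definition cube_measure :: "nat \<Rightarrow> (nat \<Rightarrow> real) measure" where
  "cube_measure n = uniform_count_measure (cube n)"

definition Lp_norm :: "nat \<Rightarrow> real \<Rightarrow> ((nat \<Rightarrow> real) \<Rightarrow> 'b::real_normed_vector) \<Rightarrow> real" where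
  "Lp_norm n p f = (LINT x|cube_measure n. norm (f x) powr p) powr (1 / p)"

definition flip :: "nat \<Rightarrow> (nat \<Rightarrow> real) \<Rightarrow> (nat \<Rightarrow> real)" where
  "flip j x = x(j := - x j)"

definition D :: "nat \<Rightarrow> ((nat \<Rightarrow> real) \<Rightarrow> complex) \<Rightarrow> (nat \<Rightarrow> real) \<Rightarrow> complex" where
  "D j f x = (f x - f (flip j x)) / 2"

text \<open>\<open>D_iter [j\<^sub>1, \<dots>, j\<^sub>k] f\<close> is \<open>D\<^bsub>j\<^sub>1\<^esub> \<cdots> D\<^bsub>j\<^sub>k\<^esub> f\<close>.\<close>

definition D_iter :: "nat list \<Rightarrow> ((nat \<Rightarrow> real) \<Rightarrow> complex) \<Rightarrow> (nat \<Rightarrow> real) \<Rightarrow> complex" where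
  "D_iter js f = foldr D js f"

definition walsh :: "nat set \<Rightarrow> (nat \<Rightarrow> real) \<Rightarrow> complex" where
  "walsh A x = complex_of_real (\<Prod>j\<in>A. x j)"

definition fourier_coeff :: "nat \<Rightarrow> ((nat \<Rightarrow> real) \<Rightarrow> complex) \<Rightarrow> nat set \<Rightarrow> complex" where
  "fourier_coeff n f A = (LINT x|cube_measure n. f x * walsh A x)"

definition Delta_power ::
    "nat \<Rightarrow> complex \<Rightarrow> ((nat \<Rightarrow> real) \<Rightarrow> complex) \<Rightarrow> (nat \<Rightarrow> real) \<Rightarrow> complex" where
  "Delta_power n z f x =
     (\<Sum>A | A \<noteq> {} \<and> A \<subseteq> {1..n}. of_nat (card A) powr z * fourier_coeff n f A * walsh A x)"

definition index_tuples :: "nat \<Rightarrow> nat \<Rightarrow> nat list set" where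
  "index_tuples n k = {js. set js \<subseteq> {1..n} \<and> length js = k}"

definition distinct_index_tuples :: "nat \<Rightarrow> nat \<Rightarrow> nat list set" where
  "distinct_index_tuples n k = {js \<in> index_tuples n k. distinct js}"

end

theory Submission
  imports Defs
begin

text \<open>
  The estimate is reduced to first derivatives of functions with values in a real inner product space:
  the \<open>k\<close>-th derivatives of a scalar function form one such vector valued function, and the number
  operator commutes with all \<open>D\<^sub>j\<close>, so \<open>k\<close> applications of the bound for
  \<open>\<nabla> \<Delta>\<^bsup>-1/p\<^esup>\<close> (lemma \<open>gradient_bound\<close>) give the bound for \<open>\<nabla>\<^sup>k \<Delta>\<^bsup>-k/p\<^esup>\<close>.

  For first derivatives put \<open>g = \<Delta>\<^bsup>1/p\<^esup> F\<close> and \<open>u\<^sub>s = P\<^sub>s g\<close>, where \<open>P\<^sub>s = e\<^bsup>-s\<Delta>\<^esup>\<close> is the heat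
  semigroup. On a Walsh function of degree \<open>a\<close> one has
  \<open>\<integral>\<^sub>0\<^sup>\<infinity> s\<^bsup>1/p-1\<^esup> (e\<^bsup>-2as\<^esup> - e\<^bsup>-3as\<^esup>) a\<^bsup>1/p\<^esup> ds = \<kappa>\<close> with \<open>\<kappa>\<close> independent of \<open>a\<close>, so
  up to this constant the pairing of \<open>\<nabla>F\<close> with a test field \<open>\<phi>\<close> in \<open>L\<^sub>q\<close>, \<open>1/p + 1/q = 1\<close>, is the integral
  over all scales \<open>s\<close> of \<open>s\<^bsup>1/p-1\<^esup>\<close> times the pairing of \<open>\<nabla>u\<^sub>s\<close> with \<open>P\<^sub>s\<phi> - P\<^sub>2\<^sub>s\<phi>\<close>.
  Along a dyadic sequence of scales the two factors are controlled by two different square functions.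

  The factor with \<open>\<phi>\<close> is a martingale square function in disguise. If every coordinate is
  forgotten at an independent random time, then \<open>P\<^sub>s\<phi>\<close> is the average over these times of the conditional
  expectation of \<open>\<phi>\<close> given the coordinates that survive (\<open>noise_mixture\<close>). For fixed times these
  conditional expectations form a martingale, and the classical maximal and square
  function inequalities (\<open>Doob_chain\<close>, \<open>Garsia_chain\<close>) pass to the semigroup through Jensen's
  inequality, the latter with constant of order \<open>\<surd>q\<close>.

  The exponent \<open>1/p\<close> comes from the factor with \<open>\<nabla>u\<^sub>s\<close>. The dissipation of \<open>\<parallel>u\<^sub>s\<parallel>\<^sub>p\<^sup>p\<close> in time controls
  \<open>\<Sum>\<^sub>j |D\<^sub>j u|\<^sup>2 M\<^sub>j\<^bsup>p-2\<^esup>\<close>, where \<open>M\<^sub>j\<close> is the larger of the norms of \<open>u\<close> at the two end points of the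
  edge \<open>j\<close> (\<open>energy_integral\<close>). As \<open>p < 2\<close>, this weight is harmless on the edges where \<open>M\<^sub>j\<close> is at most a multiple
  of a maximal function \<open>G\<close>. On the remaining edges \<open>|D\<^sub>j u|\<close> is comparable to \<open>M\<^sub>j\<close>, so there the energy controls
  \<open>\<Sum>\<^sub>j |D\<^sub>j u|\<^sup>p\<close>; this is integrable against \<open>ds = s ds/s\<close>, which is why \<open>s\<^bsup>1/p\<^esup>\<nabla>u\<^sub>s\<close>, and not
  \<open>s\<^bsup>1/2\<^esup>\<nabla>u\<^sub>s\<close> as for \<open>p \<ge> 2\<close>, is the right normalisation (\<open>gradient_square_function_le\<close>). Averaging
  over the position of the dyadic grid replaces sums over scales by integrals (\<open>integral_pairing_le\<close>). The factor
  \<open>(p - 1)\<^sup>-\<^sup>1\<close> comes from the dissipation and from the maximal inequality, the rest of \<open>(p - 1)\<^sup>-\<^sup>2\<close> from \<open>\<surd>q\<close>.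

  Optimality is seen on the indicator \<open>f\<close> of a single vertex. Its derivative of order \<open>k\<close> in pairwise distinct
  directions has modulus \<open>2\<^sup>-\<^sup>k\<close> at the vertex obtained by flipping these directions, so the left side is at least
  of order \<open>n\<^bsup>k/p\<^esup> \<parallel>f\<parallel>\<^sub>p\<close>, whereas \<open>\<parallel>\<Delta>\<^sup>\<gamma> f\<parallel>\<^sub>p\<close> is at most of order \<open>n\<^sup>\<gamma> \<parallel>f\<parallel>\<^sub>p\<close>, because
  \<open>\<Delta>/n = 1 - Q\<close> with a contraction \<open>Q\<close> and the binomial series of \<open>(1 - Q)\<^sup>\<gamma>\<close> converges absolutely
  (\<open>moment_num_power_le\<close>).
\<close>

section \<open>Averages, Walsh functions and noise operators on the cube\<close>

definition avg :: "nat \<Rightarrow> ((nat \<Rightarrow> real) \<Rightarrow> 'a::real_vector) \<Rightarrow> 'a" where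
  "avg n f = (\<Sum>x\<in>cube n. f x) /\<^sub>R 2 ^ n"

abbreviation moment :: "nat \<Rightarrow> real \<Rightarrow> ((nat \<Rightarrow> real) \<Rightarrow> 'a::real_normed_vector) \<Rightarrow> real" where
  "moment n p f \<equiv> avg n (\<lambda>x. norm (f x) powr p)"

text \<open>
  The coordinates of the second argument, independently for every \<open>j\<close>, agree with those of the first with
  probability \<open>(1 + \<theta>\<^sub>j) / 2\<close>. Letting \<open>\<theta>\<close> vary with \<open>j\<close> puts the heat semigroup (constant \<open>\<theta>\<close>) and
  the conditional expectations onto sets of coordinates (\<open>\<theta>\<close> an indicator function) into one family that is
  closed under composition.
\<close>

definition kern :: "nat \<Rightarrow> (nat \<Rightarrow> real) \<Rightarrow> (nat \<Rightarrow> real) \<Rightarrow> (nat \<Rightarrow> real) \<Rightarrow> real" where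
  "kern n \<theta> x y = (\<Prod>j\<in>{1..n}. (1 + \<theta> j * x j * y j) / 2)"

definition noise ::
    "nat \<Rightarrow> (nat \<Rightarrow> real) \<Rightarrow> ((nat \<Rightarrow> real) \<Rightarrow> 'a::real_vector) \<Rightarrow> (nat \<Rightarrow> real) \<Rightarrow> 'a" where
  "noise n \<theta> f x = (\<Sum>y\<in>cube n. kern n \<theta> x y *\<^sub>R f y)"

definition cdiff :: "nat \<Rightarrow> ((nat \<Rightarrow> real) \<Rightarrow> 'a::real_vector) \<Rightarrow> (nat \<Rightarrow> real) \<Rightarrow> 'a" where
  "cdiff j f x = (f x - f (flip j x)) /\<^sub>R 2"

text \<open>
  Walsh functions are taken real here, as they multiply coefficients in an arbitrary real vector space.
\<close>

definition rwalsh :: "nat set \<Rightarrow> (nat \<Rightarrow> real) \<Rightarrow> real" where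
  "rwalsh A x = (\<Prod>j\<in>A. x j)"

definition walsh_coeff :: "nat \<Rightarrow> ((nat \<Rightarrow> real) \<Rightarrow> 'a::real_vector) \<Rightarrow> nat set \<Rightarrow> 'a" where
  "walsh_coeff n f A = avg n (\<lambda>x. rwalsh A x *\<^sub>R f x)"

lemma finite_cube [simp]: "finite (cube n)"
  unfolding cube_def by (intro finite_PiE) auto

lemma card_cube: "card (cube n) = 2 ^ n"
  unfolding cube_def by (simp add: card_PiE card_insert_if numeral_2_eq_2)

lemma cube_coord: "x \<in> cube n \<Longrightarrow> j \<in> {1..n} \<Longrightarrow> x j = 1 \<or> x j = -1"
  unfolding cube_def by auto

lemma cube_sq: "x \<in> cube n \<Longrightarrow> j \<in> {1..n} \<Longrightarrow> x j * x j = 1"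
  using cube_coord by fastforce

lemma cube_eqI: "x \<in> cube n \<Longrightarrow> y \<in> cube n \<Longrightarrow> (\<And>j. j \<in> {1..n} \<Longrightarrow> x j = y j) \<Longrightarrow> x = y"
  unfolding cube_def by (rule PiE_ext) auto

lemma flip_cube [intro]: "x \<in> cube n \<Longrightarrow> j \<in> {1..n} \<Longrightarrow> flip j x \<in> cube n"
  unfolding cube_def flip_def by (auto simp: PiE_iff extensional_def)

lemma flip_flip [simp]: "flip j (flip j x) = x"
  by (auto simp: flip_def)

lemma sum_cube_flip:
  "j \<in> {1..n} \<Longrightarrow> (\<Sum>x\<in>cube n. f (flip j x)) = (\<Sum>x\<in>cube n. f x)"
  by (rule sum.reindex_bij_witness[where i = "flip j" and j = "flip j"]) auto

lemma avg_flip: "j \<in> {1..n} \<Longrightarrow> avg n (\<lambda>x. f (flip j x)) = avg n f"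
  by (simp add: avg_def sum_cube_flip)

lemma avg_add: "avg n (\<lambda>x. f x + g x) = avg n f + avg n g"
  by (simp add: avg_def sum.distrib scaleR_add_right)

lemma avg_diff: "avg n (\<lambda>x. f x - g x) = avg n f - avg n g"
  by (simp add: avg_def sum_subtractf scaleR_diff_right)

lemma avg_scaleR: "avg n (\<lambda>x. c *\<^sub>R f x) = c *\<^sub>R avg n f"
  by (simp add: avg_def scaleR_sum_right mult.commute)

lemma avg_cmult: "avg n (\<lambda>x. c * f x) = c * (avg n f :: real)"
  using avg_scaleR[of n c f] by simp

lemma avg_sum: "avg n (\<lambda>x. \<Sum>i\<in>I. f i x) = (\<Sum>i\<in>I. avg n (f i))"
  unfolding avg_def by (subst sum.swap) (simp add: scaleR_sum_right)

lemma avg_const [simp]: "avg n (\<lambda>x. c) = c"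
  by (simp add: avg_def card_cube scaleR_conv_of_real sum_constant_scaleR)

lemma avg_cong: "(\<And>x. x \<in> cube n \<Longrightarrow> f x = g x) \<Longrightarrow> avg n f = avg n g"
  by (simp add: avg_def)

lemma avg_mono: "(\<And>x. x \<in> cube n \<Longrightarrow> f x \<le> g x) \<Longrightarrow> avg n f \<le> (avg n g :: real)"
  by (simp add: avg_def sum_mono)

lemma avg_nonneg: "(\<And>x. x \<in> cube n \<Longrightarrow> 0 \<le> f x) \<Longrightarrow> 0 \<le> (avg n f :: real)"
  by (simp add: avg_def sum_nonneg)

lemma sum_cube_prod:
  fixes h :: "nat \<Rightarrow> real \<Rightarrow> real"
  shows "(\<Sum>y\<in>cube n. \<Prod>j\<in>{1..n}. h j (y j)) = (\<Prod>j\<in>{1..n}. h j (-1) + h j 1)"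
proof -
  have "(\<Prod>j\<in>{1..n}. \<Sum>v\<in>{-1,1}. h j v) = (\<Sum>y\<in>cube n. \<Prod>j\<in>{1..n}. h j (y j))"
    unfolding cube_def by (rule prod_sum_PiE) auto
  then show ?thesis by simp
qed

lemma kern_sum: "(\<Sum>y\<in>cube n. kern n \<theta> x y) = 1"
  unfolding kern_def by (subst sum_cube_prod) (simp add: field_simps)

lemma kern_semigroup:
  "(\<Sum>y\<in>cube n. kern n \<theta> x y * kern n \<theta>' y z) = kern n (\<lambda>j. \<theta> j * \<theta>' j) x z"
  unfolding kern_def prod.distrib[symmetric]
  by (subst sum_cube_prod) (auto intro!: prod.cong simp: field_simps)

lemma kern_commute: "kern n \<theta> x y = kern n \<theta> y x"
  by (simp add: kern_def mult_ac)

lemma kern_flip: "kern n \<theta> (flip j x) y = kern n \<theta> x (flip j y)"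
  unfolding kern_def flip_def by (intro prod.cong) auto

lemma kern_nonneg:
  assumes "\<And>j. \<bar>\<theta> j\<bar> \<le> 1" "x \<in> cube n" "y \<in> cube n"
  shows "0 \<le> kern n \<theta> x y"
  unfolding kern_def
proof (intro prod_nonneg ballI)
  fix j assume j: "j \<in> {1..n}"
  show "0 \<le> (1 + \<theta> j * x j * y j) / 2"
    using cube_coord[OF assms(2) j] cube_coord[OF assms(3) j] assms(1)[of j] by auto
qed

text \<open>
  Expanding the product over the coordinates diagonalises all noise operators at once; \<open>\<theta> = 1\<close> is
  Fourier inversion.
\<close>

lemma kern_walsh:
  "kern n \<theta> x y = (\<Sum>A\<in>Pow {1..n}. (\<Prod>j\<in>A. \<theta> j) * rwalsh A x * rwalsh A y) / 2 ^ n"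
proof -
  have "(\<Prod>j\<in>{1..n}. \<theta> j * x j * y j + 1) = (\<Sum>A\<in>Pow {1..n}. (\<Prod>j\<in>A. \<theta> j * x j * y j) * (\<Prod>j\<in>{1..n}-A. 1))"
    by (rule prod_add) simp
  then show ?thesis
    unfolding kern_def by (simp add: prod_dividef prod.distrib rwalsh_def add.commute)
qed

lemma kern_one:
  assumes "x \<in> cube n" "y \<in> cube n"
  shows "kern n (\<lambda>_. 1) x y = (if x = y then 1 else 0)"
proof (cases "x = y")
  case True
  then show ?thesis using cube_sq[OF assms(1)] by (simp add: kern_def)
next
  case False
  then obtain j where j: "j \<in> {1..n}" "x j \<noteq> y j"
    using cube_eqI assms by blast
  then have "1 + x j * y j = 0"
    using cube_coord[OF assms(1) j(1)] cube_coord[OF assms(2) j(1)] by auto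
  then show ?thesis
    using False j(1) unfolding kern_def by (auto intro!: prod_zero bexI[of _ j])
qed

lemma noise_diff: "noise n \<theta> (\<lambda>x. f x - g x) x = noise n \<theta> f x - noise n \<theta> g x"
  by (simp add: noise_def sum_subtractf scaleR_diff_right)

lemma noise_scaleR: "noise n \<theta> (\<lambda>x. c *\<^sub>R f x) x = c *\<^sub>R noise n \<theta> f x"
  by (simp add: noise_def scaleR_sum_right mult.commute)

lemma noise_const [simp]: "noise n \<theta> (\<lambda>x. c) x = c"
  by (simp add: noise_def flip: scaleR_sum_left) (simp add: kern_sum)

lemma noise_one: "x \<in> cube n \<Longrightarrow> noise n (\<lambda>_. 1) f x = f x"
proof -
  assume x: "x \<in> cube n"
  have "noise n (\<lambda>_. 1) f x = (\<Sum>y\<in>cube n. if y = x then f y else 0)"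
    unfolding noise_def using x by (intro sum.cong) (auto simp: kern_one)
  then show ?thesis using x by simp
qed

lemma noise_noise: "noise n \<theta> (noise n \<theta>' f) x = noise n (\<lambda>j. \<theta> j * \<theta>' j) f x"
proof -
  have "noise n \<theta> (noise n \<theta>' f) x = (\<Sum>y\<in>cube n. \<Sum>z\<in>cube n. (kern n \<theta> x y * kern n \<theta>' y z) *\<^sub>R f z)"
    by (simp add: noise_def scaleR_sum_right)
  also have "\<dots> = (\<Sum>z\<in>cube n. (\<Sum>y\<in>cube n. kern n \<theta> x y * kern n \<theta>' y z) *\<^sub>R f z)"
    by (subst sum.swap) (simp add: scaleR_sum_left)
  finally show ?thesis by (simp add: kern_semigroup noise_def)
qed

lemma avg_noise: "avg n (noise n \<theta> f) = avg n f"
proof -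
  have "(\<Sum>x\<in>cube n. noise n \<theta> f x) = (\<Sum>y\<in>cube n. (\<Sum>x\<in>cube n. kern n \<theta> y x) *\<^sub>R f y)"
    unfolding noise_def by (subst sum.swap) (simp add: scaleR_sum_left kern_commute[of n \<theta>])
  then show ?thesis by (simp add: avg_def kern_sum)
qed

lemma avg_inner_noise:
  fixes f g :: "(nat \<Rightarrow> real) \<Rightarrow> 'a::real_inner"
  shows "avg n (\<lambda>x. inner (noise n \<theta> f x) (g x)) = avg n (\<lambda>x. inner (f x) (noise n \<theta> g x))"
proof -
  have "(\<Sum>x\<in>cube n. inner (noise n \<theta> f x) (g x))
      = (\<Sum>x\<in>cube n. \<Sum>y\<in>cube n. kern n \<theta> x y * inner (f y) (g x))"
    by (simp add: noise_def inner_sum_left)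
  also have "\<dots> = (\<Sum>y\<in>cube n. \<Sum>x\<in>cube n. kern n \<theta> x y * inner (f y) (g x))"
    by (rule sum.swap)
  also have "\<dots> = (\<Sum>x\<in>cube n. inner (f x) (noise n \<theta> g x))"
    by (simp add: noise_def inner_sum_right kern_commute)
  finally show ?thesis by (simp add: avg_def)
qed

lemma norm_noise_le:
  fixes f :: "(nat \<Rightarrow> real) \<Rightarrow> 'a::real_normed_vector"
  assumes "\<And>j. \<bar>\<theta> j\<bar> \<le> 1" "x \<in> cube n"
  shows "norm (noise n \<theta> f x) \<le> noise n \<theta> (\<lambda>y. norm (f y)) x"
proof -
  have "norm (noise n \<theta> f x) \<le> (\<Sum>y\<in>cube n. norm (kern n \<theta> x y *\<^sub>R f y))"
    unfolding noise_def by (rule norm_sum)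
  also have "\<dots> = noise n \<theta> (\<lambda>y. norm (f y)) x"
    unfolding noise_def using assms by (intro sum.cong) (auto simp: kern_nonneg)
  finally show ?thesis .
qed

lemma cdiff_noise:
  assumes "j \<in> {1..n}"
  shows "cdiff j (noise n \<theta> f) x = noise n \<theta> (cdiff j f) x"
proof -
  have "noise n \<theta> f (flip j x) = (\<Sum>y\<in>cube n. kern n \<theta> x (flip j y) *\<^sub>R f y)"
    by (simp add: noise_def kern_flip)
  also have "\<dots> = (\<Sum>y\<in>cube n. kern n \<theta> x (flip j (flip j y)) *\<^sub>R f (flip j y))"
    by (rule sum_cube_flip[OF assms, symmetric])
  finally have "noise n \<theta> f (flip j x) = noise n \<theta> (\<lambda>y. f (flip j y)) x"
    by (simp add: noise_def)
  then show ?thesis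
    by (simp add: cdiff_def[abs_def] noise_diff noise_scaleR)
qed

lemma cdiff_flip: "cdiff j f (flip j x) = - cdiff j f x"
  by (simp add: cdiff_def scaleR_diff_right)

lemma Young_powr:
  fixes u v p :: real
  assumes "1 < p" "0 \<le> u" "0 \<le> v"
  shows "u * v powr (p - 1) \<le> u powr p / p + (1 - 1/p) * v powr p"
proof -
  have "u * v powr (p - 1) \<le> u powr p / p + (v powr (p - 1)) powr (p / (p - 1)) / (p / (p - 1))"
    by (rule Youngs_inequality) (use assms in \<open>auto simp: field_simps\<close>)
  also have "(v powr (p - 1)) powr (p / (p - 1)) / (p / (p - 1)) = (1 - 1/p) * v powr p"
    using assms by (simp add: powr_powr) (simp add: field_simps)
  finally show ?thesis .
qed

text \<open>
  Jensen's inequality follows from Young's inequality applied between each \<open>h\<^sub>i\<close> and the mean. In contrast to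
  convexity on the open half line, this allows the value \<open>0\<close>.
\<close>

lemma Jensen_powr:
  fixes w h :: "'i \<Rightarrow> real"
  assumes p: "1 \<le> p" and w1: "(\<Sum>i\<in>S. w i) = 1" and w: "\<And>i. i \<in> S \<Longrightarrow> 0 \<le> w i"
    and h: "\<And>i. i \<in> S \<Longrightarrow> 0 \<le> h i"
  shows "(\<Sum>i\<in>S. w i * h i) powr p \<le> (\<Sum>i\<in>S. w i * h i powr p)"
proof (cases "p = 1")
  case True
  then show ?thesis using w h by (simp add: sum_nonneg)
next
  case False
  then have p: "1 < p" using p by simp
  define z where "z = (\<Sum>i\<in>S. w i * h i)"
  have z: "0 \<le> z" unfolding z_def using w h by (intro sum_nonneg) auto
  have "z powr p = (\<Sum>i\<in>S. w i * (h i * z powr (p - 1)))"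
    using powr_mult_base[OF z, of "p - 1"] by (simp add: z_def sum_distrib_right mult.assoc)
  also have "\<dots> \<le> (\<Sum>i\<in>S. w i * (h i powr p / p + (1 - 1/p) * z powr p))"
    using w h z p by (intro sum_mono mult_left_mono Young_powr) auto
  also have "\<dots> = (\<Sum>i\<in>S. w i * h i powr p) / p + (\<Sum>i\<in>S. w i) * ((1 - 1/p) * z powr p)"
    by (simp add: distrib_left sum.distrib sum_divide_distrib sum_distrib_right)
  finally have "z powr p / p \<le> (\<Sum>i\<in>S. w i * h i powr p) / p"
    by (simp add: w1 algebra_simps)
  then show ?thesis using p by (simp add: z_def divide_le_cancel)
qed

lemma noise_powr_le:
  fixes h :: "(nat \<Rightarrow> real) \<Rightarrow> real"
  assumes "\<And>j. \<bar>\<theta> j\<bar> \<le> 1" "x \<in> cube n" "1 \<le> p" "\<And>y. y \<in> cube n \<Longrightarrow> 0 \<le> h y"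
  shows "(noise n \<theta> h x) powr p \<le> noise n \<theta> (\<lambda>y. h y powr p) x"
  unfolding noise_def real_scaleR_def
  by (rule Jensen_powr) (auto simp: assms kern_nonneg kern_sum)

lemma avg_noise_powr_le:
  fixes h :: "(nat \<Rightarrow> real) \<Rightarrow> real"
  assumes "\<And>j. \<bar>\<theta> j\<bar> \<le> 1" "1 \<le> p" "\<And>y. y \<in> cube n \<Longrightarrow> 0 \<le> h y"
  shows "avg n (\<lambda>x. (noise n \<theta> h x) powr p) \<le> avg n (\<lambda>y. h y powr p)"
proof -
  have "avg n (\<lambda>x. (noise n \<theta> h x) powr p) \<le> avg n (noise n \<theta> (\<lambda>y. h y powr p))"
    by (intro avg_mono noise_powr_le assms)
  then show ?thesis by (simp add: avg_noise)
qed

subsection \<open>Fourier--Walsh expansion\<close>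

lemma walsh_expand:
  assumes "x \<in> cube n"
  shows "noise n \<theta> f x = (\<Sum>A\<in>Pow {1..n}. ((\<Prod>j\<in>A. \<theta> j) * rwalsh A x) *\<^sub>R walsh_coeff n f A)"
proof -
  have "noise n \<theta> f x =
      (\<Sum>y\<in>cube n. \<Sum>A\<in>Pow {1..n}. (((\<Prod>j\<in>A. \<theta> j) * rwalsh A x) / 2 ^ n) *\<^sub>R (rwalsh A y *\<^sub>R f y))"
    unfolding noise_def kern_walsh by (simp add: sum_divide_distrib scaleR_sum_left)
  also have "\<dots> = (\<Sum>A\<in>Pow {1..n}. \<Sum>y\<in>cube n. (((\<Prod>j\<in>A. \<theta> j) * rwalsh A x) / 2 ^ n) *\<^sub>R (rwalsh A y *\<^sub>R f y))"
    by (rule sum.swap)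
  finally show ?thesis
    by (simp add: walsh_coeff_def avg_def scaleR_sum_right divide_inverse mult_ac)
qed

lemma walsh_inversion:
  assumes "x \<in> cube n"
  shows "f x = (\<Sum>A\<in>Pow {1..n}. rwalsh A x *\<^sub>R walsh_coeff n f A)"
  using walsh_expand[OF assms, of "\<lambda>_. 1" f] noise_one[OF assms, of f] by simp

lemma rwalsh_flip: "finite A \<Longrightarrow> rwalsh A (flip j x) = (if j \<in> A then - rwalsh A x else rwalsh A x)"
proof (cases "j \<in> A")
  case True
  assume "finite A"
  then show ?thesis using True
    by (simp add: rwalsh_def prod.remove[of A j] flip_def cong: prod.cong_simp)
next
  case False
  then show ?thesis by (auto simp: rwalsh_def flip_def intro!: prod.cong)
qed

lemma cdiff_rwalsh: "finite A \<Longrightarrow> cdiff j (\<lambda>x. rwalsh A x *\<^sub>R c) x = (if j \<in> A then rwalsh A x *\<^sub>R c else 0)"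
  by (simp add: cdiff_def rwalsh_flip flip: scaleR_left.diff)

lemma cdiff_scaleR: "cdiff j (\<lambda>x. c *\<^sub>R f x) x = c *\<^sub>R cdiff j f x"
  by (simp add: cdiff_def scaleR_diff_right mult.commute)

lemma cdiff_sum: "cdiff j (\<lambda>x. \<Sum>i\<in>I. f i x) x = (\<Sum>i\<in>I. cdiff j (f i) x)"
  by (simp add: cdiff_def sum_subtractf flip: scaleR_sum_right)

lemma cdiff_cong:
  "(\<And>y. y \<in> cube n \<Longrightarrow> f y = g y) \<Longrightarrow> x \<in> cube n \<Longrightarrow> j \<in> {1..n} \<Longrightarrow> cdiff j f x = cdiff j g x"
  by (simp add: cdiff_def flip_cube)

lemma noise_nonneg:
  fixes f :: "(nat \<Rightarrow> real) \<Rightarrow> real"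
  assumes "\<And>j. \<bar>\<theta> j\<bar> \<le> 1" "x \<in> cube n" "\<And>y. y \<in> cube n \<Longrightarrow> 0 \<le> f y"
  shows "0 \<le> noise n \<theta> f x"
  unfolding noise_def real_scaleR_def
  by (intro sum_nonneg mult_nonneg_nonneg) (auto simp: assms kern_nonneg)

section \<open>Random subcubes\<close>

text \<open>
  This is the dilation that replaces the semigroup by martingales. Coordinate \<open>j\<close> receives a random
  level \<open>T\<^sub>j\<close> with \<open>P(T\<^sub>j \<le> m) = \<theta>\<^sub>m\<close>, independently of the others. The operator with constant parameter \<open>\<theta>\<^sub>m\<close> is then the
  average of the conditional expectations onto the coordinates of level at most \<open>m\<close>. What matters is that one choice of \<open>T\<close>
  yields an increasing chain of sets for all \<open>m\<close> simultaneously.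
\<close>

lemma noise_mixture:
  fixes \<theta> :: "nat \<Rightarrow> real"
  assumes "0 \<le> \<theta> 0" "\<forall>m<M. \<theta> m \<le> \<theta> (Suc m)" "\<theta> M \<le> 1"
  obtains I :: "(nat \<Rightarrow> nat) set" and W :: "(nat \<Rightarrow> nat) \<Rightarrow> real" and S :: "(nat \<Rightarrow> nat) \<Rightarrow> nat \<Rightarrow> nat set"
  where "finite I" "(\<Sum>T\<in>I. W T) = 1" "\<And>T. T \<in> I \<Longrightarrow> 0 \<le> W T" "\<And>T m. S T m \<subseteq> S T (Suc m)"
    "\<And>m x y. m \<le> M \<Longrightarrow> kern n (\<lambda>_. \<theta> m) x y = (\<Sum>T\<in>I. W T * kern n (indicator (S T m)) x y)"
proof -
  \<comment> \<open>The distribution of a single level; the last value \<open>Suc M\<close> collects the coordinates that never enter.\<close>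
  define w where "w t = (if t = 0 then \<theta> 0 else if t \<le> M then \<theta> t - \<theta> (t - 1) else 1 - \<theta> M)" for t :: nat
  define B where "B = {..Suc M}"
  define I where "I = {1..n} \<rightarrow>\<^sub>E B"
  define W where "W T = (\<Prod>j\<in>{1..n}. w (T j))" for T
  define S where "S T m = {j. T j \<le> m}" for T :: "nat \<Rightarrow> nat" and m
  have w0: "0 \<le> w t" if "t \<in> B" for t
    using assms that unfolding w_def B_def by (cases t) (auto simp: Suc_le_eq)
  have ps: "(\<Sum>t\<le>m. w t) = \<theta> m" if "m \<le> M" for m
    using that by (induction m) (auto simp: w_def)
  have tot: "(\<Sum>t\<in>B. w t) = 1"
    using ps[of M] by (simp add: B_def) (simp add: w_def)
  have mix: "(\<Sum>t\<in>B. w t * ((1 + indicator {..m} t * a) / 2)) = (1 + \<theta> m * a) / 2" if "m \<le> M" for m a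
  proof -
    have "(\<Sum>t\<in>B. w t * indicator {..m} t) = (\<Sum>t\<in>B \<inter> {..m}. w t)"
      by (subst sum.inter_restrict) (simp add: B_def, rule sum.cong, auto simp: indicator_def)
    also have "B \<inter> {..m} = {..m}" using that by (auto simp: B_def)
    finally have 1: "(\<Sum>t\<in>B. w t * indicator {..m} t) = \<theta> m" by (simp add: ps that)
    have "(\<Sum>t\<in>B. w t * ((1 + indicator {..m} t * a) / 2)) =
        (\<Sum>t\<in>B. w t) / 2 + (\<Sum>t\<in>B. w t * indicator {..m} t) * (a / 2)"
      by (simp add: sum_distrib_right sum_divide_distrib flip: sum.distrib) (simp add: field_simps)
    then show ?thesis by (simp add: 1 tot field_simps)
  qed
  show thesis
  proof (rule that[of I W S])
    show "finite I" unfolding I_def B_def by (intro finite_PiE) auto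
    have "(\<Prod>j\<in>{1..n}. \<Sum>t\<in>B. w t) = (\<Sum>T\<in>I. W T)"
      unfolding I_def W_def by (rule prod_sum_PiE) (auto simp: B_def)
    then show "(\<Sum>T\<in>I. W T) = 1" by (simp add: tot)
    show "0 \<le> W T" if "T \<in> I" for T
    proof -
      have "T j \<in> B" if "j \<in> {1..n}" for j
        using \<open>T \<in> I\<close> that unfolding I_def by (rule PiE_mem)
      then show ?thesis unfolding W_def by (intro prod_nonneg ballI w0)
    qed
    show "S T m \<subseteq> S T (Suc m)" for T m by (auto simp: S_def)
    show "kern n (\<lambda>_. \<theta> m) x y = (\<Sum>T\<in>I. W T * kern n (indicator (S T m)) x y)" if m: "m \<le> M" for m x y
    proof -
      have "kern n (\<lambda>_. \<theta> m) x y =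
          (\<Prod>j\<in>{1..n}. \<Sum>t\<in>B. w t * ((1 + indicator {..m} t * (x j * y j)) / 2))"
        unfolding kern_def by (intro prod.cong refl, subst mix[OF m]) (simp add: mult.assoc)
      also have "\<dots> = (\<Sum>T\<in>I. \<Prod>j\<in>{1..n}. w (T j) * ((1 + indicator {..m} (T j) * (x j * y j)) / 2))"
        unfolding I_def by (rule prod_sum_PiE) (auto simp: B_def)
      also have "\<dots> = (\<Sum>T\<in>I. W T * kern n (indicator (S T m)) x y)"
        unfolding W_def kern_def S_def prod.distrib
        by (intro sum.cong refl arg_cong2[where f = "(*)"] prod.cong) (auto simp: indicator_def)
      finally show ?thesis .
    qed
  qed
qed

lemma noise_mixture_apply:
  assumes "\<And>y. kern n \<theta> x y = (\<Sum>T\<in>I. W T * kern n (\<theta>' T) x y)"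
  shows "noise n \<theta> f x = (\<Sum>T\<in>I. W T *\<^sub>R noise n (\<theta>' T) f x)"
  unfolding noise_def assms scaleR_sum_left scaleR_sum_right
  by (subst sum.swap) simp

text \<open>
  Measurability with respect to the coordinates in \<open>S\<close>, for functions that are only relevant on the cube.
\<close>

definition depends_on :: "nat \<Rightarrow> nat set \<Rightarrow> ((nat \<Rightarrow> real) \<Rightarrow> 'a) \<Rightarrow> bool" where
  "depends_on n S h \<longleftrightarrow> (\<forall>x\<in>cube n. \<forall>y\<in>cube n. (\<forall>j\<in>S. x j = y j) \<longrightarrow> h x = h y)"

lemma depends_onI:
  assumes "\<And>x y. x \<in> cube n \<Longrightarrow> y \<in> cube n \<Longrightarrow> (\<And>j. j \<in> S \<Longrightarrow> x j = y j) \<Longrightarrow> h x = h y"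
  shows "depends_on n S h"
  unfolding depends_on_def
proof (intro ballI impI)
  fix x y assume x: "x \<in> cube n" and y: "y \<in> cube n" and e: "\<forall>j\<in>S. x j = y j"
  show "h x = h y" by (rule assms[OF x y bspec[OF e]])
qed

lemma depends_onD:
  assumes h: "depends_on n S h" and x: "x \<in> cube n" and y: "y \<in> cube n" and e: "\<And>j. j \<in> S \<Longrightarrow> x j = y j"
  shows "h x = h y"
  using h[unfolded depends_on_def, THEN bspec, OF x, THEN bspec, OF y, THEN mp, OF ballI[OF e]] .

lemma depends_on_mono: assumes "depends_on n S h" "S \<subseteq> S'" shows "depends_on n S' h"
proof (rule depends_onI)
  fix x y assume "x \<in> cube n" "y \<in> cube n" and e: "\<And>j. j \<in> S' \<Longrightarrow> x j = y j"
  then show "h x = h y" using depends_onD[OF assms(1), of x y] e subsetD[OF assms(2)] by fast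
qed

lemma depends_on_comp2:
  assumes "depends_on n S h" "depends_on n S k" shows "depends_on n S (\<lambda>x. g (h x) (k x))"
proof (rule depends_onI)
  fix x y assume "x \<in> cube n" "y \<in> cube n" and "\<And>j. j \<in> S \<Longrightarrow> x j = y j"
  then have "h x = h y" "k x = k y" using depends_onD[OF assms(1), of x y] depends_onD[OF assms(2), of x y] by fast+
  then show "g (h x) (k x) = g (h y) (k y)" by simp
qed

lemma depends_on_comp: "depends_on n S h \<Longrightarrow> depends_on n S (\<lambda>x. g (h x))"
  by (rule depends_on_comp2[where g = "\<lambda>a b. g a"])

lemma depends_on_sum:
  assumes "\<And>i. i \<in> I \<Longrightarrow> depends_on n S (h i)" shows "depends_on n S (\<lambda>x. \<Sum>i\<in>I. h i x)"
proof (rule depends_onI)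
  fix x y assume "x \<in> cube n" "y \<in> cube n" and e: "\<And>j. j \<in> S \<Longrightarrow> x j = y j"
  then have "h i x = h i y" if "i \<in> I" for i using depends_onD[OF assms[OF that], of x y] by fast
  then show "(\<Sum>i\<in>I. h i x) = (\<Sum>i\<in>I. h i y)" by simp
qed

lemma depends_on_noise: "depends_on n S (noise n (indicator S) f)"
proof (rule depends_onI)
  fix x y :: "nat \<Rightarrow> real" assume "\<And>j. j \<in> S \<Longrightarrow> x j = y j"
  then have "kern n (indicator S) x z = kern n (indicator S) y z" for z
    unfolding kern_def by (intro prod.cong) (auto simp: indicator_def)
  then show "noise n (indicator S) f x = noise n (indicator S) f y"
    by (simp add: noise_def)
qed

lemma kern_indicator_agree:
  assumes "x \<in> cube n" "y \<in> cube n" "kern n (indicator S) x y \<noteq> 0" "j \<in> S"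
  shows "x j = y j"
proof (cases "j \<in> {1..n}")
  case True
  then have "1 + indicator S j * x j * y j \<noteq> (0::real)"
    using assms(3) by (auto simp: kern_def)
  then show ?thesis
    using assms(4) cube_coord[OF assms(1) True] cube_coord[OF assms(2) True] by auto
next
  case False
  then show ?thesis using assms(1,2) unfolding cube_def by (auto simp: PiE_iff extensional_def)
qed

text \<open>
  The kernel of the conditional expectation onto \<open>S\<close> vanishes at pairs of points that differ somewhere on \<open>S\<close>.
\<close>

lemma noise_indicator_fix:
  assumes "depends_on n S g" "x \<in> cube n"
  shows "noise n (indicator S) g x = g x"
proof -
  have "noise n (indicator S) g x = (\<Sum>y\<in>cube n. kern n (indicator S) x y *\<^sub>R g x)"
    unfolding noise_def
  proof (intro sum.cong refl)
    fix y assume y: "y \<in> cube n"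
    show "kern n (indicator S) x y *\<^sub>R g y = kern n (indicator S) x y *\<^sub>R g x"
    proof (cases "kern n (indicator S) x y = 0")
      case False
      then have "g x = g y"
        by (intro depends_onD[OF assms(1)] assms(2) y kern_indicator_agree[OF assms(2) y])
      then show ?thesis by simp
    qed simp
  qed
  also have "\<dots> = g x" by (simp add: kern_sum flip: scaleR_sum_left)
  finally show ?thesis .
qed

lemma abs_indicator_le_1: "\<bar>indicator S j :: real\<bar> \<le> 1"
  by (simp add: indicator_def)

lemma noise_indicator_tower:
  assumes "S \<subseteq> S'"
  shows "noise n (indicator S) (noise n (indicator S') f) x = noise n (indicator S) f x"
proof -
  have "(\<lambda>j. indicator S j * indicator S' j :: real) = indicator S"
    using assms by (auto simp: indicator_def fun_eq_iff)
  then show ?thesis by (simp add: noise_noise)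
qed

lemma avg_inner_depends:
  fixes f g :: "(nat \<Rightarrow> real) \<Rightarrow> 'a::real_inner"
  assumes "depends_on n S g"
  shows "avg n (\<lambda>x. inner (g x) (noise n (indicator S) f x)) = avg n (\<lambda>x. inner (g x) (f x))"
proof -
  have "avg n (\<lambda>x. inner (g x) (noise n (indicator S) f x)) =
        avg n (\<lambda>x. inner (noise n (indicator S) g x) (f x))"
    by (rule avg_inner_noise[symmetric])
  also have "\<dots> = avg n (\<lambda>x. inner (g x) (f x))"
    by (intro avg_cong) (simp add: noise_indicator_fix[OF assms])
  finally show ?thesis .
qed

lemma chain_mono: "(\<And>m. S m \<subseteq> S (Suc m)) \<Longrightarrow> i \<le> j \<Longrightarrow> S i \<subseteq> (S j :: nat set)"
  by (rule lift_Suc_mono_le)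

section \<open>Martingale inequalities along a chain of subcubes\<close>

text \<open>
  Young's inequality closes an estimate of this shape without dividing by the unknown; both martingale inequalities end
  in this way.
\<close>

lemma avg_powr_absorb:
  fixes u v :: "(nat \<Rightarrow> real) \<Rightarrow> real"
  assumes p: "1 < p" and c: "0 \<le> c" and u: "\<And>x. x \<in> cube n \<Longrightarrow> 0 \<le> u x" and v: "\<And>x. x \<in> cube n \<Longrightarrow> 0 \<le> v x"
    and le: "avg n (\<lambda>x. v x powr p) \<le> c * avg n (\<lambda>x. u x * v x powr (p - 1))"
  shows "avg n (\<lambda>x. v x powr p) \<le> c powr p * avg n (\<lambda>x. u x powr p)"
proof -
  define X where "X = avg n (\<lambda>x. v x powr p)"
  have "X \<le> avg n (\<lambda>x. (c * u x) * v x powr (p - 1))"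
    using le by (simp add: X_def mult.assoc avg_cmult)
  also have "\<dots> \<le> avg n (\<lambda>x. (c powr p / p) * u x powr p + (1 - 1/p) * v x powr p)"
  proof (rule avg_mono)
    fix x assume x: "x \<in> cube n"
    have "(c * u x) * v x powr (p - 1) \<le> (c * u x) powr p / p + (1 - 1/p) * v x powr p"
      using c u[OF x] by (intro Young_powr p v x) auto
    then show "(c * u x) * v x powr (p - 1) \<le> (c powr p / p) * u x powr p + (1 - 1/p) * v x powr p"
      by (simp add: powr_mult)
  qed
  also have "\<dots> = (c powr p / p) * avg n (\<lambda>x. u x powr p) + (1 - 1/p) * X"
    unfolding avg_add avg_cmult X_def ..
  finally have "X / p \<le> (c powr p * avg n (\<lambda>x. u x powr p)) / p"
    by (simp add: algebra_simps)
  then show ?thesis using p by (simp add: divide_le_cancel X_def)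
qed

text \<open>
  Doob's maximal inequality, by induction along the chain: with \<open>h\<^sup>*\<^sub>m\<close> the running maximum, a new summand of the
  telescoping sum \<open>\<Sum> (h\<^sup>*\<^sub>m\<^bsup>p-1\<^esup> - h\<^sup>*\<^sub>m\<^sub>-\<^sub>1\<^bsup>p-1\<^esup>)\<close> is nonzero only where \<open>h\<^sup>*\<^sub>m = h\<^sub>m\<close>, and there \<open>h\<^sub>m\<close> may be exchanged
  for \<open>h\<close> inside the average, since the summand depends only on the coordinates in \<open>S\<^sub>m\<close>.
\<close>

lemma Doob_chain:
  fixes h :: "(nat \<Rightarrow> real) \<Rightarrow> real" and S :: "nat \<Rightarrow> nat set"
  assumes p: "1 < p" and h: "\<And>x. x \<in> cube n \<Longrightarrow> 0 \<le> h x" and S: "\<And>m. S m \<subseteq> S (Suc m)"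
  defines "mx \<equiv> \<lambda>m x. Max ((\<lambda>i. noise n (indicator (S i)) h x) ` {..m})"
  shows "avg n (\<lambda>x. mx M x powr p) \<le> (p / (p - 1)) powr p * avg n (\<lambda>x. h x powr p)"
proof -
  define hm where "hm i x = noise n (indicator (S i)) h x" for i x
  have hm0: "0 \<le> hm i x" if "x \<in> cube n" for i x
    unfolding hm_def by (intro noise_nonneg abs_indicator_le_1 that h)
  have mx_0: "mx 0 x = hm 0 x" for x by (simp add: mx_def hm_def)
  have mx_Suc: "mx (Suc m) x = max (hm (Suc m) x) (mx m x)" for m x
    unfolding mx_def hm_def atMost_Suc image_insert by (subst Max_insert) auto
  have mx0: "0 \<le> mx m x" if "x \<in> cube n" for m x
    using hm0[OF that] by (induction m) (auto simp: mx_0 mx_Suc max_def)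
  have dep_hm: "depends_on n (S m) (hm i)" if "i \<le> m" for i m
    unfolding hm_def using depends_on_noise chain_mono[of S, OF S that] by (rule depends_on_mono)
  have dep: "depends_on n (S m) (mx m)" for m
  proof (induction m)
    case 0
    then show ?case using dep_hm[of 0 0] by (simp add: mx_0[abs_def])
  next
    case (Suc m)
    show ?case unfolding mx_Suc[abs_def]
      by (rule depends_on_comp2[OF dep_hm depends_on_mono[OF Suc S]]) simp
  qed
  have mart: "avg n (\<lambda>x. g x * hm m x) = avg n (\<lambda>x. g x * h x)" if "depends_on n (S m) g" for g m
    using avg_inner_depends[OF that, of h] by (simp add: hm_def)
  have claim: "(1 - 1/p) * avg n (\<lambda>x. mx m x powr p) \<le> avg n (\<lambda>x. mx m x powr (p - 1) * h x)" for m
  proof (induction m)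
    case 0
    have "(1 - 1/p) * avg n (\<lambda>x. mx 0 x powr p) \<le> avg n (\<lambda>x. mx 0 x powr (p - 1) * hm 0 x)"
      unfolding avg_cmult[symmetric]
    proof (rule avg_mono)
      fix x assume "x \<in> cube n"
      then have "0 \<le> hm 0 x" by (rule hm0)
      moreover have "(1 - 1/p) * hm 0 x powr p \<le> hm 0 x powr p"
        using p by (intro mult_left_le_one_le) auto
      moreover have "hm 0 x powr p = hm 0 x powr (p - 1) * hm 0 x"
        using \<open>0 \<le> hm 0 x\<close> by (cases "hm 0 x = 0") (auto simp: powr_diff)
      ultimately show "(1 - 1/p) * mx 0 x powr p \<le> mx 0 x powr (p - 1) * hm 0 x"
        by (simp add: mx_0)
    qed
    also have "\<dots> = avg n (\<lambda>x. mx 0 x powr (p - 1) * h x)"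
      by (rule mart) (rule depends_on_comp[OF dep])
    finally show ?case .
  next
    case (Suc m)
    \<comment> \<open>Both sides vanish unless the maximum has just been renewed, in which case it equals the new value.\<close>
    have step: "(1 - 1/p) * (mx (Suc m) x powr p - mx m x powr p) \<le>
        (mx (Suc m) x powr (p - 1) - mx m x powr (p - 1)) * hm (Suc m) x" if x: "x \<in> cube n" for x
    proof (cases "mx m x \<le> hm (Suc m) x")
      case True
      then have e: "mx (Suc m) x = hm (Suc m) x" by (simp add: mx_Suc max_def)
      have "hm (Suc m) x * mx m x powr (p - 1) \<le> hm (Suc m) x powr p / p + (1 - 1/p) * mx m x powr p"
        by (rule Young_powr[OF p hm0[OF x] mx0[OF x]])
      moreover have "hm (Suc m) x powr p = hm (Suc m) x powr (p - 1) * hm (Suc m) x"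
        using hm0[OF x, of "Suc m"] by (cases "hm (Suc m) x = 0") (auto simp: powr_diff)
      ultimately show ?thesis using p by (simp add: e algebra_simps)
    next
      case False
      then show ?thesis by (simp add: mx_Suc max_def)
    qed
    have "(1 - 1/p) * avg n (\<lambda>x. mx (Suc m) x powr p) =
        (1 - 1/p) * avg n (\<lambda>x. mx m x powr p) + avg n (\<lambda>x. (1 - 1/p) * (mx (Suc m) x powr p - mx m x powr p))"
      unfolding avg_cmult avg_diff by (simp add: algebra_simps)
    also have "\<dots> \<le> avg n (\<lambda>x. mx m x powr (p - 1) * h x)
        + avg n (\<lambda>x. (mx (Suc m) x powr (p - 1) - mx m x powr (p - 1)) * hm (Suc m) x)"
      by (intro add_mono Suc avg_mono step)
    also have "avg n (\<lambda>x. (mx (Suc m) x powr (p - 1) - mx m x powr (p - 1)) * hm (Suc m) x)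
        = avg n (\<lambda>x. (mx (Suc m) x powr (p - 1) - mx m x powr (p - 1)) * h x)"
      by (rule mart) (rule depends_on_comp2[OF dep depends_on_mono[OF dep S]])
    also have "avg n (\<lambda>x. mx m x powr (p - 1) * h x) + \<dots> = avg n (\<lambda>x. mx (Suc m) x powr (p - 1) * h x)"
      unfolding avg_add[symmetric] by (rule avg_cong) (simp add: algebra_simps)
    finally show ?case .
  qed
  show ?thesis
  proof (rule avg_powr_absorb[OF p _ h mx0])
    show "0 \<le> p / (p - 1)" using p by simp
    have "t = (p / (p - 1)) * ((1 - 1/p) * t)" for t using p by (simp add: field_simps)
    then have "avg n (\<lambda>x. mx M x powr p) = (p / (p - 1)) * ((1 - 1/p) * avg n (\<lambda>x. mx M x powr p))" .
    also have "\<dots> \<le> (p / (p - 1)) * avg n (\<lambda>x. mx M x powr (p - 1) * h x)"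
      using p by (intro mult_left_mono claim) auto
    finally show "avg n (\<lambda>x. mx M x powr p) \<le> p / (p - 1) * avg n (\<lambda>x. h x * mx M x powr (p - 1))"
      by (simp add: mult.commute)
  qed
qed

text \<open>
  The square function \<open>A\<^sub>k = \<Sum>\<^sub>i\<^sub><\<^sub>k |d\<^sub>i|\<^sup>2\<close> is controlled by any majorant \<open>B\<close> of the martingale squared. The induction along
  the chain carries the term \<open>|f\<^sub>k|\<^sup>2 A\<^sub>k\<^bsup>r-1\<^esup>\<close>: orthogonality of \<open>d\<^sub>k\<close> to functions of the first coordinates
  turns \<open>|d\<^sub>k|\<^sup>2 A\<^sub>k\<^bsup>r-1\<^esup>\<close> into \<open>(|f\<^sub>k\<^sub>+\<^sub>1|\<^sup>2 - |f\<^sub>k|\<^sup>2) A\<^sub>k\<^bsup>r-1\<^esup>\<close>, and the jump of \<open>A\<^bsup>r-1\<^esup>\<close> is multiplied by at most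
  \<open>|d\<^sub>k|\<^sup>2 \<le> 4 B\<close>. The linear growth of the base \<open>5 r\<close> in \<open>r\<close> is what later yields \<open>\<surd>q\<close>.
\<close>

lemma Garsia_chain:
  fixes \<phi> :: "'j \<Rightarrow> (nat \<Rightarrow> real) \<Rightarrow> 'a::real_inner" and S :: "nat \<Rightarrow> nat set" and n :: nat
  assumes r: "1 < r" and J: "finite J" and S: "\<And>m. S m \<subseteq> S (Suc m)"
  defines "f \<equiv> \<lambda>k j x. noise n (indicator (S k)) (\<phi> j) x"
  assumes B: "\<And>x k. x \<in> cube n \<Longrightarrow> k \<le> M \<Longrightarrow> (\<Sum>j\<in>J. (norm (f k j x))\<^sup>2) \<le> B x"
  shows "avg n (\<lambda>x. (\<Sum>i<M. \<Sum>j\<in>J. (norm (f (Suc i) j x - f i j x))\<^sup>2) powr r)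
    \<le> (5 * r) powr r * avg n (\<lambda>x. B x powr r)"
proof -
  define A where "A k x = (\<Sum>i<k. \<Sum>j\<in>J. (norm (f (Suc i) j x - f i j x))\<^sup>2)" for k x
  define d where "d k x = (\<Sum>j\<in>J. (norm (f (Suc k) j x - f k j x))\<^sup>2)" for k x
  define F where "F k x = (\<Sum>j\<in>J. (norm (f k j x))\<^sup>2)" for k x
  have A_Suc: "A (Suc k) x = A k x + d k x" for k x by (simp add: A_def d_def)
  have d0: "0 \<le> d k x" for k x by (simp add: d_def sum_nonneg)
  have A0: "0 \<le> A k x" for k x by (simp add: A_def sum_nonneg)
  have F0: "0 \<le> F k x" for k x by (simp add: F_def sum_nonneg)
  have FB: "F k x \<le> B x" if "x \<in> cube n" "k \<le> M" for k x
    using B that by (simp add: F_def)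
  have B0: "0 \<le> B x" if "x \<in> cube n" for x
    using FB[OF that, of 0] F0[of 0 x] by simp
  have dB: "d k x \<le> 4 * B x" if x: "x \<in> cube n" and k: "Suc k \<le> M" for k x
  proof -
    have "(norm (a - b))\<^sup>2 \<le> 2 * (norm a)\<^sup>2 + 2 * (norm b)\<^sup>2" for a b :: 'a
      using zero_le_power2[of "norm (a + b)"]
      by (simp add: power2_norm_eq_inner inner_simps inner_commute)
    then have "d k x \<le> (\<Sum>j\<in>J. 2 * (norm (f (Suc k) j x))\<^sup>2 + 2 * (norm (f k j x))\<^sup>2)"
      unfolding d_def by (intro sum_mono)
    also have "\<dots> = 2 * F (Suc k) x + 2 * F k x"
      by (simp add: F_def sum.distrib sum_distrib_left)
    also have "\<dots> \<le> 4 * B x" using FB[OF x, of "Suc k"] FB[OF x, of k] k by simp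
    finally show ?thesis .
  qed
  have dep_f: "depends_on n (S k) (f i j)" if "i \<le> k" for i j k
    unfolding f_def using depends_on_noise chain_mono[of S, OF S that] by (rule depends_on_mono)
  have dep_A: "depends_on n (S k) (A k)" for k
    unfolding A_def
    by (intro depends_on_sum depends_on_comp2[where g = "\<lambda>a b. (norm (a - b))\<^sup>2"] dep_f) auto
  have orth: "avg n (\<lambda>x. d k x * A k x powr (r - 1)) = avg n (\<lambda>x. (F (Suc k) x - F k x) * A k x powr (r - 1))" for k
  proof -
    have "avg n (\<lambda>x. A k x powr (r - 1) * inner (f k j x) (f (Suc k) j x)) =
          avg n (\<lambda>x. A k x powr (r - 1) * inner (f k j x) (f k j x))" for j
    proof -
      have dp: "depends_on n (S k) (\<lambda>x. A k x powr (r - 1) *\<^sub>R f k j x)"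
        by (rule depends_on_comp2[OF dep_A dep_f]) simp
      have "noise n (indicator (S k)) (f (Suc k) j) x = f k j x" for x
        unfolding f_def by (rule noise_indicator_tower[OF S])
      then show ?thesis using avg_inner_depends[OF dp, of "f (Suc k) j"] by simp
    qed
    then have *: "avg n (\<lambda>x. 2 * (A k x powr (r - 1) * inner (f k j x) (f (Suc k) j x))) =
          avg n (\<lambda>x. 2 * (A k x powr (r - 1) * (norm (f k j x))\<^sup>2))" for j
      unfolding avg_cmult by (simp add: power2_norm_eq_inner)
    have "avg n (\<lambda>x. d k x * A k x powr (r - 1)) = (\<Sum>j\<in>J. avg n (\<lambda>x. A k x powr (r - 1) * ((norm (f (Suc k) j x))\<^sup>2 + (norm (f k j x))\<^sup>2)
        - 2 * (A k x powr (r - 1) * inner (f k j x) (f (Suc k) j x))))"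
      unfolding avg_sum[symmetric] d_def sum_distrib_right
      by (intro avg_cong sum.cong refl)
         (simp add: power2_norm_eq_inner inner_simps inner_commute algebra_simps)
    also have "\<dots> = (\<Sum>j\<in>J. avg n (\<lambda>x. A k x powr (r - 1) * ((norm (f (Suc k) j x))\<^sup>2 + (norm (f k j x))\<^sup>2)
        - 2 * (A k x powr (r - 1) * (norm (f k j x))\<^sup>2)))"
      unfolding avg_diff * ..
    also have "\<dots> = avg n (\<lambda>x. (F (Suc k) x - F k x) * A k x powr (r - 1))"
      unfolding avg_sum[symmetric] F_def sum_subtractf[symmetric] sum_distrib_right
      by (intro avg_cong sum.cong refl) (simp add: algebra_simps)
    finally show ?thesis .
  qed
  have claim: "avg n (\<lambda>x. A k x powr r) / r \<le> avg n (\<lambda>x. (4 * B x + F k x) * A k x powr (r - 1))" if "k \<le> M" for k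
    using that
  proof (induction k)
    case 0
    then show ?case using r by (simp add: A_def)
  next
    case (Suc k)
    have step: "(A (Suc k) x powr r - A k x powr r) / r \<le>
       4 * B x * (A (Suc k) x powr (r - 1) - A k x powr (r - 1)) + d k x * A k x powr (r - 1)"
      if x: "x \<in> cube n" for x
    proof -
      have "A k x * A (Suc k) x powr (r - 1) \<le> A k x powr r / r + (1 - 1/r) * A (Suc k) x powr r"
        by (rule Young_powr[OF r A0 A0])
      moreover have "A (Suc k) x powr r = A (Suc k) x powr (r - 1) * A (Suc k) x"
        using A0[of "Suc k" x] by (cases "A (Suc k) x = 0") (auto simp: powr_diff)
      ultimately have "(A (Suc k) x powr r - A k x powr r) / r \<le> d k x * A (Suc k) x powr (r - 1)"
        by (simp add: A_Suc algebra_simps diff_divide_distrib)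
      also have "\<dots> = d k x * (A (Suc k) x powr (r - 1) - A k x powr (r - 1)) + d k x * A k x powr (r - 1)"
        by (simp add: algebra_simps)
      also have "d k x * (A (Suc k) x powr (r - 1) - A k x powr (r - 1)) \<le> 4 * B x * (A (Suc k) x powr (r - 1) - A k x powr (r - 1))"
      proof (rule mult_right_mono[OF dB[OF x Suc.prems]])
        have "A k x powr (r - 1) \<le> A (Suc k) x powr (r - 1)"
          using r A0 d0 by (intro powr_mono2) (auto simp: A_Suc)
        then show "0 \<le> A (Suc k) x powr (r - 1) - A k x powr (r - 1)" by simp
      qed
      finally show ?thesis by simp
    qed
    have "avg n (\<lambda>x. A (Suc k) x powr r) / r = avg n (\<lambda>x. A k x powr r) / r + avg n (\<lambda>x. (A (Suc k) x powr r - A k x powr r) / r)"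
      using avg_cmult[of n "1/r"] by (simp add: diff_divide_distrib avg_diff)
    also have "\<dots> \<le> avg n (\<lambda>x. (4 * B x + F k x) * A k x powr (r - 1)) +
       avg n (\<lambda>x. 4 * B x * (A (Suc k) x powr (r - 1) - A k x powr (r - 1)) + d k x * A k x powr (r - 1))"
      using Suc by (intro add_mono avg_mono step) auto
    also have "\<dots> = avg n (\<lambda>x. (4 * B x + F k x) * A k x powr (r - 1)) +
       avg n (\<lambda>x. 4 * B x * (A (Suc k) x powr (r - 1) - A k x powr (r - 1)) + (F (Suc k) x - F k x) * A k x powr (r - 1))"
      unfolding avg_add orth ..
    also have "\<dots> = avg n (\<lambda>x. 4 * B x * A (Suc k) x powr (r - 1) + F (Suc k) x * A k x powr (r - 1))"
      unfolding avg_add[symmetric] by (rule avg_cong) (simp add: algebra_simps)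
    also have "\<dots> \<le> avg n (\<lambda>x. (4 * B x + F (Suc k) x) * A (Suc k) x powr (r - 1))"
    proof (rule avg_mono)
      fix x
      have "A k x powr (r - 1) \<le> A (Suc k) x powr (r - 1)"
        using r A0 d0 by (intro powr_mono2) (auto simp: A_Suc)
      then show "4 * B x * A (Suc k) x powr (r - 1) + F (Suc k) x * A k x powr (r - 1) \<le> (4 * B x + F (Suc k) x) * A (Suc k) x powr (r - 1)"
        using F0 by (simp add: distrib_right mult_left_mono)
    qed
    finally show ?case .
  qed
  have "avg n (\<lambda>x. A M x powr r) \<le> (5 * r) powr r * avg n (\<lambda>x. B x powr r)"
  proof (rule avg_powr_absorb[OF r _ B0 A0])
    have "avg n (\<lambda>x. A M x powr r) \<le> r * avg n (\<lambda>x. (4 * B x + F M x) * A M x powr (r - 1))"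
      using claim[of M] r by (simp add: field_simps)
    also have "\<dots> \<le> r * avg n (\<lambda>x. 5 * (B x * A M x powr (r - 1)))"
      using r FB unfolding mult.assoc[symmetric] by (intro mult_left_mono avg_mono mult_right_mono) auto
    finally show "avg n (\<lambda>x. A M x powr r) \<le> 5 * r * avg n (\<lambda>x. B x * A M x powr (r - 1))"
      by (simp add: avg_cmult)
  qed (use r in auto)
  then show ?thesis by (simp add: A_def)
qed

text \<open>
  Minkowski's inequality for finitely many summands.
\<close>

lemma L2_set_sum_le: "finite Y \<Longrightarrow> L2_set (\<lambda>i. \<Sum>y\<in>Y. g y i) I \<le> (\<Sum>y\<in>Y. L2_set (g y) I)"
proof (induction Y rule: finite_induct)
  case (insert y Y)
  have "L2_set (\<lambda>i. \<Sum>y\<in>insert y Y. g y i) I = L2_set (\<lambda>i. g y i + (\<Sum>y\<in>Y. g y i)) I"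
    using insert by simp
  also have "\<dots> \<le> L2_set (g y) I + L2_set (\<lambda>i. \<Sum>y\<in>Y. g y i) I"
    by (rule L2_set_triangle_ineq)
  finally show ?case using insert by simp
qed (simp add: L2_set_0')

abbreviation l2norm :: "'j set \<Rightarrow> ('j \<Rightarrow> 'x \<Rightarrow> 'a::real_normed_vector) \<Rightarrow> 'x \<Rightarrow> real" where
  "l2norm J \<phi> x \<equiv> L2_set (\<lambda>j. norm (\<phi> j x)) J"

lemma noise_L2_le:
  fixes \<phi> :: "'j \<Rightarrow> (nat \<Rightarrow> real) \<Rightarrow> real"
  assumes "\<And>j. \<bar>\<theta> j\<bar> \<le> 1" "x \<in> cube n"
  shows "L2_set (\<lambda>j. noise n \<theta> (\<phi> j) x) J \<le> noise n \<theta> (\<lambda>y. L2_set (\<lambda>j. \<phi> j y) J) x"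
proof -
  have "L2_set (\<lambda>j. noise n \<theta> (\<phi> j) x) J \<le> (\<Sum>y\<in>cube n. L2_set (\<lambda>j. kern n \<theta> x y * \<phi> j y) J)"
    unfolding noise_def real_scaleR_def by (rule L2_set_sum_le) simp
  also have "\<dots> = noise n \<theta> (\<lambda>y. L2_set (\<lambda>j. \<phi> j y) J) x"
    unfolding noise_def real_scaleR_def
    by (intro sum.cong refl L2_set_right_distrib[symmetric] kern_nonneg assms)
  finally show ?thesis .
qed

lemma noise_family_le:
  fixes \<phi> :: "'j \<Rightarrow> (nat \<Rightarrow> real) \<Rightarrow> 'a::real_normed_vector"
  assumes "\<And>j. \<bar>\<theta> j\<bar> \<le> 1" "x \<in> cube n"
  shows "L2_set (\<lambda>j. norm (noise n \<theta> (\<phi> j) x)) J \<le> noise n \<theta> (\<lambda>y. l2norm J \<phi> y) x"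
proof -
  have "L2_set (\<lambda>j. norm (noise n \<theta> (\<phi> j) x)) J \<le> L2_set (\<lambda>j. noise n \<theta> (\<lambda>y. norm (\<phi> j y)) x) J"
    by (intro L2_set_mono norm_noise_le assms) auto
  also have "\<dots> \<le> noise n \<theta> (\<lambda>y. l2norm J \<phi> y) x"
    by (intro noise_L2_le assms)
  finally show ?thesis .
qed

lemma L2_set_sq: "(L2_set f J)\<^sup>2 = (\<Sum>j\<in>J. (f j)\<^sup>2)"
  by (simp add: L2_set_def sum_nonneg)

lemma square_function_chain:
  fixes \<phi> :: "'j \<Rightarrow> (nat \<Rightarrow> real) \<Rightarrow> 'a::real_inner" and S :: "nat \<Rightarrow> nat set" and n :: nat
  assumes q: "2 < q" and J: "finite J" and S: "\<And>m. S m \<subseteq> S (Suc m)"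
  defines "f \<equiv> \<lambda>k j x. noise n (indicator (S k)) (\<phi> j) x"
  shows "avg n (\<lambda>x. (\<Sum>i<M. \<Sum>j\<in>J. (norm (f (Suc i) j x - f i j x))\<^sup>2) powr (q/2))
    \<le> (10 * q) powr (q/2) * avg n (\<lambda>x. (l2norm J \<phi> x) powr q)"
proof -
  define h where "h x = l2norm J \<phi> x" for x
  define mx where "mx m x = Max ((\<lambda>i. noise n (indicator (S i)) h x) ` {..m})" for m x
  have h0: "0 \<le> h x" for x by (simp add: h_def)
  have noise0: "0 \<le> noise n (indicator (S k)) h x" if "x \<in> cube n" for k x
    by (intro noise_nonneg abs_indicator_le_1 that h0)
  have mx_ge: "noise n (indicator (S k)) h x \<le> mx M x" if "k \<le> M" for k x
    unfolding mx_def using that by (intro Max_ge) auto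
  have mx0: "0 \<le> mx M x" if "x \<in> cube n" for x
    using noise0[OF that, of 0] mx_ge[of 0 x] by simp
  have "avg n (\<lambda>x. (\<Sum>i<M. \<Sum>j\<in>J. (norm (f (Suc i) j x - f i j x))\<^sup>2) powr (q/2))
    \<le> (5 * (q/2)) powr (q/2) * avg n (\<lambda>x. ((mx M x)\<^sup>2) powr (q/2))"
    unfolding f_def
  proof (rule Garsia_chain)
    fix x k assume x: "x \<in> cube n" and k: "k \<le> M"
    have "(\<Sum>j\<in>J. (norm (noise n (indicator (S k)) (\<phi> j) x))\<^sup>2) = (L2_set (\<lambda>j. norm (noise n (indicator (S k)) (\<phi> j) x)) J)\<^sup>2"
      by (simp add: L2_set_sq)
    also have "\<dots> \<le> (noise n (indicator (S k)) h x)\<^sup>2"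
      unfolding h_def by (intro power_mono noise_family_le abs_indicator_le_1 x) auto
    also have "\<dots> \<le> (mx M x)\<^sup>2" by (intro power_mono mx_ge noise0 x k)
    finally show "(\<Sum>j\<in>J. (norm (noise n (indicator (S k)) (\<phi> j) x))\<^sup>2) \<le> (mx M x)\<^sup>2" .
  qed (use q J S in auto)
  also have "avg n (\<lambda>x. ((mx M x)\<^sup>2) powr (q/2)) = avg n (\<lambda>x. mx M x powr q)"
  proof (rule avg_cong)
    fix x assume "x \<in> cube n"
    then have "0 \<le> mx M x" by (rule mx0)
    then have "(mx M x)\<^sup>2 = mx M x powr 2" by simp
    then show "((mx M x)\<^sup>2) powr (q/2) = mx M x powr q" by (simp add: powr_powr)
  qed
  also have "avg n (\<lambda>x. mx M x powr q) \<le> (q / (q - 1)) powr q * avg n (\<lambda>x. h x powr q)"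
    unfolding mx_def using q S h0 by (intro Doob_chain) auto
  also have "\<dots> \<le> 2 powr q * avg n (\<lambda>x. h x powr q)"
    using q by (intro mult_right_mono powr_mono2 avg_nonneg) (auto simp: field_simps)
  also have "(5 * (q/2)) powr (q/2) * (2 powr q * avg n (\<lambda>x. h x powr q)) = (10 * q) powr (q/2) * avg n (\<lambda>x. h x powr q)"
  proof -
    have "2 powr q = (4::real) powr (q/2)"
      using powr_powr[of 2 2 "q/2"] by simp
    then have "(5 * (q/2)) powr (q/2) * 2 powr q = (5 * (q/2) * 4) powr (q/2)"
      using q by (simp only: powr_mult)
    then have "(5 * (q/2)) powr (q/2) * 2 powr q = (10 * q) powr (q/2)" by simp
    then show ?thesis by (simp add: mult.assoc[symmetric])
  qed
  finally show ?thesis using q by (simp add: h_def mult_left_mono)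
qed

section \<open>Passing to the noise semigroup\<close>

text \<open>
  The maximum of averages is at most the average of the maxima; Jensen's inequality moves the average over the
  random levels out of the power.
\<close>

lemma noise_maximal:
  fixes h :: "(nat \<Rightarrow> real) \<Rightarrow> real" and \<theta> :: "nat \<Rightarrow> real"
  assumes \<theta>: "0 \<le> \<theta> 0" "\<And>m. m < M \<Longrightarrow> \<theta> m \<le> \<theta> (Suc m)" "\<theta> M \<le> 1"
    and p: "1 < p" and h: "\<And>x. x \<in> cube n \<Longrightarrow> 0 \<le> h x"
  shows "avg n (\<lambda>x. Max ((\<lambda>m. noise n (\<lambda>_. \<theta> m) h x) ` {..M}) powr p)
    \<le> (p / (p - 1)) powr p * avg n (\<lambda>x. h x powr p)"
proof -
  let ?mx = "\<lambda>x. Max ((\<lambda>m. noise n (\<lambda>_. \<theta> m) h x) ` {..M})"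
  have \<theta>2: "\<forall>m<M. \<theta> m \<le> \<theta> (Suc m)" using \<theta>(2) by blast
  obtain I :: "(nat \<Rightarrow> nat) set" and W S where I: "finite I" "(\<Sum>T\<in>I. W T) = 1" "\<And>T. T \<in> I \<Longrightarrow> 0 \<le> W T"
    "\<And>T m. S T m \<subseteq> S T (Suc m)"
    and mix: "\<And>m x y. m \<le> M \<Longrightarrow> kern n (\<lambda>_. \<theta> m) x y = (\<Sum>T\<in>I. W T * kern n (indicator (S T m)) x y)"
    by (rule noise_mixture[OF \<theta>(1) \<theta>2 \<theta>(3), where n = n]) (rule that)
  define mx where "mx T x = Max ((\<lambda>i. noise n (indicator (S T i)) h x) ` {..M})" for T x
  have noise0: "0 \<le> noise n (indicator U) h x" if "x \<in> cube n" for U x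
    by (intro noise_nonneg abs_indicator_le_1 that h)
  have mx_ge: "noise n (indicator (S T k)) h x \<le> mx T x" if "k \<le> M" for k x T
    unfolding mx_def using that by (intro Max_ge) auto
  have mx0: "0 \<le> mx T x" if "x \<in> cube n" for x T
    using noise0[OF that] mx_ge[of 0 T x] by (meson le0 order_trans)
  have noi: "noise n (\<lambda>_. \<theta> m) h x = (\<Sum>T\<in>I. W T * noise n (indicator (S T m)) h x)" if "m \<le> M" for m x
    by (simp add: noise_mixture_apply[OF mix[OF that]])
  have "avg n (\<lambda>x. ?mx x powr p) \<le> avg n (\<lambda>x. \<Sum>T\<in>I. W T * mx T x powr p)"
  proof (rule avg_mono)
    fix x assume x: "x \<in> cube n"
    have "?mx x \<le> (\<Sum>T\<in>I. W T * mx T x)"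
      using I by (intro Max.boundedI) (auto simp: noi intro!: sum_mono mult_left_mono mx_ge)
    moreover have "0 \<le> ?mx x"
      using I noise0[OF x] noi[of 0 x] by (intro Max_ge_iff[THEN iffD2]) (auto intro!: sum_nonneg bexI[of _ 0])
    ultimately have "?mx x powr p \<le> (\<Sum>T\<in>I. W T * mx T x) powr p"
      using p by (intro powr_mono2) auto
    also have "\<dots> \<le> (\<Sum>T\<in>I. W T * mx T x powr p)"
      using I p mx0[OF x] by (intro Jensen_powr) auto
    finally show "?mx x powr p \<le> (\<Sum>T\<in>I. W T * mx T x powr p)" .
  qed
  also have "\<dots> = (\<Sum>T\<in>I. W T * avg n (\<lambda>x. mx T x powr p))"
    by (simp add: avg_sum avg_cmult)
  also have "\<dots> \<le> (\<Sum>T\<in>I. W T * ((p / (p - 1)) powr p * avg n (\<lambda>x. h x powr p)))"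
    unfolding mx_def using I p h by (intro sum_mono mult_left_mono Doob_chain) auto
  also have "\<dots> = (p / (p - 1)) powr p * avg n (\<lambda>x. h x powr p)"
    by (simp add: I flip: sum_distrib_right)
  finally show ?thesis .
qed

text \<open>
  Jensen's inequality is used twice for the random levels: for the square of each increment, and for the power \<open>q/2\<close>
  of the sum, where \<open>q \<ge> 2\<close> is essential.
\<close>

lemma noise_square_function:
  fixes \<phi> :: "'j \<Rightarrow> (nat \<Rightarrow> real) \<Rightarrow> 'a::real_inner" and \<theta> :: "nat \<Rightarrow> real"
  assumes \<theta>: "0 \<le> \<theta> 0" "\<And>m. m < M \<Longrightarrow> \<theta> m \<le> \<theta> (Suc m)" "\<theta> M \<le> 1"
    and q: "2 < q" and J: "finite J"
  shows "avg n (\<lambda>x. (\<Sum>i<M. \<Sum>j\<in>J.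
        (norm (noise n (\<lambda>_. \<theta> (Suc i)) (\<phi> j) x - noise n (\<lambda>_. \<theta> i) (\<phi> j) x))\<^sup>2) powr (q/2))
    \<le> (10 * q) powr (q/2) * avg n (\<lambda>x. (l2norm J \<phi> x) powr q)"
proof -
  let ?D = "\<lambda>i j x. (norm (noise n (\<lambda>_. \<theta> (Suc i)) (\<phi> j) x - noise n (\<lambda>_. \<theta> i) (\<phi> j) x))\<^sup>2"
  let ?V = "\<lambda>x. \<Sum>i<M. \<Sum>j\<in>J. (norm (noise n (\<lambda>_. \<theta> (Suc i)) (\<phi> j) x - noise n (\<lambda>_. \<theta> i) (\<phi> j) x))\<^sup>2"
  have \<theta>2: "\<forall>m<M. \<theta> m \<le> \<theta> (Suc m)" using \<theta>(2) by blast
  obtain I :: "(nat \<Rightarrow> nat) set" and W S where I: "finite I" "(\<Sum>T\<in>I. W T) = 1" "\<And>T. T \<in> I \<Longrightarrow> 0 \<le> W T"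
    "\<And>T m. S T m \<subseteq> S T (Suc m)"
    and mix: "\<And>m x y. m \<le> M \<Longrightarrow> kern n (\<lambda>_. \<theta> m) x y = (\<Sum>T\<in>I. W T * kern n (indicator (S T m)) x y)"
    by (rule noise_mixture[OF \<theta>(1) \<theta>2 \<theta>(3), where n = n]) (rule that)
  define d where "d T i j x = noise n (indicator (S T (Suc i))) (\<phi> j) x - noise n (indicator (S T i)) (\<phi> j) x" for T i j x
  have noi: "noise n (\<lambda>_. \<theta> m) (\<phi> j) x = (\<Sum>T\<in>I. W T *\<^sub>R noise n (indicator (S T m)) (\<phi> j) x)" if "m \<le> M" for m j x
    by (rule noise_mixture_apply[OF mix[OF that]])
  have one: "?D i j x
      \<le> (\<Sum>T\<in>I. W T * (norm (d T i j x))\<^sup>2)" if "i < M" for i j x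
  proof -
    have "noise n (\<lambda>_. \<theta> (Suc i)) (\<phi> j) x - noise n (\<lambda>_. \<theta> i) (\<phi> j) x = (\<Sum>T\<in>I. W T *\<^sub>R d T i j x)"
      using that by (simp add: noi d_def scaleR_diff_right sum_subtractf)
    then have "norm (noise n (\<lambda>_. \<theta> (Suc i)) (\<phi> j) x - noise n (\<lambda>_. \<theta> i) (\<phi> j) x) \<le> (\<Sum>T\<in>I. W T * norm (d T i j x))"
      using I by (auto intro!: sum_norm_le)
    then have "?D i j x \<le> (\<Sum>T\<in>I. W T * norm (d T i j x))\<^sup>2"
      by (intro power_mono) auto
    also have "\<dots> \<le> (\<Sum>T\<in>I. W T * (norm (d T i j x))\<^sup>2)"
      using Jensen_powr[OF _ I(2,3), of 2 "\<lambda>T. norm (d T i j x)"] I(3) by (simp add: sum_nonneg)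
    finally show ?thesis .
  qed
  have "avg n (\<lambda>x. ?V x powr (q/2))
    \<le> avg n (\<lambda>x. \<Sum>T\<in>I. W T * (\<Sum>i<M. \<Sum>j\<in>J. (norm (d T i j x))\<^sup>2) powr (q/2))"
  proof (rule avg_mono)
    fix x assume x: "x \<in> cube n"
    have "?V x
      \<le> (\<Sum>i<M. \<Sum>j\<in>J. \<Sum>T\<in>I. W T * (norm (d T i j x))\<^sup>2)"
      by (intro sum_mono one) auto
    also have "\<dots> = (\<Sum>T\<in>I. W T * (\<Sum>i<M. \<Sum>j\<in>J. (norm (d T i j x))\<^sup>2))"
      unfolding sum_distrib_left by (subst sum.swap[of _ I], subst sum.swap[of _ I]) (rule refl)
    finally have "?V x powr (q/2)
      \<le> (\<Sum>T\<in>I. W T * (\<Sum>i<M. \<Sum>j\<in>J. (norm (d T i j x))\<^sup>2)) powr (q/2)"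
      using q by (intro powr_mono2) (auto intro!: sum_nonneg)
    also have "\<dots> \<le> (\<Sum>T\<in>I. W T * (\<Sum>i<M. \<Sum>j\<in>J. (norm (d T i j x))\<^sup>2) powr (q/2))"
      using I q by (intro Jensen_powr) (auto intro!: sum_nonneg)
    finally show "?V x powr (q/2)
      \<le> (\<Sum>T\<in>I. W T * (\<Sum>i<M. \<Sum>j\<in>J. (norm (d T i j x))\<^sup>2) powr (q/2))" .
  qed
  also have "\<dots> = (\<Sum>T\<in>I. W T * avg n (\<lambda>x. (\<Sum>i<M. \<Sum>j\<in>J. (norm (d T i j x))\<^sup>2) powr (q/2)))"
    by (simp add: avg_sum avg_cmult)
  also have "\<dots> \<le> (\<Sum>T\<in>I. W T * ((10 * q) powr (q/2) * avg n (\<lambda>x. (l2norm J \<phi> x) powr q)))"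
    unfolding d_def using I q J by (intro sum_mono mult_left_mono square_function_chain) auto
  also have "\<dots> = (10 * q) powr (q/2) * avg n (\<lambda>x. (l2norm J \<phi> x) powr q)"
    by (simp add: I flip: sum_distrib_right)
  finally show ?thesis .
qed

section \<open>The heat semigroup and its energy in \<open>L\<^sub>p\<close>\<close>

text \<open>
  The graph of the concave function \<open>y\<^bsup>p-1\<^esup>\<close> lies below its tangent at \<open>x\<close>.
\<close>

lemma powr_tangent:
  fixes x y p :: real
  assumes p: "1 < p" "p < 2" and y: "0 < y" and x: "0 < x"
  shows "y powr (p - 1) \<le> x powr (p - 1) + (p - 1) * x powr (p - 2) * (y - x)"
proof -
  have "y powr (p - 1) * x powr (2 - p) \<le> (p - 1) * y + (2 - p) * x"
    using p y x by (intro Youngs_inequality_0) auto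
  then have "y powr (p - 1) * x powr (2 - p) * x powr (p - 2) \<le> ((p - 1) * y + (2 - p) * x) * x powr (p - 2)"
    by (intro mult_right_mono) auto
  moreover have "x powr (2 - p) * x powr (p - 2) = 1"
    using x by (simp flip: powr_add)
  moreover have "x * x powr (p - 2) = x powr (p - 1)"
    using x powr_mult_base[of x "p - 2"] by simp
  ultimately show ?thesis by (simp add: algebra_simps)
qed

text \<open>
  Strong monotonicity of \<open>v \<mapsto> |v|\<^bsup>p-2\<^esup> v\<close>. With the larger vector first, the difference of both sides is affine in the
  inner product with nonpositive slope, so collinear vectors are the worst case; there the claim is
  the tangent inequality.
\<close>

lemma duality_map_monotone:
  fixes a b :: "'a::real_inner"
  assumes p: "1 < p" "p < 2" and a: "a \<noteq> 0" and b: "b \<noteq> 0"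
  shows "(p - 1) * (norm (a - b))\<^sup>2 * (max (norm a) (norm b)) powr (p - 2)
    \<le> inner (norm a powr (p - 2) *\<^sub>R a - norm b powr (p - 2) *\<^sub>R b) (a - b)"
proof -
  have wlog: "(p - 1) * (norm (a - b))\<^sup>2 * norm a powr (p - 2)
    \<le> inner (norm a powr (p - 2) *\<^sub>R a - norm b powr (p - 2) *\<^sub>R b) (a - b)"
    if a: "a \<noteq> 0" and b: "b \<noteq> 0" and le: "norm b \<le> norm a" for a b :: 'a
  proof -
    define x y where "x = norm a" and "y = norm b"
    define \<alpha> \<beta> where "\<alpha> = x powr (p - 2)" and "\<beta> = y powr (p - 2)"
    define c where "c = inner a b"
    have xy: "0 < y" "y \<le> x" "0 < x" using a b le by (auto simp: x_def y_def)
    have ab: "\<alpha> \<le> \<beta>" unfolding \<alpha>_def \<beta>_def using p xy by (intro powr_mono2') auto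
    have a0: "0 < \<alpha>" using xy by (simp add: \<alpha>_def)
    have c: "c \<le> x * y" unfolding c_def x_def y_def by (rule norm_cauchy_schwarz)
    have "(p - 1) * \<alpha> \<le> 1 * \<alpha>" using p a0 by (intro mult_right_mono) auto
    then have coef: "0 \<le> \<alpha> + \<beta> - 2 * ((p - 1) * \<alpha>)" using ab by linarith
    have ax: "\<alpha> * x = x powr (p - 1)" "\<beta> * y = y powr (p - 1)"
      using xy powr_mult_base[of x "p - 2"] powr_mult_base[of y "p - 2"] by (auto simp: \<alpha>_def \<beta>_def mult.commute)
    have "y powr (p - 1) \<le> x powr (p - 1) + (p - 1) * \<alpha> * (y - x)"
      unfolding \<alpha>_def using p xy by (intro powr_tangent) auto
    then have "0 \<le> (\<alpha> * x - \<beta> * y - (p - 1) * \<alpha> * (x - y)) * (x - y)"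
      using xy by (intro mult_nonneg_nonneg) (auto simp: ax algebra_simps)
    also have "\<dots> = \<alpha> * x\<^sup>2 + \<beta> * y\<^sup>2 - (p - 1) * \<alpha> * (x\<^sup>2 + y\<^sup>2) - (x * y) * (\<alpha> + \<beta> - 2 * ((p - 1) * \<alpha>))"
      by (simp add: power2_eq_square algebra_simps)
    also have "\<dots> \<le> \<alpha> * x\<^sup>2 + \<beta> * y\<^sup>2 - (p - 1) * \<alpha> * (x\<^sup>2 + y\<^sup>2) - c * (\<alpha> + \<beta> - 2 * ((p - 1) * \<alpha>))"
      using mult_right_mono[OF c coef] by simp
    finally have "(p - 1) * (x\<^sup>2 + y\<^sup>2 - 2 * c) * \<alpha> \<le> \<alpha> * x\<^sup>2 + \<beta> * y\<^sup>2 - (\<alpha> + \<beta>) * c"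
      by (simp add: algebra_simps)
    moreover have "(norm (a - b))\<^sup>2 = x\<^sup>2 + y\<^sup>2 - 2 * c"
      by (simp add: x_def y_def c_def power2_norm_eq_inner inner_simps inner_commute)
    moreover have "inner (\<alpha> *\<^sub>R a - \<beta> *\<^sub>R b) (a - b) = \<alpha> * x\<^sup>2 + \<beta> * y\<^sup>2 - (\<alpha> + \<beta>) * c"
      by (simp add: x_def y_def c_def power2_norm_eq_inner inner_simps inner_commute algebra_simps)
    ultimately show ?thesis by (simp add: \<alpha>_def \<beta>_def x_def y_def)
  qed
  show ?thesis
  proof (cases "norm b \<le> norm a")
    case True
    then show ?thesis using wlog[OF a b] by (simp add: max_def)
  next
    case False
    moreover have "inner (norm b powr (p - 2) *\<^sub>R b - norm a powr (p - 2) *\<^sub>R a) (b - a) =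
        inner (norm a powr (p - 2) *\<^sub>R a - norm b powr (p - 2) *\<^sub>R b) (a - b)"
      by (simp add: inner_simps)
    ultimately show ?thesis using wlog[OF b a] by (simp add: max_def norm_minus_commute)
  qed
qed

text \<open>
  The weight is the larger of the two norms on the edge, to the negative power \<open>p - 2\<close>. The usual weight
  \<open>|u x|\<^bsup>p-2\<^esup>\<close> of the continuous theory would give an energy that the dissipation does not control,
  as there is no chain rule across an edge.
\<close>

definition energy :: "nat \<Rightarrow> real \<Rightarrow> ((nat \<Rightarrow> real) \<Rightarrow> 'a::real_normed_vector) \<Rightarrow> (nat \<Rightarrow> real) \<Rightarrow> real" where
  "energy n p u x =
    (\<Sum>j\<in>{1..n}. (norm (cdiff j u x))\<^sup>2 * (max (norm (u x)) (norm (u (flip j x)))) powr (p - 2))"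

abbreviation heat :: "nat \<Rightarrow> real \<Rightarrow> ((nat \<Rightarrow> real) \<Rightarrow> 'a::real_vector) \<Rightarrow> (nat \<Rightarrow> real) \<Rightarrow> 'a" where
  "heat n s \<equiv> noise n (\<lambda>_. exp (- s))"

lemma energy_nonneg: "0 \<le> energy n p u x"
  unfolding energy_def by (intro sum_nonneg) auto

lemma heat_expand:
  "x \<in> cube n \<Longrightarrow> heat n s f x = (\<Sum>A\<in>Pow {1..n}. (exp (- s * real (card A)) * rwalsh A x) *\<^sub>R walsh_coeff n f A)"
  by (simp add: walsh_expand) (simp add: exp_of_nat_mult[symmetric] mult.commute)

lemma sum_cdiff_rwalsh:
  assumes "A \<subseteq> {1..n}"
  shows "(\<Sum>j\<in>{1..n}. cdiff j (\<lambda>x. rwalsh A x *\<^sub>R c) x) = (real (card A) * rwalsh A x) *\<^sub>R c"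
proof -
  have fin: "finite A" using assms finite_subset by blast
  have "(\<Sum>j\<in>{1..n}. cdiff j (\<lambda>x. rwalsh A x *\<^sub>R c) x) = (\<Sum>j\<in>{1..n}. if j \<in> A then rwalsh A x *\<^sub>R c else 0)"
    by (simp add: cdiff_rwalsh[OF fin])
  also have "\<dots> = (\<Sum>j\<in>A. rwalsh A x *\<^sub>R c)"
    using assms by (subst sum.inter_restrict[symmetric]) (auto simp: Int_absorb1)
  finally show ?thesis by (simp add: sum_constant_scaleR)
qed

lemma sum_cdiff_expand:
  assumes x: "x \<in> cube n"
    and u: "\<And>y. y \<in> cube n \<Longrightarrow> u y = (\<Sum>A\<in>Pow {1..n}. (c A * rwalsh A y) *\<^sub>R v A)"
  shows "(\<Sum>j\<in>{1..n}. cdiff j u x) = (\<Sum>A\<in>Pow {1..n}. (real (card A) * c A * rwalsh A x) *\<^sub>R v A)"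
proof -
  have "(\<Sum>j\<in>{1..n}. cdiff j u x) = (\<Sum>j\<in>{1..n}. cdiff j (\<lambda>y. \<Sum>A\<in>Pow {1..n}. rwalsh A y *\<^sub>R (c A *\<^sub>R v A)) x)"
    using x by (intro sum.cong refl cdiff_cong[of n]) (auto simp: u mult.commute)
  also have "\<dots> = (\<Sum>A\<in>Pow {1..n}. \<Sum>j\<in>{1..n}. cdiff j (\<lambda>y. rwalsh A y *\<^sub>R (c A *\<^sub>R v A)) x)"
    unfolding cdiff_sum by (rule sum.swap)
  also have "\<dots> = (\<Sum>A\<in>Pow {1..n}. (real (card A) * c A * rwalsh A x) *\<^sub>R v A)"
    by (intro sum.cong refl) (subst sum_cdiff_rwalsh, auto simp: mult_ac)
  finally show ?thesis .
qed

text \<open>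
  The generator of the heat semigroup is the negative of the number operator \<open>\<Sum>\<^sub>j D\<^sub>j\<close>.
\<close>

lemma heat_deriv:
  fixes f :: "(nat \<Rightarrow> real) \<Rightarrow> 'a::real_normed_vector"
  assumes x: "x \<in> cube n"
  shows "((\<lambda>s. heat n s f x) has_vector_derivative - (\<Sum>j\<in>{1..n}. cdiff j (heat n s f) x)) (at s within T)"
proof -
  have "((\<lambda>s. \<Sum>A\<in>Pow {1..n}. (exp (- s * real (card A)) * rwalsh A x) *\<^sub>R walsh_coeff n f A) has_vector_derivative
        (\<Sum>A\<in>Pow {1..n}. (- real (card A) * exp (- s * real (card A)) * rwalsh A x) *\<^sub>R walsh_coeff n f A)) (at s within T)"
    by (intro has_vector_derivative_sum) (auto intro!: derivative_eq_intros)
  also have "(\<Sum>A\<in>Pow {1..n}. (- real (card A) * exp (- s * real (card A)) * rwalsh A x) *\<^sub>R walsh_coeff n f A)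
      = - (\<Sum>j\<in>{1..n}. cdiff j (heat n s f) x)"
    by (subst sum_cdiff_expand[OF x heat_expand]) (simp_all add: sum_negf[symmetric])
  finally show ?thesis by (simp add: heat_expand[OF x])
qed

lemma continuous_on_heat [continuous_intros]:
  fixes f :: "(nat \<Rightarrow> real) \<Rightarrow> 'a::real_normed_vector"
  assumes "continuous_on T t"
  shows "continuous_on T (\<lambda>s. heat n (t s) f x)"
proof -
  have "continuous_on T (\<lambda>s. \<Sum>y\<in>cube n. (\<Prod>j\<in>{1..n}. (1 + exp (- t s) * x j * y j) / 2) *\<^sub>R f y)"
    by (intro continuous_intros assms) auto
  then show ?thesis by (simp add: noise_def kern_def)
qed

lemma norm_powr_deriv:
  fixes u :: "real \<Rightarrow> 'a::real_inner"
  assumes u: "(u has_vector_derivative u') (at s within T)" and nz: "u s \<noteq> 0"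
  shows "((\<lambda>s. norm (u s) powr p) has_real_derivative p * norm (u s) powr (p - 2) * inner (u s) u') (at s within T)"
proof -
  have e: "norm v powr r = (inner v v) powr (r / 2)" for v :: 'a and r
    by (simp add: norm_eq_sqrt_inner powr_half_sqrt[symmetric] powr_powr)
  have u2: "(u has_derivative (\<lambda>h. h *\<^sub>R u')) (at s within T)"
    using u by (simp add: has_vector_derivative_def)
  have "((\<lambda>s. inner (u s) (u s)) has_derivative (\<lambda>h. inner (u s) (h *\<^sub>R u') + inner (h *\<^sub>R u') (u s))) (at s within T)"
    by (rule has_derivative_inner[OF u2 u2])
  then have d: "((\<lambda>s. inner (u s) (u s)) has_real_derivative 2 * inner (u s) u') (at s within T)"
    by (simp add: has_field_derivative_def inner_commute mult.commute algebra_simps mult_commute_abs)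
  have pos: "0 < inner (u s) (u s)" using nz by simp
  have "((\<lambda>s. inner (u s) (u s) powr (p/2)) has_real_derivative
      (p/2) * inner (u s) (u s) powr (p/2 - 1) * (2 * inner (u s) u')) (at s within T)"
    by (rule DERIV_chain2[OF has_real_derivative_powr[OF pos] d])
  then show ?thesis
    unfolding e by (simp add: diff_divide_distrib mult.assoc)
qed

lemma avg_inner_cdiff:
  fixes V u :: "(nat \<Rightarrow> real) \<Rightarrow> 'a::real_inner"
  assumes j: "j \<in> {1..n}"
  shows "2 * avg n (\<lambda>x. inner (V x) (cdiff j u x)) = avg n (\<lambda>x. inner (V x - V (flip j x)) (cdiff j u x))"
proof -
  have "avg n (\<lambda>x. inner (V x) (cdiff j u x)) = avg n (\<lambda>x. inner (V (flip j x)) (cdiff j u (flip j x)))"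
    using avg_flip[OF j, of "\<lambda>x. inner (V x) (cdiff j u x)"] by simp
  then have "2 * avg n (\<lambda>x. inner (V x) (cdiff j u x)) =
     avg n (\<lambda>x. inner (V x) (cdiff j u x)) + avg n (\<lambda>x. inner (V (flip j x)) (cdiff j u (flip j x)))" by simp
  then show ?thesis
    by (simp add: avg_add[symmetric] cdiff_flip inner_diff_left)
qed

text \<open>
  The right side is \<open>-1/p\<close> times the time derivative of \<open>\<parallel>u\<parallel>\<^sub>p\<^sup>p\<close> under the heat flow. Symmetrising every edge
  turns it into a sum of the expressions bounded below by monotonicity.
\<close>

lemma energy_le_dissipation:
  fixes u :: "(nat \<Rightarrow> real) \<Rightarrow> 'a::real_inner"
  assumes p: "1 < p" "p < 2" and nz: "\<And>x. x \<in> cube n \<Longrightarrow> u x \<noteq> 0"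
  shows "(p - 1) * avg n (energy n p u)
    \<le> avg n (\<lambda>x. norm (u x) powr (p - 2) * inner (u x) (\<Sum>j\<in>{1..n}. cdiff j u x))"
proof -
  define V where "V x = norm (u x) powr (p - 2) *\<^sub>R u x" for x
  define m where "m j x = (max (norm (u x)) (norm (u (flip j x)))) powr (p - 2)" for j x
  have one: "(p - 1) * avg n (\<lambda>x. (norm (cdiff j u x))\<^sup>2 * m j x) \<le> avg n (\<lambda>x. inner (V x) (cdiff j u x))"
    if j: "j \<in> {1..n}" for j
  proof -
    have "2 * ((p - 1) * avg n (\<lambda>x. (norm (cdiff j u x))\<^sup>2 * m j x))
        = avg n (\<lambda>x. 2 * ((p - 1) * ((norm (cdiff j u x))\<^sup>2 * m j x)))"
      unfolding avg_cmult ..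
    also have "\<dots> \<le> avg n (\<lambda>x. inner (V x - V (flip j x)) (cdiff j u x))"
    proof (rule avg_mono)
      fix x assume x: "x \<in> cube n"
      have "(p - 1) * (norm (u x - u (flip j x)))\<^sup>2 * m j x \<le> inner (V x - V (flip j x)) (u x - u (flip j x))"
        unfolding m_def V_def by (intro duality_map_monotone p nz x flip_cube j)
      then show "2 * ((p - 1) * ((norm (cdiff j u x))\<^sup>2 * m j x)) \<le> inner (V x - V (flip j x)) (cdiff j u x)"
        by (simp add: cdiff_def power_mult_distrib power2_eq_square mult_ac)
    qed
    also have "\<dots> = 2 * avg n (\<lambda>x. inner (V x) (cdiff j u x))"
      by (rule avg_inner_cdiff[OF j, symmetric])
    finally show ?thesis by simp
  qed
  have "(p - 1) * avg n (energy n p u) = (\<Sum>j\<in>{1..n}. (p - 1) * avg n (\<lambda>x. (norm (cdiff j u x))\<^sup>2 * m j x))"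
    unfolding energy_def[abs_def] m_def by (simp add: avg_sum sum_distrib_left)
  also have "\<dots> \<le> (\<Sum>j\<in>{1..n}. avg n (\<lambda>x. inner (V x) (cdiff j u x)))"
    by (intro sum_mono one)
  also have "\<dots> = avg n (\<lambda>x. norm (u x) powr (p - 2) * inner (u x) (\<Sum>j\<in>{1..n}. cdiff j u x))"
    unfolding avg_sum[symmetric] by (simp add: V_def inner_sum_right sum_distrib_left)
  finally show ?thesis .
qed

lemma moment_noise_le:
  fixes f :: "(nat \<Rightarrow> real) \<Rightarrow> 'a::real_normed_vector"
  assumes \<theta>: "\<And>j. \<bar>\<theta> j\<bar> \<le> 1" and r: "1 \<le> r"
  shows "moment n r (noise n \<theta> f) \<le> moment n r f"
proof -
  have "moment n r (noise n \<theta> f) \<le> avg n (\<lambda>x. (noise n \<theta> (\<lambda>y. norm (f y)) x) powr r)"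
    using r by (intro avg_mono powr_mono2 norm_noise_le \<theta>) auto
  also have "\<dots> \<le> moment n r f"
    by (intro avg_noise_powr_le \<theta> r) auto
  finally show ?thesis .
qed

lemma continuous_on_energy:
  fixes g :: "(nat \<Rightarrow> real) \<Rightarrow> 'a::real_inner"
  assumes nz: "\<And>s x. s \<in> T \<Longrightarrow> x \<in> cube n \<Longrightarrow> heat n s g x \<noteq> 0"
  shows "continuous_on T (\<lambda>s. avg n (energy n p (heat n s g)))"
  unfolding avg_def energy_def cdiff_def
  by (intro continuous_intros ballI) (auto simp: max_def nz)

text \<open>
  Nonvanishing of the flow makes \<open>|u\<^sub>s|\<^sup>p\<close> differentiable and the energy continuous in time.
\<close>

lemma energy_integral:
  fixes g :: "(nat \<Rightarrow> real) \<Rightarrow> 'a::real_inner"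
  assumes p: "1 < p" "p < 2" and ab: "0 \<le> a" "a \<le> b"
    and nz: "\<And>s x. 0 \<le> s \<Longrightarrow> x \<in> cube n \<Longrightarrow> heat n s g x \<noteq> 0"
  shows "(\<lambda>s. avg n (energy n p (heat n s g))) integrable_on {a..b}"
    and "(p - 1) * integral {a..b} (\<lambda>s. avg n (energy n p (heat n s g))) \<le> moment n p g"
proof -
  define e where "e s = avg n (energy n p (heat n s g))" for s
  define N where "N s = moment n p (heat n s g)" for s
  define N' where "N' s = avg n (\<lambda>x. p * norm (heat n s g x) powr (p - 2) *
      inner (heat n s g x) (- (\<Sum>j\<in>{1..n}. cdiff j (heat n s g) x)))" for s
  have int: "e integrable_on {a..b}"
    unfolding e_def using ab nz by (intro integrable_continuous_interval continuous_on_energy) auto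
  then show "(\<lambda>s. avg n (energy n p (heat n s g))) integrable_on {a..b}" by (simp add: e_def[abs_def])
  have deriv: "(N has_real_derivative N' s) (at s within {a..b})" if "s \<in> {a..b}" for s
    unfolding N_def N'_def avg_def real_scaleR_def
    using that ab by (intro DERIV_cmult DERIV_sum norm_powr_deriv heat_deriv nz) auto
  have N': "N' s \<le> - (p * (p - 1) * e s)" if "s \<in> {a..b}" for s
  proof -
    have "(p - 1) * e s \<le> avg n (\<lambda>x. norm (heat n s g x) powr (p - 2) * inner (heat n s g x) (\<Sum>j\<in>{1..n}. cdiff j (heat n s g) x))"
      unfolding e_def using that ab by (intro energy_le_dissipation p nz) auto
    then have "p * ((p - 1) * e s) \<le> p * avg n (\<lambda>x. norm (heat n s g x) powr (p - 2) * inner (heat n s g x) (\<Sum>j\<in>{1..n}. cdiff j (heat n s g) x))"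
      using p by (intro mult_left_mono) auto
    moreover have "N' s = - p * avg n (\<lambda>x. norm (heat n s g x) powr (p - 2) * inner (heat n s g x) (\<Sum>j\<in>{1..n}. cdiff j (heat n s g) x))"
      unfolding N'_def avg_cmult[symmetric] by (intro avg_cong) simp
    ultimately show ?thesis by simp
  qed
  have N0: "0 \<le> N b" unfolding N_def by (intro avg_nonneg) auto
  have I1: "(N' has_integral (N b - N a)) {a..b}"
    using deriv by (intro fundamental_theorem_of_calculus ab)
      (auto simp: has_real_derivative_iff_has_vector_derivative)
  have I2: "((\<lambda>s. - (p * (p - 1) * e s)) has_integral - (p * (p - 1) * integral {a..b} e)) {a..b}"
    by (intro has_integral_neg has_integral_mult_right integrable_integral int)
  have "N b - N a \<le> - (p * (p - 1) * integral {a..b} e)"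
    by (rule has_integral_le[OF I1 I2 N'])
  then have "p * ((p - 1) * integral {a..b} e) \<le> N a" using N0 by (simp add: mult.assoc)
  moreover have "0 \<le> integral {a..b} e"
    by (intro integral_nonneg int) (auto simp: e_def intro!: avg_nonneg energy_nonneg)
  then have "1 * ((p - 1) * integral {a..b} e) \<le> p * ((p - 1) * integral {a..b} e)"
    using p by (intro mult_right_mono) auto
  moreover have "N a \<le> moment n p g"
    unfolding N_def using ab p by (intro moment_noise_le) auto
  ultimately show "(p - 1) * integral {a..b} (\<lambda>s. avg n (energy n p (heat n s g))) \<le> moment n p g"
    by (simp add: e_def[abs_def])
qed

lemma sum_powr_le_powr_sum:
  fixes a :: "'i \<Rightarrow> real"
  assumes "finite I" "1 \<le> t" "\<And>i. i \<in> I \<Longrightarrow> 0 \<le> a i"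
  shows "(\<Sum>i\<in>I. a i powr t) \<le> (\<Sum>i\<in>I. a i) powr t"
proof -
  define S where "S = (\<Sum>i\<in>I. a i)"
  have S0: "0 \<le> S" using assms by (auto simp: S_def intro: sum_nonneg)
  have e: "v powr t = v * v powr (t - 1)" if "0 \<le> v" for v :: real
    using powr_mult_base[OF that, of "t - 1"] by simp
  have "(\<Sum>i\<in>I. a i powr t) \<le> (\<Sum>i\<in>I. a i * S powr (t - 1))"
  proof (rule sum_mono)
    fix i assume i: "i \<in> I"
    have "a i \<le> S" unfolding S_def using assms i by (intro member_le_sum) auto
    then show "a i powr t \<le> a i * S powr (t - 1)"
      using assms i by (subst e) (auto intro!: mult_left_mono powr_mono2)
  qed
  also have "\<dots> = S powr t" using e[OF S0] by (simp add: S_def sum_distrib_right)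
  finally show ?thesis by (simp add: S_def)
qed

text \<open>
  An edge is near if the norm at its other end is at most \<open>3 G\<close>, and far otherwise. On near edges the weight is at
  least \<open>(3G)\<^bsup>p-2\<^esup>\<close>. On far edges \<open>|D\<^sub>j u|\<close> is at least a third of the larger norm, so that the energy dominates
  \<open>|D\<^sub>j u|\<^sup>p\<close>.
\<close>

lemma gradient_le_energy:
  fixes u :: "(nat \<Rightarrow> real) \<Rightarrow> 'a::real_normed_vector"
  assumes p: "1 < p" "p < 2" and x: "x \<in> cube n" and nz: "\<And>y. y \<in> cube n \<Longrightarrow> u y \<noteq> 0"
    and G: "norm (u x) \<le> G"
  shows "(\<Sum>j\<in>{1..n}. (norm (cdiff j u x))\<^sup>2)
    \<le> 3 * G powr (2 - p) * energy n p u x + (3 * energy n p u x) powr (2 / p)"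
proof -
  define t where "t j = (norm (cdiff j u x))\<^sup>2 * (max (norm (u x)) (norm (u (flip j x)))) powr (p - 2)" for j
  have t0: "0 \<le> t j" for j by (simp add: t_def)
  have G0: "0 < G" using G nz[OF x] by (meson norm_le_zero_iff not_le order_trans)
  have one: "(norm (cdiff j u x))\<^sup>2 \<le> 3 * G powr (2 - p) * t j + (3 * t j) powr (2 / p)" if j: "j \<in> {1..n}" for j
  proof -
    define m where "m = max (norm (u x)) (norm (u (flip j x)))"
    define d where "d = norm (cdiff j u x)"
    have m0: "0 < m" using nz[OF x] by (simp add: m_def less_max_iff_disj)
    have tj: "t j = d\<^sup>2 * m powr (p - 2)" by (simp add: t_def m_def d_def)
    show ?thesis
    proof (cases "norm (u (flip j x)) \<le> 3 * G")
      case True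
      then have "m \<le> 3 * G" using G G0 by (simp add: m_def)
      have "d\<^sup>2 = t j * m powr (2 - p)"
        unfolding tj mult.assoc using m0 by (simp flip: powr_add)
      also have "\<dots> \<le> t j * (3 * G) powr (2 - p)"
        using \<open>m \<le> 3 * G\<close> m0 p t0 by (intro mult_left_mono powr_mono2) auto
      also have "(3 * G) powr (2 - p) = 3 powr (2 - p) * G powr (2 - p)"
        by (rule powr_mult)
      also have "t j * \<dots> \<le> t j * (3 * G powr (2 - p))"
        using p t0 powr_mono[of "2 - p" 1 3] by (intro mult_left_mono mult_right_mono) auto
      finally have "d\<^sup>2 \<le> 3 * G powr (2 - p) * t j" by (simp add: mult_ac)
      then show ?thesis unfolding d_def by (rule order_trans) simp
    next
      case False
      then have m: "m = norm (u (flip j x))" and G3: "3 * norm (u x) \<le> m" using G G0 by (auto simp: m_def)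
      have "m - norm (u x) \<le> norm (u x - u (flip j x))"
        unfolding m by (metis norm_minus_commute norm_triangle_ineq2)
      then have d: "m / 3 \<le> d" using G3 by (simp add: d_def cdiff_def)
      have d0: "0 < d" using d m0 by linarith
      have "d powr p = d\<^sup>2 * d powr (p - 2)"
        using d0 by (simp add: powr_add[symmetric] flip: powr_numeral)
      also have "\<dots> \<le> d\<^sup>2 * (m / 3) powr (p - 2)"
        using d m0 p by (intro mult_left_mono powr_mono2') auto
      also have "(m / 3) powr (p - 2) = m powr (p - 2) * 3 powr (2 - p)"
      proof -
        have "3 powr (2 - p) = 1 / (3::real) powr (p - 2)"
          using powr_minus_divide[of "3::real" "p - 2"] by simp
        moreover have "(m / 3) powr (p - 2) = m powr (p - 2) / 3 powr (p - 2)"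
          using m0 by (intro powr_divide; simp)
        ultimately show ?thesis by simp
      qed
      also have "d\<^sup>2 * \<dots> \<le> d\<^sup>2 * (m powr (p - 2) * 3)"
        using p powr_mono[of "2 - p" 1 3] by (intro mult_left_mono) auto
      finally have dp: "d powr p \<le> 3 * t j" by (simp add: tj mult_ac)
      have "d\<^sup>2 = (d powr p) powr (2 / p)"
        using p d0 by (simp add: powr_powr)
      also have "\<dots> \<le> (3 * t j) powr (2 / p)"
        using p dp by (intro powr_mono2) auto
      finally show ?thesis using t0 G0 by (simp add: d_def add_increasing)
    qed
  qed
  have "(\<Sum>j\<in>{1..n}. (norm (cdiff j u x))\<^sup>2) \<le> (\<Sum>j\<in>{1..n}. 3 * G powr (2 - p) * t j + (3 * t j) powr (2 / p))"
    by (intro sum_mono one)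
  also have "\<dots> = 3 * G powr (2 - p) * (\<Sum>j\<in>{1..n}. t j) + (\<Sum>j\<in>{1..n}. (3 * t j) powr (2 / p))"
    by (simp add: sum.distrib sum_distrib_left)
  also have "(\<Sum>j\<in>{1..n}. (3 * t j) powr (2 / p)) \<le> (\<Sum>j\<in>{1..n}. 3 * t j) powr (2 / p)"
    using p t0 by (intro sum_powr_le_powr_sum) auto
  finally show ?thesis by (simp add: energy_def t_def sum_distrib_left)
qed

text \<open>
  Near edges would tolerate the larger factor \<open>s\<close> in place of \<open>s\<^bsup>2/p\<^esup>\<close>, as \<open>s \<le> 1\<close>; far edges need exactly \<open>s\<^bsup>2/p\<^esup>\<close>, since
  \<open>\<Sum> a\<^sub>m\<^bsup>2/p\<^esup> \<le> (\<Sum> a\<^sub>m)\<^bsup>2/p\<^esup>\<close> is applied to \<open>a\<^sub>m = s\<^sub>m e\<^sub>m\<close>, with \<open>e\<^sub>m\<close> the energy at scale \<open>s\<^sub>m\<close>. Both contributions are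
  bounded through the maximum of \<open>G\<close> and the \<open>p\<close>-th root of the total energy.
\<close>

lemma gradient_square_function_le:
  fixes u :: "nat \<Rightarrow> (nat \<Rightarrow> real) \<Rightarrow> 'a::real_normed_vector"
  assumes p: "1 < p" "p < 2" and x: "x \<in> cube n" and nz: "\<And>m y. m < M \<Longrightarrow> y \<in> cube n \<Longrightarrow> u m y \<noteq> 0"
    and G: "\<And>m. m < M \<Longrightarrow> norm (u m x) \<le> G" "0 < G"
    and s: "\<And>m. m < M \<Longrightarrow> 0 < s m" "\<And>m. m < M \<Longrightarrow> s m \<le> 1"
  shows "(\<Sum>m<M. s m powr (2 / p) * (\<Sum>j\<in>{1..n}. (norm (cdiff j (u m) x))\<^sup>2)) powr (p / 2)
    \<le> 2 * (G powr p + 3 * (\<Sum>m<M. s m * energy n p (u m) x))"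
proof -
  define y where "y = 3 * (\<Sum>m<M. s m * energy n p (u m) x)"
  define z where "z = y powr (1 / p)"
  define w where "w = max G z"
  define Y where "Y = (\<Sum>m<M. s m powr (2 / p) * (\<Sum>j\<in>{1..n}. (norm (cdiff j (u m) x))\<^sup>2))"
  have sE: "0 \<le> s m * energy n p (u m) x" if "m < M" for m
    using s(1)[OF that] energy_nonneg[of n p "u m" x] by simp
  have y0: "0 \<le> y" unfolding y_def using sE by (auto intro!: sum_nonneg)
  have Y0: "0 \<le> Y" unfolding Y_def by (intro sum_nonneg mult_nonneg_nonneg) auto
  have w: "0 < w" "G \<le> w" "z \<le> w" using G by (auto simp: w_def)
  have zp: "z powr p = y" using p y0 by (simp add: z_def powr_powr)
  have "Y \<le> (\<Sum>m<M. G powr (2 - p) * (3 * (s m * energy n p (u m) x)) + (3 * (s m * energy n p (u m) x)) powr (2 / p))"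
    unfolding Y_def
  proof (rule sum_mono)
    fix m assume "m \<in> {..<M}"
    then have m: "m < M" by simp
    have "s m powr (2 / p) \<le> s m powr 1"
      using p s[OF m] by (intro powr_mono') auto
    then have le: "s m powr (2 / p) \<le> s m" using s(1)[OF m] by simp
    have "s m powr (2 / p) * (\<Sum>j\<in>{1..n}. (norm (cdiff j (u m) x))\<^sup>2)
      \<le> s m powr (2 / p) * (3 * G powr (2 - p) * energy n p (u m) x + (3 * energy n p (u m) x) powr (2 / p))"
      using m by (intro mult_left_mono gradient_le_energy p x nz G) auto
    also have "\<dots> = s m powr (2 / p) * (3 * G powr (2 - p) * energy n p (u m) x) + (s m * (3 * energy n p (u m) x)) powr (2 / p)"
      using s(1)[OF m] energy_nonneg[of n p "u m" x] by (simp add: distrib_left powr_mult)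
    also have "\<dots> \<le> s m * (3 * G powr (2 - p) * energy n p (u m) x) + (s m * (3 * energy n p (u m) x)) powr (2 / p)"
      using le energy_nonneg[of n p "u m" x] by (intro add_right_mono mult_right_mono) auto
    finally show "s m powr (2 / p) * (\<Sum>j\<in>{1..n}. (norm (cdiff j (u m) x))\<^sup>2)
      \<le> G powr (2 - p) * (3 * (s m * energy n p (u m) x)) + (3 * (s m * energy n p (u m) x)) powr (2 / p)"
      by (simp add: mult_ac)
  qed
  also have "\<dots> = G powr (2 - p) * y + (\<Sum>m<M. (3 * (s m * energy n p (u m) x)) powr (2 / p))"
    by (simp add: sum.distrib sum_distrib_left y_def)
  also have "(\<Sum>m<M. (3 * (s m * energy n p (u m) x)) powr (2 / p)) \<le> (\<Sum>m<M. 3 * (s m * energy n p (u m) x)) powr (2 / p)"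
    using p sE by (intro sum_powr_le_powr_sum) auto
  also have "\<dots> = z\<^sup>2"
    using p y0 by (simp add: y_def z_def powr_powr sum_distrib_left flip: powr_numeral)
  also have "G powr (2 - p) * y + z\<^sup>2 \<le> w powr (2 - p) * w powr p + w\<^sup>2"
  proof (intro add_mono mult_mono)
    show "G powr (2 - p) \<le> w powr (2 - p)" using p G w by (intro powr_mono2) auto
    have "z powr p \<le> w powr p" using p w by (intro powr_mono2) (auto simp: z_def)
    then show "y \<le> w powr p" by (simp add: zp)
    show "z\<^sup>2 \<le> w\<^sup>2" using w by (intro power_mono) (auto simp: z_def)
  qed (use y0 in auto)
  also have "\<dots> = 2 * w powr 2" using w by (simp flip: powr_add)
  finally have "Y \<le> 2 * w powr 2" by simp
  then have "Y powr (p / 2) \<le> (2 * w powr 2) powr (p / 2)"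
    using p Y0 by (intro powr_mono2) auto
  also have "\<dots> = 2 powr (p / 2) * w powr p"
    by (simp add: powr_mult powr_powr)
  also have "\<dots> \<le> 2 * w powr p"
    using p powr_mono[of "p / 2" 1 2] by (intro mult_right_mono) auto
  also have "\<dots> \<le> 2 * (G powr p + y)"
    using y0 by (auto simp: w_def max_def zp)
  finally show ?thesis by (simp add: Y_def y_def)
qed

section \<open>The dual pairing at one scale\<close>

text \<open>
  The gradient at scale \<open>s\<close> is tested against the part of \<open>\<phi>\<close> between the scales \<open>s\<close> and \<open>2 s\<close>.
\<close>

definition pairing ::
    "nat \<Rightarrow> ((nat \<Rightarrow> real) \<Rightarrow> 'a::real_inner) \<Rightarrow> (nat \<Rightarrow> (nat \<Rightarrow> real) \<Rightarrow> 'a) \<Rightarrow> real \<Rightarrow> real" where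
  "pairing n g \<phi> s = (\<Sum>j\<in>{1..n}. avg n (\<lambda>x.
     inner (cdiff j (heat n s g) x) (heat n s (\<phi> j) x - heat n (2 * s) (\<phi> j) x)))"

lemma sum_inner_le_sqrt:
  fixes a b :: "'i \<Rightarrow> 'a::real_inner"
  shows "(\<Sum>i\<in>I. inner (a i) (b i)) \<le> sqrt (\<Sum>i\<in>I. (norm (a i))\<^sup>2) * sqrt (\<Sum>i\<in>I. (norm (b i))\<^sup>2)"
proof -
  have "(\<Sum>i\<in>I. inner (a i) (b i)) \<le> (\<Sum>i\<in>I. \<bar>norm (a i)\<bar> * \<bar>norm (b i)\<bar>)"
    by (intro sum_mono) (simp add: norm_cauchy_schwarz)
  also have "\<dots> \<le> L2_set (\<lambda>i. norm (a i)) I * L2_set (\<lambda>i. norm (b i)) I"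
    by (rule L2_set_mult_ineq)
  finally show ?thesis by (simp add: L2_set_def)
qed

text \<open>
  Hoelder's inequality in a form that survives averaging: for the right choice of the scaling factors \<open>K\<close> and \<open>L\<close>, the
  average of the bracket is bounded.
\<close>

lemma Young_scaled:
  fixes u v p q :: real
  assumes p: "1 < p" "1 < q" "1/p + 1/q = 1" and K: "0 < K" and L: "0 < L" and uv: "0 \<le> u" "0 \<le> v"
  shows "u * v \<le> L * K * (u powr p / K powr p + v powr q / L powr q)"
proof -
  have "(u / K) * (v / L) \<le> (u / K) powr p / p + (v / L) powr q / q"
    using p K L uv by (intro Youngs_inequality) auto
  also have "\<dots> \<le> (u / K) powr p + (v / L) powr q"
  proof -
    have "a / t \<le> a" if "1 < t" "0 \<le> a" for a t :: real
      using that by (simp add: divide_le_eq mult_le_cancel_left1)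
    then show ?thesis using p by (intro add_mono) auto
  qed
  finally have "L * K * ((u / K) * (v / L)) \<le> L * K * ((u / K) powr p + (v / L) powr q)"
    using K L by (intro mult_left_mono) auto
  then show ?thesis using K L uv by (simp add: powr_divide)
qed

text \<open>
  Along the scales \<open>r, r/2, r/4, \<dots>\<close> the pairing is a product of the gradient square function and the
  martingale square function of \<open>\<phi>\<close>. The normalisation by \<open>K = 1/(p - 1)\<close> reflects the constant of the maximal inequality, and
  \<open>L = \<surd>(10 q)\<close> that of the square function. The energies stay on the right; they are integrated
  over \<open>r\<close> later.
\<close>

lemma pairing_dyadic_sum:
  fixes g :: "(nat \<Rightarrow> real) \<Rightarrow> 'a::real_inner" and \<phi> :: "nat \<Rightarrow> (nat \<Rightarrow> real) \<Rightarrow> 'a"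
  assumes p: "1 < p" "p < 2" and q: "q = p / (p - 1)" and r: "0 < r" "r \<le> 1"
    and nz: "\<And>s x. 0 \<le> s \<Longrightarrow> x \<in> cube n \<Longrightarrow> heat n s g x \<noteq> 0"
    and X: "moment n p g \<le> 1"
    and Z: "avg n (\<lambda>x. (l2norm {1..n} \<phi> x) powr q) \<le> 1"
  shows "(\<Sum>m<M. (r / 2 ^ m) powr (1 / p) * pairing n g \<phi> (r / 2 ^ m))
    \<le> 9 * (sqrt (10 * q) / (p - 1)) * (1 + (p - 1) * (\<Sum>m<M. (r / 2 ^ m) * avg n (energy n p (heat n (r / 2 ^ m) g))))"
proof -
  define s where "s m = r / 2 ^ m" for m :: nat
  let ?I = "\<lambda>m j x. inner (s m powr (1/p) *\<^sub>R cdiff j (heat n (s m) g) x)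
    (heat n (s m) (\<phi> j) x - heat n (2 * s m) (\<phi> j) x)"
  define L K where "L = sqrt (10 * q)" and "K = 1 / (p - 1)"
  \<comment> \<open>The scales are shifted by one, so that \<open>\<theta> (Suc i)\<close> and \<open>\<theta> i\<close> belong to \<open>s i\<close> and \<open>2 * s i\<close>, and they are
    listed so that the parameters increase.\<close>
  define \<theta> where "\<theta> i = exp (- (2 * r / 2 ^ i))" for i :: nat
  define Y where "Y x = (\<Sum>m<M. s m powr (2 / p) * (\<Sum>j\<in>{1..n}. (norm (cdiff j (heat n (s m) g) x))\<^sup>2))" for x
  define V where "V x = (\<Sum>i<M. \<Sum>j\<in>{1..n}.
        (norm (noise n (\<lambda>_. \<theta> (Suc i)) (\<phi> j) x - noise n (\<lambda>_. \<theta> i) (\<phi> j) x))\<^sup>2)" for x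
  define G where "G x = Max ((\<lambda>m. noise n (\<lambda>_. \<theta> m) (\<lambda>y. norm (g y)) x) ` {..M})" for x
  define S where "S = (\<Sum>m<M. s m * avg n (energy n p (heat n (s m) g)))"
  have q2: "2 < q" using p by (simp add: q field_simps)
  have LK: "0 < L" "0 < K" using p q2 by (auto simp: L_def K_def)
  have s: "0 < s m" "s m \<le> 1" for m
  proof -
    show "0 < s m" using r by (simp add: s_def)
    have "r \<le> 2 ^ m" using r one_le_power[of "2::real" m] by linarith
    then show "s m \<le> 1" by (simp add: s_def)
  qed
  have th: "\<theta> (Suc i) = exp (- s i)" "\<theta> i = exp (- (2 * s i))" for i
    by (auto simp: \<theta>_def s_def)
  have \<theta>: "0 \<le> \<theta> 0" "\<theta> m \<le> \<theta> (Suc m)" "\<theta> M \<le> 1" for m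
  proof -
    show "\<theta> m \<le> \<theta> (Suc m)" using s[of m] unfolding th(1)[of m] th(2)[of m] by simp
    show "\<theta> M \<le> 1" using s[of M] by (simp add: th)
  qed (simp add: \<theta>_def)
  have avgV: "avg n (\<lambda>x. V x powr (q/2)) \<le> L powr q"
  proof -
    have "avg n (\<lambda>x. V x powr (q/2)) \<le> (10 * q) powr (q/2) * avg n (\<lambda>x. (l2norm {1..n} \<phi> x) powr q)"
      unfolding V_def by (rule noise_square_function[OF \<theta> q2]) auto
    also have "\<dots> \<le> (10 * q) powr (q/2) * 1"
      by (intro mult_left_mono Z) auto
    also have "\<dots> = L powr q"
      using q2 by (simp add: L_def powr_half_sqrt[symmetric] powr_powr)
    finally show ?thesis .
  qed
  have avgG: "avg n (\<lambda>x. G x powr p) \<le> (p / (p - 1)) powr p"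
  proof -
    have "avg n (\<lambda>x. G x powr p) \<le> (p / (p - 1)) powr p * moment n p g"
      unfolding G_def by (rule noise_maximal[OF \<theta> p(1)]) auto
    also have "\<dots> \<le> (p / (p - 1)) powr p * 1" by (intro mult_left_mono X) auto
    finally show ?thesis by simp
  qed
  have avgY: "avg n (\<lambda>x. Y x powr (p/2)) \<le> 2 * ((p / (p - 1)) powr p + 3 * S)"
  proof (cases "M = 0")
    case True
    then show ?thesis by (simp add: Y_def S_def)
  next
    case False
    have "avg n (\<lambda>x. Y x powr (p/2)) \<le> avg n (\<lambda>x. 2 * (G x powr p + 3 * (\<Sum>m<M. s m * energy n p (heat n (s m) g) x)))"
    proof (rule avg_mono)
      fix x assume x: "x \<in> cube n"
      have G: "norm (heat n (s m) g x) \<le> G x" if "m < M" for m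
      proof -
        have "norm (heat n (s m) g x) \<le> noise n (\<lambda>_. \<theta> (Suc m)) (\<lambda>y. norm (g y)) x"
          unfolding th(1)[of m] using s[of m] x by (intro norm_noise_le) auto
        also have "\<dots> \<le> G x" unfolding G_def using that by (intro Max_ge) auto
        finally show ?thesis .
      qed
      have "0 < norm (heat n (s 0) g x)" using nz[OF _ x, of "s 0"] s[of 0] by simp
      then have G0: "0 < G x" using G[of 0] False by linarith
      show "Y x powr (p/2) \<le> 2 * (G x powr p + 3 * (\<Sum>m<M. s m * energy n p (heat n (s m) g) x))"
        unfolding Y_def using s by (intro gradient_square_function_le p x nz G G0) (auto intro: less_imp_le)
    qed
    also have "\<dots> = 2 * (avg n (\<lambda>x. G x powr p) + 3 * S)"
      unfolding avg_cmult avg_add avg_sum S_def by simp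
    finally show ?thesis using avgG by simp
  qed
  have pp: "p powr p \<le> 4"
  proof -
    have "p powr p \<le> 2 powr p" using p by (intro powr_mono2) auto
    also have "\<dots> \<le> 2 powr 2" using p by (intro powr_mono) auto
    finally show ?thesis by simp
  qed
  have S0: "0 \<le> S" unfolding S_def using s
    by (intro sum_nonneg mult_nonneg_nonneg avg_nonneg energy_nonneg) (auto intro: less_imp_le)
  have "avg n (\<lambda>x. Y x powr (p/2)) / K powr p \<le> (2 * ((p / (p - 1)) powr p + 3 * S)) / K powr p"
    by (intro divide_right_mono avgY) auto
  also have "\<dots> = 2 * (p powr p + 3 * ((p - 1) powr p * S))"
    using p by (simp add: K_def powr_divide field_simps)
  also have "\<dots> \<le> 2 * (4 + 3 * ((p - 1) * S))"
  proof -
    have "(p - 1) powr p \<le> (p - 1) powr 1" using p by (intro powr_mono') auto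
    then show ?thesis using p pp S0 by (intro mult_left_mono add_mono mult_right_mono) auto
  qed
  finally have avgYK: "avg n (\<lambda>x. Y x powr (p/2)) / K powr p \<le> 2 * (4 + 3 * ((p - 1) * S))" .
  have "(\<Sum>m<M. s m powr (1/p) * pairing n g \<phi> (s m)) = avg n (\<lambda>x. \<Sum>(m,j)\<in>{..<M} \<times> {1..n}. ?I m j x)"
    by (simp add: pairing_def sum.cartesian_product[symmetric] avg_sum avg_cmult sum_distrib_left)
  also have "\<dots> \<le> avg n (\<lambda>x. L * K * (Y x powr (p/2) / K powr p + V x powr (q/2) / L powr q))"
  proof (rule avg_mono)
    fix x
    define YY where "YY = (\<Sum>(m,j)\<in>{..<M} \<times> {1..n}. (norm (s m powr (1/p) *\<^sub>R cdiff j (heat n (s m) g) x))\<^sup>2)"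
    define VV where "VV = (\<Sum>(m,j)\<in>{..<M} \<times> {1..n}. (norm (heat n (s m) (\<phi> j) x - heat n (2 * s m) (\<phi> j) x))\<^sup>2)"
    have "(s m powr (1/p))\<^sup>2 = s m powr (2/p)" for m
      using s[of m] by (simp add: powr_powr flip: powr_numeral)
    then have YY: "YY = Y x"
      unfolding YY_def Y_def by (simp add: sum.cartesian_product[symmetric] sum_distrib_left power_mult_distrib)
    have VV: "VV = V x"
      unfolding VV_def V_def th(1) unfolding th(2) by (simp add: sum.cartesian_product[symmetric])
    have 0: "0 \<le> Y x" "0 \<le> V x"
      unfolding Y_def V_def by (intro sum_nonneg mult_nonneg_nonneg; simp)+
    have "(\<Sum>(m,j)\<in>{..<M} \<times> {1..n}. ?I m j x)
      \<le> sqrt YY * sqrt VV"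
      unfolding YY_def VV_def case_prod_beta by (rule sum_inner_le_sqrt)
    also have "\<dots> \<le> L * K * (sqrt (Y x) powr p / K powr p + sqrt (V x) powr q / L powr q)"
      unfolding YY VV using p q2 LK 0 by (intro Young_scaled) (auto simp: q field_simps)
    also have "sqrt (Y x) powr p = Y x powr (p/2)"
      using 0 by (simp add: powr_half_sqrt[symmetric] powr_powr)
    also have "sqrt (V x) powr q = V x powr (q/2)"
      using 0 by (simp add: powr_half_sqrt[symmetric] powr_powr)
    finally show "(\<Sum>(m,j)\<in>{..<M} \<times> {1..n}. ?I m j x)
      \<le> L * K * (Y x powr (p/2) / K powr p + V x powr (q/2) / L powr q)" .
  qed
  also have "\<dots> = L * K * (avg n (\<lambda>x. Y x powr (p/2)) / K powr p + avg n (\<lambda>x. V x powr (q/2)) / L powr q)"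
    unfolding divide_inverse mult.commute[of _ "inverse _"] avg_cmult avg_add ..
  also have "\<dots> \<le> L * K * (2 * (4 + 3 * ((p - 1) * S)) + 1)"
    using LK avgV by (intro mult_left_mono add_mono avgYK) auto
  also have "\<dots> \<le> L * K * (9 * (1 + (p - 1) * S))"
    using LK p S0 by (intro mult_left_mono) auto
  also have "\<dots> = 9 * (L * K) * (1 + (p - 1) * S)" by simp
  finally show ?thesis unfolding s_def S_def L_def K_def by simp
qed

lemma heat_heat: "heat n s (heat n t f) x = heat n (s + t) f x"
  by (simp add: noise_noise exp_add[symmetric] add.commute)

text \<open>
  For \<open>k\<close> odd in coordinate \<open>j\<close>, combining the points \<open>y\<close> and \<open>flip j y\<close> replaces the kernel by the difference of its two
  values, which is \<open>e\<^sup>-\<^sup>t\<close> times their sum.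
\<close>

lemma norm_heat_odd_le:
  fixes k :: "(nat \<Rightarrow> real) \<Rightarrow> 'a::real_normed_vector"
  assumes j: "j \<in> {1..n}" and t: "0 \<le> t" and x: "x \<in> cube n" and odd: "\<And>y. k (flip j y) = - k y"
  shows "norm (heat n t k x) \<le> exp (- t) * heat n t (\<lambda>y. norm (k y)) x"
proof -
  define R where "R y = (\<Prod>i\<in>{1..n}-{j}. (1 + exp (- t) * x i * y i) / 2)" for y
  have K1: "kern n (\<lambda>_. exp (- t)) x y = (1 + exp (- t) * x j * y j) / 2 * R y" for y
    unfolding kern_def R_def using j by (subst prod.remove[of _ j]) auto
  have RF: "R (flip j y) = R y" for y
    unfolding R_def by (intro prod.cong) (auto simp: flip_def)
  have K2: "kern n (\<lambda>_. exp (- t)) x (flip j y) = (1 - exp (- t) * x j * y j) / 2 * R y" for y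
    unfolding K1 RF by (simp add: flip_def)
  have R0: "0 \<le> R y" if y: "y \<in> cube n" for y
    unfolding R_def
  proof (intro prod_nonneg ballI)
    fix i assume i: "i \<in> {1..n} - {j}"
    show "0 \<le> (1 + exp (- t) * x i * y i) / 2"
      using cube_coord[OF x, of i] cube_coord[OF y, of i] i t by auto
  qed
  have abs1: "\<bar>y j\<bar> = 1" if "y \<in> cube n" for y
    using cube_coord[OF that j] by auto
  have "2 *\<^sub>R heat n t k x = (\<Sum>y\<in>cube n. kern n (\<lambda>_. exp (- t)) x y *\<^sub>R k y) +
      (\<Sum>y\<in>cube n. kern n (\<lambda>_. exp (- t)) x (flip j y) *\<^sub>R k (flip j y))"
    using sum_cube_flip[OF j, of "\<lambda>y. kern n (\<lambda>_. exp (- t)) x y *\<^sub>R k y"] by (simp add: noise_def scaleR_2)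
  also have "\<dots> = (\<Sum>y\<in>cube n. (exp (- t) * x j * y j * R y) *\<^sub>R k y)"
    unfolding K2 unfolding K1 odd sum.distrib[symmetric] scaleR_minus_right
  proof (intro sum.cong refl)
    fix y
    have e: "exp (- t) * x j * y j * R y = (1 + exp (- t) * x j * y j) / 2 * R y - (1 - exp (- t) * x j * y j) / 2 * R y"
      by (simp add: field_simps)
    show "((1 + exp (- t) * x j * y j) / 2 * R y) *\<^sub>R k y + - (((1 - exp (- t) * x j * y j) / 2 * R y) *\<^sub>R k y)
        = (exp (- t) * x j * y j * R y) *\<^sub>R k y"
      unfolding e scaleR_diff_left by simp
  qed
  finally have "norm (2 *\<^sub>R heat n t k x) \<le> (\<Sum>y\<in>cube n. exp (- t) * (R y * norm (k y)))"
    using abs1[OF x] abs1 R0 by (auto intro!: sum_norm_le simp: abs_mult)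
  also have "\<dots> = exp (- t) * (\<Sum>y\<in>cube n. kern n (\<lambda>_. exp (- t)) x y * norm (k y) +
      kern n (\<lambda>_. exp (- t)) x (flip j y) * norm (k (flip j y)))"
    unfolding K2 unfolding K1 odd sum_distrib_left by (intro sum.cong refl) (simp add: field_simps)
  also have "\<dots> = exp (- t) * (2 * heat n t (\<lambda>y. norm (k y)) x)"
    using sum_cube_flip[OF j, of "\<lambda>y. kern n (\<lambda>_. exp (- t)) x y * norm (k y)"]
    by (simp add: noise_def sum.distrib)
  finally show ?thesis by simp
qed

lemma gradient_heat_decay:
  fixes g :: "(nat \<Rightarrow> real) \<Rightarrow> 'a::real_normed_vector"
  assumes t: "0 \<le> t" and x: "x \<in> cube n"
  shows "l2norm {1..n} (\<lambda>j. cdiff j (heat n (t + \<sigma>) g)) x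
    \<le> exp (- t) * heat n t (\<lambda>y. l2norm {1..n} (\<lambda>j. cdiff j (heat n \<sigma> g)) y) x"
proof -
  have "norm (cdiff j (heat n (t + \<sigma>) g) x) \<le> exp (- t) * heat n t (\<lambda>y. norm (cdiff j (heat n \<sigma> g) y)) x"
    if j: "j \<in> {1..n}" for j
  proof -
    have "cdiff j (heat n (t + \<sigma>) g) x = cdiff j (heat n t (heat n \<sigma> g)) x"
      by (simp add: heat_heat[abs_def] cdiff_def)
    also have "\<dots> = heat n t (cdiff j (heat n \<sigma> g)) x" by (rule cdiff_noise[OF j])
    finally show ?thesis using norm_heat_odd_le[OF j t x, of "cdiff j (heat n \<sigma> g)"] by (simp add: cdiff_flip)
  qed
  then have "l2norm {1..n} (\<lambda>j. cdiff j (heat n (t + \<sigma>) g)) x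
    \<le> L2_set (\<lambda>j. exp (- t) * heat n t (\<lambda>y. norm (cdiff j (heat n \<sigma> g) y)) x) {1..n}"
    by (intro L2_set_mono) auto
  also have "\<dots> = exp (- t) * L2_set (\<lambda>j. heat n t (\<lambda>y. norm (cdiff j (heat n \<sigma> g) y)) x) {1..n}"
    by (rule L2_set_right_distrib[symmetric]) simp
  also have "\<dots> \<le> exp (- t) * heat n t (\<lambda>y. l2norm {1..n} (\<lambda>j. cdiff j (heat n \<sigma> g)) y) x"
    using t x by (intro mult_left_mono noise_L2_le) auto
  finally show ?thesis .
qed

text \<open>
  At large times the exponential decay of the gradient suffices. The gradient at time \<open>s\<close> is compared with the one at a time
  \<open>\<sigma>\<close> in \<open>[1/2, 1]\<close> at which the energy is of order \<open>1/(p - 1)\<close>.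
\<close>

lemma pairing_large_time:
  fixes g :: "(nat \<Rightarrow> real) \<Rightarrow> 'a::real_inner" and \<phi> :: "nat \<Rightarrow> (nat \<Rightarrow> real) \<Rightarrow> 'a"
  assumes p: "1 < p" "p < 2" and q: "q = p / (p - 1)" and s: "1 \<le> s"
    and nz: "\<And>s x. 0 \<le> s \<Longrightarrow> x \<in> cube n \<Longrightarrow> heat n s g x \<noteq> 0"
    and X: "moment n p g \<le> 1"
    and Z: "avg n (\<lambda>x. (l2norm {1..n} \<phi> x) powr q) \<le> 1"
  shows "pairing n g \<phi> s \<le> 82 / (p - 1) * exp (- (s - 1))"
proof -
  define e where "e t = avg n (energy n p (heat n t g))" for t
  define K where "K = 1 / (p - 1)"
  have K: "0 < K" using p by (simp add: K_def)
  have q1: "1 < q" using p by (simp add: q field_simps)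
  \<comment> \<open>The mean of the energy over \<open>[1/2, 1]\<close> is at most \<open>2/(p - 1)\<close>, so a time with energy at most \<open>3/(p - 1)\<close> exists.\<close>
  obtain \<sigma> where \<sigma>: "\<sigma> \<in> {1/2..1}" "(p - 1) * e \<sigma> \<le> 3"
  proof (rule ccontr)
    assume contra: "\<not> thesis"
    note found = that
    have gt: "3 / (p - 1) \<le> e t" if t: "t \<in> {1/2..1}" for t
    proof (rule ccontr)
      assume "\<not> ?thesis"
      then have "(p - 1) * e t \<le> 3" using p by (simp add: field_simps)
      then show False using found[OF t] contra by blast
    qed
    have int: "e integrable_on {1/2..1}" and le: "(p - 1) * integral {1/2..1} e \<le> 1"
      using energy_integral[OF p _ _ nz, of "1/2" 1] X by (auto simp: e_def[abs_def])
    have "integral {1/2..1::real} (\<lambda>t. 3 / (p - 1)) \<le> integral {1/2..1} e"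
      by (intro integral_le int gt) auto
    then have "3 / (p - 1) / 2 \<le> integral {1/2..1} e" by (simp add: mult.commute)
    then have A: "(p - 1) * (3 / (p - 1) / 2) \<le> (p - 1) * integral {1/2..1} e"
      using p by (intro mult_left_mono) auto
    have B: "(p - 1) * (3 / (p - 1) / 2) = 3 / 2"
    proof -
      have "v * (3 / v / 2) = 3 / 2" if "v \<noteq> 0" for v :: real using that by simp
      from this[of "p - 1"] p show ?thesis by linarith
    qed
    have "3 / 2 \<le> (1::real)" using order_trans[OF A le] unfolding B .
    then show False by simp
  qed
  define Gr where "Gr t x = l2norm {1..n} (\<lambda>j. cdiff j (heat n t g)) x" for t x
  have Gr0: "0 \<le> Gr t x" for t x by (simp add: Gr_def)
  have Gr\<sigma>: "avg n (\<lambda>x. Gr \<sigma> x powr p) \<le> 40 / (p - 1)"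
  proof -
    have "avg n (\<lambda>x. Gr \<sigma> x powr p) \<le> avg n (\<lambda>x. 4 * (norm (heat n \<sigma> g x) powr p + 3 * energy n p (heat n \<sigma> g) x))"
    proof (rule avg_mono)
      fix x assume x: "x \<in> cube n"
      have "(\<Sum>m<1::nat. \<sigma> powr (2 / p) * (\<Sum>j\<in>{1..n}. (norm (cdiff j (heat n \<sigma> g) x))\<^sup>2)) powr (p / 2)
        \<le> 2 * (norm (heat n \<sigma> g x) powr p + 3 * (\<Sum>m<1::nat. \<sigma> * energy n p (heat n \<sigma> g) x))"
        using \<sigma>(1) nz[OF _ x, of \<sigma>]
        by (intro gradient_square_function_le[where u = "\<lambda>_. heat n \<sigma> g" and s = "\<lambda>_. \<sigma>"] p x nz) auto
      moreover have "(\<sigma> powr (2 / p) * (\<Sum>j\<in>{1..n}. (norm (cdiff j (heat n \<sigma> g) x))\<^sup>2)) powr (p / 2) = \<sigma> * Gr \<sigma> x powr p"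
        using \<sigma>(1) p by (simp add: powr_mult powr_powr Gr_def L2_set_def powr_half_sqrt[symmetric] sum_nonneg)
      moreover have "\<sigma> * energy n p (heat n \<sigma> g) x \<le> 1 * energy n p (heat n \<sigma> g) x"
        using \<sigma>(1) by (intro mult_right_mono energy_nonneg) auto
      moreover have "(1/2) * Gr \<sigma> x powr p \<le> \<sigma> * Gr \<sigma> x powr p"
        using \<sigma>(1) by (intro mult_right_mono) auto
      ultimately show "Gr \<sigma> x powr p \<le> 4 * (norm (heat n \<sigma> g x) powr p + 3 * energy n p (heat n \<sigma> g) x)"
        by simp
    qed
    also have "\<dots> = 4 * (moment n p (heat n \<sigma> g) + 3 * e \<sigma>)"
      unfolding avg_cmult avg_add e_def by simp
    also have "\<dots> \<le> 4 * (1 + 3 * (3 / (p - 1)))"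
    proof -
      have "moment n p (heat n \<sigma> g) \<le> moment n p g"
        using \<sigma>(1) p by (intro moment_noise_le) auto
      moreover have "e \<sigma> \<le> 3 / (p - 1)" using \<sigma>(2) p by (simp add: field_simps)
      ultimately show ?thesis using X by simp
    qed
    also have "\<dots> \<le> 40 / (p - 1)"
    proof -
      have "1 \<le> 1 / (p - 1)" using p by (simp add: field_simps)
      then show ?thesis by (simp add: divide_inverse)
    qed
    finally show ?thesis .
  qed
  have decay: "Gr s x \<le> exp (- (s - 1)) * heat n (s - \<sigma>) (Gr \<sigma>) x" if x: "x \<in> cube n" for x
  proof -
    have "Gr s x \<le> exp (- (s - \<sigma>)) * heat n (s - \<sigma>) (Gr \<sigma>) x"
      using gradient_heat_decay[OF _ x, of "s - \<sigma>" \<sigma> g] s \<sigma>(1) by (simp add: Gr_def[abs_def])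
    also have "\<dots> \<le> exp (- (s - 1)) * heat n (s - \<sigma>) (Gr \<sigma>) x"
      using s \<sigma>(1) x Gr0 by (intro mult_right_mono noise_nonneg) auto
    finally show ?thesis .
  qed
  define H where "H x = heat n (s - \<sigma>) (Gr \<sigma>) x" for x
  define b where "b t x = heat n t (\<lambda>y. l2norm {1..n} \<phi> y) x" for t x
  have avgH: "avg n (\<lambda>x. H x powr p) \<le> 40 / (p - 1)"
  proof -
    have "avg n (\<lambda>x. H x powr p) \<le> avg n (\<lambda>x. Gr \<sigma> x powr p)"
      unfolding H_def using s \<sigma>(1) p Gr0 by (intro avg_noise_powr_le) auto
    then show ?thesis using Gr\<sigma> by simp
  qed
  have avgb: "avg n (\<lambda>x. b t x powr q) \<le> 1" if "0 \<le> t" for t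
  proof -
    have "avg n (\<lambda>x. b t x powr q) \<le> avg n (\<lambda>x. (l2norm {1..n} \<phi> x) powr q)"
      unfolding b_def using that q1 by (intro avg_noise_powr_le) auto
    then show ?thesis using Z by simp
  qed
  let ?P = "\<lambda>x. \<Sum>j\<in>{1..n}. inner (cdiff j (heat n s g) x) (heat n s (\<phi> j) x - heat n (2 * s) (\<phi> j) x)"
  let ?R = "\<lambda>x. exp (- (s - 1)) * (K * (H x powr p / K powr p + b s x powr q)
    + K * (H x powr p / K powr p + b (2 * s) x powr q))"
  have "pairing n g \<phi> s = avg n (\<lambda>x. ?P x)"
    by (simp add: pairing_def avg_sum)
  also have "\<dots> \<le> avg n (\<lambda>x. ?R x)"
  proof (rule avg_mono)
    fix x assume x: "x \<in> cube n"
    have H0: "0 \<le> H x" unfolding H_def using s \<sigma>(1) x Gr0 by (intro noise_nonneg) auto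
    have b0: "0 \<le> b t x" if "0 \<le> t" for t unfolding b_def using that x by (intro noise_nonneg) auto
    have "?P x
      \<le> Gr s x * L2_set (\<lambda>j. norm (heat n s (\<phi> j) x - heat n (2 * s) (\<phi> j) x)) {1..n}"
      using sum_inner_le_sqrt[of "\<lambda>j. cdiff j (heat n s g) x" "\<lambda>j. heat n s (\<phi> j) x - heat n (2 * s) (\<phi> j) x" "{1..n}"]
      by (simp add: Gr_def L2_set_def)
    also have "\<dots> \<le> (exp (- (s - 1)) * H x) * (b s x + b (2 * s) x)"
    proof (rule mult_mono)
      show "Gr s x \<le> exp (- (s - 1)) * H x" unfolding H_def by (rule decay[OF x])
      have "L2_set (\<lambda>j. norm (heat n s (\<phi> j) x - heat n (2 * s) (\<phi> j) x)) {1..n}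
          \<le> L2_set (\<lambda>j. norm (heat n s (\<phi> j) x) + norm (heat n (2 * s) (\<phi> j) x)) {1..n}"
        by (intro L2_set_mono norm_triangle_ineq4) auto
      also have "\<dots> \<le> L2_set (\<lambda>j. norm (heat n s (\<phi> j) x)) {1..n} + L2_set (\<lambda>j. norm (heat n (2 * s) (\<phi> j) x)) {1..n}"
        by (rule L2_set_triangle_ineq)
      also have "\<dots> \<le> b s x + b (2 * s) x"
        unfolding b_def using s x by (intro add_mono noise_family_le) auto
      finally show "L2_set (\<lambda>j. norm (heat n s (\<phi> j) x - heat n (2 * s) (\<phi> j) x)) {1..n} \<le> b s x + b (2 * s) x" .
    qed (use H0 in auto)
    also have "\<dots> = exp (- (s - 1)) * (H x * b s x + H x * b (2 * s) x)"
      by (simp add: algebra_simps)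
    also have "\<dots> \<le> ?R x"
    proof (intro mult_left_mono add_mono)
      have "H x * b t x \<le> K * (H x powr p / K powr p + b t x powr q)" if "0 \<le> t" for t
        using Young_scaled[OF p(1) q1 _ K zero_less_one H0 b0[OF that]] p by (simp add: q field_simps)
      then show "H x * b s x \<le> K * (H x powr p / K powr p + b s x powr q)"
         "H x * b (2 * s) x \<le> K * (H x powr p / K powr p + b (2 * s) x powr q)" using s by auto
    qed auto
    finally show "?P x
      \<le> ?R x" .
  qed
  also have "\<dots> = exp (- (s - 1)) * (K * (avg n (\<lambda>x. H x powr p) / K powr p + avg n (\<lambda>x. b s x powr q))
      + K * (avg n (\<lambda>x. H x powr p) / K powr p + avg n (\<lambda>x. b (2 * s) x powr q)))"
    unfolding divide_inverse mult.commute[of _ "inverse _"] avg_cmult avg_add ..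
  also have "\<dots> \<le> exp (- (s - 1)) * (K * (40 + 1) + K * (40 + 1))"
  proof -
    have "avg n (\<lambda>x. H x powr p) / K powr p \<le> (40 / (p - 1)) / K powr p"
      by (intro divide_right_mono avgH) auto
    also have "\<dots> = 40 * (p - 1) powr (p - 1)"
      using p by (simp add: K_def powr_divide powr_diff)
    also have "\<dots> \<le> 40 * 1"
      using p powr_mono2[of "p - 1" "p - 1" 1] by (intro mult_left_mono) auto
    finally have "avg n (\<lambda>x. H x powr p) / K powr p \<le> 40" by simp
    then show ?thesis using K s avgb[of s] avgb[of "2 * s"] by (intro mult_left_mono add_mono) auto
  qed
  also have "\<dots> = 82 / (p - 1) * exp (- (s - 1))" by (simp add: K_def)
  finally show ?thesis .
qed

section \<open>Powers of the number operator\<close>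

text \<open>
  Real powers of the number operator for vector valued functions. The summand for the empty set vanishes, because
  \<open>0 powr a = 0\<close> for all \<open>a\<close>.
\<close>

definition num_power :: "nat \<Rightarrow> real \<Rightarrow> ((nat \<Rightarrow> real) \<Rightarrow> 'a::real_vector) \<Rightarrow> (nat \<Rightarrow> real) \<Rightarrow> 'a" where
  "num_power n a f x = (\<Sum>A\<in>Pow {1..n}. (real (card A) powr a * rwalsh A x) *\<^sub>R walsh_coeff n f A)"

lemma rwalsh_full: "A \<subseteq> {1..n} \<Longrightarrow> rwalsh A x = (\<Prod>j\<in>{1..n}. if j \<in> A then x j else 1)"
  unfolding rwalsh_def by (subst prod.inter_restrict[symmetric]) (auto simp: Int_absorb1)

lemma avg_rwalsh_rwalsh:
  assumes "A \<subseteq> {1..n}" "B \<subseteq> {1..n}"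
  shows "avg n (\<lambda>x. rwalsh A x * rwalsh B x) = (if A = B then 1 else 0)"
proof -
  have "(\<Sum>x\<in>cube n. rwalsh A x * rwalsh B x) =
      (\<Sum>x\<in>cube n. \<Prod>j\<in>{1..n}. (if j \<in> A then x j else 1) * (if j \<in> B then x j else 1))"
    unfolding rwalsh_full[OF assms(1)] rwalsh_full[OF assms(2)] prod.distrib ..
  also have "\<dots> = (\<Prod>j\<in>{1..n}. if (j \<in> A) = (j \<in> B) then 2 else 0)"
    by (subst sum_cube_prod) (auto intro!: prod.cong)
  also have "\<dots> = (if A = B then 2 ^ n else 0)"
  proof (cases "A = B")
    case False
    then obtain j where "j \<in> {1..n}" "(j \<in> A) \<noteq> (j \<in> B)" using assms by blast
    then have "(\<Prod>j\<in>{1..n}. if (j \<in> A) = (j \<in> B) then 2 else (0::real)) = 0"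
      by (intro prod_zero) auto
    then show ?thesis using False by simp
  qed simp
  finally show ?thesis by (simp add: avg_def)
qed

lemma walsh_coeff_walsh_sum:
  assumes B: "B \<subseteq> {1..n}"
  shows "walsh_coeff n (\<lambda>x. \<Sum>A\<in>Pow {1..n}. rwalsh A x *\<^sub>R v A) B = v B"
proof -
  have "walsh_coeff n (\<lambda>x. \<Sum>A\<in>Pow {1..n}. rwalsh A x *\<^sub>R v A) B =
      (\<Sum>A\<in>Pow {1..n}. avg n (\<lambda>x. (rwalsh B x * rwalsh A x) *\<^sub>R v A))"
    by (simp add: walsh_coeff_def scaleR_sum_right avg_sum)
  also have "\<dots> = (\<Sum>A\<in>Pow {1..n}. avg n (\<lambda>x. rwalsh B x * rwalsh A x) *\<^sub>R v A)"
    by (simp add: avg_def scaleR_sum_left[symmetric])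
  also have "\<dots> = (\<Sum>A\<in>Pow {1..n}. if A = B then v A else 0)"
    using B by (intro sum.cong) (auto simp: avg_rwalsh_rwalsh)
  also have "\<dots> = v B" using B by simp
  finally show ?thesis .
qed

lemma walsh_coeff_num_power:
  assumes "B \<subseteq> {1..n}"
  shows "walsh_coeff n (num_power n a f) B = real (card B) powr a *\<^sub>R walsh_coeff n f B"
proof -
  have "num_power n a f = (\<lambda>x. \<Sum>A\<in>Pow {1..n}. rwalsh A x *\<^sub>R (real (card A) powr a *\<^sub>R walsh_coeff n f A))"
    by (simp add: num_power_def fun_eq_iff mult.commute)
  then show ?thesis using walsh_coeff_walsh_sum[OF assms, of "\<lambda>A. real (card A) powr a *\<^sub>R walsh_coeff n f A"] by simp
qed

lemma num_power_num_power: "num_power n a (num_power n b f) x = num_power n (a + b) f x"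
  unfolding num_power_def[of n a] num_power_def[of n "a + b"]
  by (intro sum.cong refl) (simp add: walsh_coeff_num_power powr_add mult_ac)

lemma num_power_scaleR: "num_power n a (\<lambda>x. c *\<^sub>R f x) x = c *\<^sub>R num_power n a f x"
proof -
  have "walsh_coeff n (\<lambda>x. c *\<^sub>R f x) A = c *\<^sub>R walsh_coeff n f A" for A
    using avg_scaleR[of n c "\<lambda>x. rwalsh A x *\<^sub>R f x"] by (simp add: walsh_coeff_def mult.commute)
  then show ?thesis by (simp add: num_power_def scaleR_sum_right mult_ac)
qed

lemma heat_num_power:
  assumes "x \<in> cube n"
  shows "heat n t (num_power n a f) x =
    (\<Sum>A\<in>Pow {1..n}. (exp (- t * real (card A)) * real (card A) powr a * rwalsh A x) *\<^sub>R walsh_coeff n f A)"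
  unfolding heat_expand[OF assms] by (intro sum.cong refl) (simp add: walsh_coeff_num_power mult_ac)

section \<open>The pairing reproduces the gradient\<close>

text \<open>
  As \<open>P\<^sub>s\<close> is self-adjoint and commutes with differences, all of it can be moved to one side of the pairing.
\<close>

lemma pairing_alt:
  "pairing n g \<phi> s = (\<Sum>j\<in>{1..n}. avg n (\<lambda>x. inner (cdiff j (heat n (2 * s) g) x - cdiff j (heat n (3 * s) g) x) (\<phi> j x)))"
  unfolding pairing_def
proof (intro sum.cong refl)
  fix j assume j: "j \<in> {1..n}"
  have "avg n (\<lambda>x. inner (cdiff j (heat n s g) x) (heat n t (\<phi> j) x)) = avg n (\<lambda>x. inner (cdiff j (heat n (t + s) g) x) (\<phi> j x))" for t
  proof -
    have "cdiff j (heat n (t + s) g) x = cdiff j (heat n t (heat n s g)) x" for x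
      by (simp add: heat_heat[abs_def] cdiff_def)
    then have "cdiff j (heat n (t + s) g) x = heat n t (cdiff j (heat n s g)) x" for x
      by (simp only: cdiff_noise[OF j])
    then show ?thesis by (simp add: avg_inner_noise)
  qed
  from this[of s] this[of "2 * s"]
  show "avg n (\<lambda>x. inner (cdiff j (heat n s g) x) (heat n s (\<phi> j) x - heat n (2 * s) (\<phi> j) x)) =
    avg n (\<lambda>x. inner (cdiff j (heat n (2 * s) g) x - cdiff j (heat n (3 * s) g) x) (\<phi> j x))"
    by (simp add: inner_diff_right inner_diff_left avg_diff)
qed

lemma avg_inner_cdiff_expand:
  fixes u :: "(nat \<Rightarrow> real) \<Rightarrow> 'a::real_inner"
  assumes j: "j \<in> {1..n}" and u: "\<And>x. x \<in> cube n \<Longrightarrow> u x = (\<Sum>A\<in>Pow {1..n}. (c A * rwalsh A x) *\<^sub>R v A)"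
  shows "avg n (\<lambda>x. inner (cdiff j u x) (\<phi> x)) =
    (\<Sum>A\<in>Pow {1..n}. c A * avg n (\<lambda>x. inner (cdiff j (\<lambda>x. rwalsh A x *\<^sub>R v A) x) (\<phi> x)))"
proof -
  have "avg n (\<lambda>x. inner (cdiff j u x) (\<phi> x)) =
      avg n (\<lambda>x. inner (cdiff j (\<lambda>x. \<Sum>A\<in>Pow {1..n}. c A *\<^sub>R (rwalsh A x *\<^sub>R v A)) x) (\<phi> x))"
    using j by (intro avg_cong arg_cong2[where f = inner] cdiff_cong[of n] refl) (auto simp: u)
  then show ?thesis
    by (simp only: cdiff_sum cdiff_scaleR inner_sum_left inner_scaleR_left avg_sum avg_cmult)
qed

lemma pairing_num_power:
  fixes F :: "(nat \<Rightarrow> real) \<Rightarrow> 'a::real_inner"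
  defines "c \<equiv> \<lambda>n F (\<phi> :: nat \<Rightarrow> (nat \<Rightarrow> real) \<Rightarrow> 'a) A. \<Sum>j\<in>{1..n}. avg n (\<lambda>x. inner (cdiff j (\<lambda>x. rwalsh A x *\<^sub>R walsh_coeff n F A) x) (\<phi> j x))"
  shows "pairing n (num_power n a F) \<phi> s =
      (\<Sum>A\<in>Pow {1..n}. (exp (- (2 * s) * real (card A)) - exp (- (3 * s) * real (card A))) * real (card A) powr a * c n F \<phi> A)"
    and "(\<Sum>j\<in>{1..n}. avg n (\<lambda>x. inner (cdiff j F x) (\<phi> j x))) = (\<Sum>A\<in>Pow {1..n}. c n F \<phi> A)"
proof -
  have "avg n (\<lambda>x. inner (cdiff j (heat n t (num_power n a F)) x) (\<phi> j x)) =
    (\<Sum>A\<in>Pow {1..n}. exp (- t * real (card A)) * real (card A) powr a *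
      avg n (\<lambda>x. inner (cdiff j (\<lambda>x. rwalsh A x *\<^sub>R walsh_coeff n F A) x) (\<phi> j x)))" if "j \<in> {1..n}" for j t
    by (rule avg_inner_cdiff_expand[OF that heat_num_power])
  then have "pairing n (num_power n a F) \<phi> s = (\<Sum>j\<in>{1..n}. \<Sum>A\<in>Pow {1..n}.
      (exp (- (2 * s) * real (card A)) - exp (- (3 * s) * real (card A))) * real (card A) powr a *
      avg n (\<lambda>x. inner (cdiff j (\<lambda>x. rwalsh A x *\<^sub>R walsh_coeff n F A) x) (\<phi> j x)))"
    by (simp add: pairing_alt inner_diff_left avg_diff left_diff_distrib sum_subtractf)
  also have "\<dots> = (\<Sum>A\<in>Pow {1..n}. (exp (- (2 * s) * real (card A)) - exp (- (3 * s) * real (card A))) * real (card A) powr a * c n F \<phi> A)"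
    unfolding c_def sum_distrib_left by (rule sum.swap)
  finally show "pairing n (num_power n a F) \<phi> s =
      (\<Sum>A\<in>Pow {1..n}. (exp (- (2 * s) * real (card A)) - exp (- (3 * s) * real (card A))) * real (card A) powr a * c n F \<phi> A)" .
  have "avg n (\<lambda>x. inner (cdiff j F x) (\<phi> j x)) =
    (\<Sum>A\<in>Pow {1..n}. 1 * avg n (\<lambda>x. inner (cdiff j (\<lambda>x. rwalsh A x *\<^sub>R walsh_coeff n F A) x) (\<phi> j x)))" if "j \<in> {1..n}" for j
    by (rule avg_inner_cdiff_expand[OF that]) (use walsh_inversion in simp)
  then have "(\<Sum>j\<in>{1..n}. avg n (\<lambda>x. inner (cdiff j F x) (\<phi> j x))) = (\<Sum>j\<in>{1..n}. \<Sum>A\<in>Pow {1..n}.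
      avg n (\<lambda>x. inner (cdiff j (\<lambda>x. rwalsh A x *\<^sub>R walsh_coeff n F A) x) (\<phi> j x)))" by simp
  also have "\<dots> = (\<Sum>A\<in>Pow {1..n}. c n F \<phi> A)"
    unfolding c_def by (rule sum.swap)
  finally show "(\<Sum>j\<in>{1..n}. avg n (\<lambda>x. inner (cdiff j F x) (\<phi> j x))) = (\<Sum>A\<in>Pow {1..n}. c n F \<phi> A)" .
qed

lemma Gamma_integral_scaled:
  fixes x c :: real
  assumes x: "0 < x" and c: "0 < c"
  shows "(\<lambda>t. t powr (x - 1) * exp (- (c * t))) absolutely_integrable_on {0..}"
    and "integral {0..} (\<lambda>t. t powr (x - 1) * exp (- (c * t))) = Gamma x / c powr x"
proof -
  define f where "f t = t powr (x - 1) / exp t" for t :: real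
  have "(f has_integral Gamma x) {0..}" unfolding f_def by (rule Gamma_integral_real[OF x])
  then have f: "f absolutely_integrable_on {0..}" "integral {0..} f = Gamma x"
    by (auto simp: f_def intro!: nonnegative_absolutely_integrable_1 simp: has_integral_iff)
  have im: "(\<lambda>t. c * t) ` {0..} = {0..}"
  proof (intro equalityI subsetI)
    fix y :: real assume "y \<in> {0..}"
    then show "y \<in> (\<lambda>t. c * t) ` {0..}" using c by (intro image_eqI[of _ _ "y / c"]) auto
  qed (use c in auto)
  have "(\<lambda>t. \<bar>c\<bar> * f (c * t)) absolutely_integrable_on {0..} \<and> integral {0..} (\<lambda>t. \<bar>c\<bar> * f (c * t)) = Gamma x"
    using has_absolute_integral_change_of_variables_1'[of "{0..}" "\<lambda>t. c * t" "\<lambda>_. c" f "Gamma x"] f c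
    unfolding im by (auto simp: inj_on_def intro!: derivative_eq_intros)
  moreover have "\<bar>c\<bar> * f (c * t) = c powr x * (t powr (x - 1) * exp (- (c * t)))" if "t \<in> {0..}" for t
    using that c powr_mult_base[of c "x - 1"] by (simp add: f_def powr_mult exp_minus divide_inverse)
  then have "(\<lambda>t. \<bar>c\<bar> * f (c * t)) absolutely_integrable_on {0..} \<longleftrightarrow>
      (\<lambda>t. c powr x * (t powr (x - 1) * exp (- (c * t)))) absolutely_integrable_on {0..}"
    "integral {0..} (\<lambda>t. \<bar>c\<bar> * f (c * t)) = integral {0..} (\<lambda>t. c powr x * (t powr (x - 1) * exp (- (c * t))))"
    by (intro set_integrable_cong integral_cong refl; simp)+
  ultimately have *: "(\<lambda>t. c powr x * (t powr (x - 1) * exp (- (c * t)))) absolutely_integrable_on {0..}"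
    "integral {0..} (\<lambda>t. c powr x * (t powr (x - 1) * exp (- (c * t)))) = Gamma x"
    by simp_all
  have c0: "c powr x \<noteq> 0" using c by simp
  show "(\<lambda>t. t powr (x - 1) * exp (- (c * t))) absolutely_integrable_on {0..}"
    using *(1) c0 by simp
  show "integral {0..} (\<lambda>t. t powr (x - 1) * exp (- (c * t))) = Gamma x / c powr x"
    using *(2) c0 by (simp add: field_simps)
qed

text \<open>
  The integral is independent of \<open>a\<close> by scaling; this makes the average of the pairing over all
  scales a multiple of the pairing with the gradient itself.
\<close>

lemma reproducing_constant:
  fixes p a :: real
  assumes p: "1 < p" "p < 2" and a: "0 < a"
  shows "(\<lambda>s. s powr (1/p - 1) * ((exp (- (2 * s) * a) - exp (- (3 * s) * a)) * a powr (1/p))) absolutely_integrable_on {0..}"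
    and "integral {0..} (\<lambda>s. s powr (1/p - 1) * ((exp (- (2 * s) * a) - exp (- (3 * s) * a)) * a powr (1/p)))
      = Gamma (1/p) * (2 powr (-1/p) - 3 powr (-1/p))"
proof -
  have x: "0 < 1/p" using p by simp
  define h where "h c s = s powr (1/p - 1) * exp (- (c * s))" for c s :: real
  have h: "h c absolutely_integrable_on {0..}" "integral {0..} (h c) = Gamma (1/p) / c powr (1/p)" if "0 < c" for c
    unfolding h_def using Gamma_integral_scaled[OF x that] by auto
  have e: "s powr (1/p - 1) * ((exp (- (2 * s) * a) - exp (- (3 * s) * a)) * a powr (1/p)) =
      a powr (1/p) * (h (2 * a) s - h (3 * a) s)" for s
    by (simp add: h_def algebra_simps)
  have h2: "h (2 * a) absolutely_integrable_on {0..}" and h3: "h (3 * a) absolutely_integrable_on {0..}"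
    using a by (auto intro: h)
  show "(\<lambda>s. s powr (1/p - 1) * ((exp (- (2 * s) * a) - exp (- (3 * s) * a)) * a powr (1/p))) absolutely_integrable_on {0..}"
    unfolding e by (intro set_integrable_mult_right set_integral_diff h2 h3)
  have "integral {0..} (\<lambda>s. a powr (1/p) * (h (2 * a) s - h (3 * a) s)) =
      a powr (1/p) * (integral {0..} (h (2 * a)) - integral {0..} (h (3 * a)))"
    using h2 h3 by (simp add: integral_diff set_lebesgue_integral_eq_integral)
  also have "\<dots> = Gamma (1/p) * (2 powr (-1/p) - 3 powr (-1/p))"
  proof -
    have m: "b powr (-1/p) = 1 / b powr (1/p)" for b :: real
      using powr_minus_divide[of b "1/p"] by simp
    show ?thesis using a unfolding m by (simp add: h powr_mult field_simps)
  qed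
  finally show "integral {0..} (\<lambda>s. s powr (1/p - 1) * ((exp (- (2 * s) * a) - exp (- (3 * s) * a)) * a powr (1/p)))
      = Gamma (1/p) * (2 powr (-1/p) - 3 powr (-1/p))"
    unfolding e .
qed

text \<open>
  The lower bound is uniform in \<open>p\<close>: on \<open>[1/2, 1]\<close> the integrand of the Gamma function is at least \<open>1/e\<close>, and
  \<open>1 - (2/3)\<^sup>x \<ge> 1/6\<close> for \<open>x \<ge> 1/2\<close>.
\<close>

lemma reproducing_constant_ge:
  fixes p :: real
  assumes p: "1 < p" "p < 2"
  shows "1 / 72 \<le> Gamma (1/p) * (2 powr (-1/p) - 3 powr (-1/p))"
proof -
  define x where "x = 1/p"
  have x: "1/2 < x" "x < 1" using p by (auto simp: x_def field_simps)
  have e3: "1/3 \<le> exp (-1::real)"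
    using exp_le by (simp add: exp_minus field_simps)
  have G: "1 / 6 \<le> Gamma x"
  proof -
    have I: "((\<lambda>t. t powr (x - 1) / exp t) has_integral Gamma x) {0..}"
      using x by (intro Gamma_integral_real) auto
    have sub: "(\<lambda>t. t powr (x - 1) / exp t) integrable_on {1/2..1::real}"
      using I by (intro integrable_on_subinterval[of _ "{0..}"]) auto
    have "integral {1/2..1::real} (\<lambda>t. 1/3) \<le> integral {1/2..1} (\<lambda>t. t powr (x - 1) / exp t)"
    proof (intro integral_le sub)
      fix t :: real assume t: "t \<in> {1/2..1}"
      have "1 powr (x - 1) \<le> t powr (x - 1)" using t x by (intro powr_mono2') auto
      moreover have "exp (-1) \<le> exp (- t)" using t by simp
      ultimately have "1 * exp (-1) \<le> t powr (x - 1) * exp (- t)" by (intro mult_mono) auto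
      moreover have "t powr (x - 1) / exp t = t powr (x - 1) * exp (- t)"
        by (simp only: exp_minus divide_inverse)
      ultimately show "1/3 \<le> t powr (x - 1) / exp t" using e3 by linarith
    qed auto
    also have "\<dots> \<le> integral {0..} (\<lambda>t. t powr (x - 1) / exp t)"
      using I sub by (intro integral_subset_le) (auto simp: has_integral_iff)
    finally show ?thesis using I by (simp add: has_integral_iff)
  qed
  have "(2/3::real) powr x \<le> (2/3) powr (1/2)" using x by (intro powr_mono') auto
  also have "\<dots> = sqrt (2/3)" by (simp add: powr_half_sqrt)
  also have "\<dots> \<le> 5/6" by (rule real_le_lsqrt) (auto simp: power2_eq_square)
  finally have h: "(2/3::real) powr x \<le> 5/6" .
  have "(2::real) powr (-1) \<le> 2 powr (- x)" using x by (intro powr_mono) auto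
  then have "1/2 * (1/6) \<le> 2 powr (- x) * (1 - (2/3) powr x)"
    using h by (intro mult_mono) auto
  also have "\<dots> = 2 powr (-x) - 3 powr (-x)"
  proof -
    have m: "b powr (- x) = 1 / b powr x" for b :: real
      by (rule powr_minus_divide)
    have d: "(2/3) powr x = 2 powr x / (3::real) powr x" by (intro powr_divide; simp)
    have "1 / a * (1 - a / b) = 1 / a - 1 / b" if "a \<noteq> 0" for a b :: real
      using that by (simp add: field_simps)
    from this[of "2 powr x" "3 powr x"] show ?thesis unfolding m d by simp
  qed
  finally have "1/12 \<le> 2 powr (-x) - 3 powr (-(x::real))" by simp
  then have "1/6 * (1/12) \<le> Gamma x * (2 powr (-x) - 3 powr (-x))"
    using G by (intro mult_mono) auto
  then show ?thesis by (simp add: x_def)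
qed

text \<open>
  Summing over a dyadic grid and then averaging over its position \<open>r\<close> amounts to integrating over all
  scales between \<open>2\<^bsup>-M\<^esup>\<close> and \<open>1\<close>.
\<close>

lemma integral_dyadic:
  fixes w :: "real \<Rightarrow> real"
  assumes "w integrable_on {1 / 2 ^ M..1}"
  shows "((\<lambda>r. \<Sum>m<M. w (r / 2 ^ m) / 2 ^ m) has_integral integral {1 / 2 ^ M..1} w) {1/2..1}"
  using assms
proof (induction M)
  case 0
  then show ?case by simp
next
  case (Suc M)
  have le: "1 / 2 ^ Suc M \<le> (1 / 2 ^ M :: real)" "(1 / 2 ^ M :: real) \<le> 1"
    by (auto simp: field_simps)
  have sub: "w integrable_on {1 / 2 ^ M..1}" "w integrable_on {1 / 2 ^ Suc M..1 / 2 ^ M}"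
    by (intro integrable_subinterval_real[OF Suc.prems] atLeastatMost_subset_iff[THEN iffD2] disjI2 conjI le order_refl)+
  define i where "i = integral {1 / 2 ^ Suc M..1 / 2 ^ M} w"
  have "(w has_integral i) {1 / 2 ^ Suc M..1 / 2 ^ M}"
    using sub(2) by (simp add: i_def integrable_integral)
  then have "((\<lambda>r. w ((1 / 2 ^ M) * r)) has_integral (1 / \<bar>1 / 2 ^ M\<bar>) *\<^sub>R i) ((\<lambda>x. x / (1 / 2 ^ M)) ` {1 / 2 ^ Suc M..1 / 2 ^ M})"
    by (rule has_integral_stretch_real) simp
  also have "(\<lambda>x. x / (1 / 2 ^ M)) ` {1 / 2 ^ Suc M..1 / 2 ^ M} = {1/2..1::real}"
    using image_mult_atLeastAtMost[of "2 ^ M :: real" "1 / 2 ^ Suc M" "1 / 2 ^ M"] by (simp add: mult.commute)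
  finally have "((\<lambda>r. w (r / 2 ^ M)) has_integral 2 ^ M * i) {1/2..1}" by simp
  then have "((\<lambda>r. w (r / 2 ^ M) / 2 ^ M) has_integral (2 ^ M * i) / 2 ^ M) {1/2..1}"
    by (rule has_integral_divide)
  then have "((\<lambda>r. w (r / 2 ^ M) / 2 ^ M) has_integral i) {1/2..1}" by simp
  from has_integral_add[OF Suc.IH[OF sub(1)] this]
  show ?case
    using Henstock_Kurzweil_Integration.integral_combine[OF le Suc.prems] by (simp add: i_def add.commute)
qed

lemma integral_le_of_truncations:
  fixes f :: "real \<Rightarrow> real"
  assumes f: "f integrable_on {0..1}" and U: "\<And>M::nat. integral {1 / 2 ^ M..1} f \<le> U"
  shows "integral {0..1} f \<le> U"
proof -
  have cont: "continuous_on {0..1} (\<lambda>x. integral {x..1} f)"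
    by (rule indefinite_integral_continuous_1'[OF f])
  have "((\<lambda>x. integral {x..1} f) \<longlongrightarrow> integral {0..1} f) (at 0 within {0..1})"
    using cont by (simp add: continuous_on_def)
  moreover have "filterlim (\<lambda>M::nat. 1 / 2 ^ M :: real) (at 0 within {0..1}) sequentially"
    unfolding filterlim_at
    using LIMSEQ_inverse_realpow_zero[of 2] by (auto simp: divide_inverse inverse_le_1_iff)
  ultimately have "(\<lambda>M::nat. integral {1 / 2 ^ M..1} f) \<longlonglongrightarrow> integral {0..1} f"
    by (rule filterlim_compose)
  then show ?thesis by (rule LIMSEQ_le_const2) (use U in auto)
qed

text \<open>
  The function \<open>w\<close> is the integrand minus the multiple of the energy that the dyadic estimate leaves on its right side, so
  its dyadic sums are bounded uniformly in the position of the grid. The energy is then put back at the cost of its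
  integral over \<open>(0, 1]\<close>, which is at most \<open>1/(p - 1)\<close>. Of the constant, \<open>90\<close> is due to the scales below \<open>1\<close> and \<open>82\<close> to those
  above.
\<close>

lemma integral_pairing_le:
  fixes g :: "(nat \<Rightarrow> real) \<Rightarrow> 'a::real_inner" and \<phi> :: "nat \<Rightarrow> (nat \<Rightarrow> real) \<Rightarrow> 'a"
  assumes p: "1 < p" "p < 2" and q: "q = p / (p - 1)"
    and nz: "\<And>s x. 0 \<le> s \<Longrightarrow> x \<in> cube n \<Longrightarrow> heat n s g x \<noteq> 0"
    and X: "moment n p g \<le> 1"
    and Z: "avg n (\<lambda>x. (l2norm {1..n} \<phi> x) powr q) \<le> 1"
    and int: "(\<lambda>s. s powr (1/p - 1) * pairing n g \<phi> s) absolutely_integrable_on {0..}"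
  shows "integral {0..} (\<lambda>s. s powr (1/p - 1) * pairing n g \<phi> s) \<le> 172 / (p - 1)\<^sup>2"
proof -
  define f where "f s = s powr (1/p - 1) * pairing n g \<phi> s" for s
  define e where "e t = avg n (energy n p (heat n t g))" for t
  define C where "C = 9 * (sqrt (10 * q) / (p - 1))"
  have q0: "0 < q" using p by (simp add: q)
  have C0: "0 \<le> C" using p q0 by (simp add: C_def)
  have f: "f absolutely_integrable_on {0..}" using int by (simp add: f_def[abs_def])
  then have fi: "f integrable_on {0..}" by (simp add: set_lebesgue_integral_eq_integral)
  have f01: "f integrable_on {0..1}" by (rule integrable_on_subinterval[OF fi]) auto
  have f1: "f integrable_on {1..}"
    using set_integrable_subset[OF f, of "{1..}"] by (simp add: set_lebesgue_integral_eq_integral)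
  have small: "integral {1 / 2 ^ M..1} f \<le> 2 * C" for M
  proof -
    define w where "w s = f s - C * ((p - 1) * e s)" for s
    have le: "0 \<le> (1 / 2 ^ M :: real)" "(1 / 2 ^ M :: real) \<le> 1" by (auto simp: field_simps)
    have ei: "e integrable_on {1 / 2 ^ M..1}" and ele: "(p - 1) * integral {1 / 2 ^ M..1} e \<le> 1"
      using energy_integral[OF p le nz] X by (auto simp: e_def[abs_def])
    have fM: "f integrable_on {1 / 2 ^ M..1}"
      by (rule integrable_on_subinterval[OF fi]) (use le in auto)
    have wi: "w integrable_on {1 / 2 ^ M..1}"
      unfolding w_def by (intro integrable_diff fM integrable_on_mult_right ei)
    have "integral {1 / 2 ^ M..1} w \<le> C"
    proof (rule has_integral_le[OF integral_dyadic[OF wi]])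
      show "((\<lambda>r. 2 * C) has_integral C) {1/2..1::real}"
        using has_integral_const_real[of "2 * C" "1/2" 1] by simp
      fix r :: real assume r: "r \<in> {1/2..1}"
      have "(\<Sum>m<M. f (r / 2 ^ m) / 2 ^ m) = (1 / r) * (\<Sum>m<M. (r / 2 ^ m) powr (1 / p) * pairing n g \<phi> (r / 2 ^ m))"
        unfolding sum_distrib_left
      proof (intro sum.cong refl)
        fix m
        have "(r / 2 ^ m) powr (1/p) = (r / 2 ^ m) * (r / 2 ^ m) powr (1/p - 1)"
          using r powr_mult_base[of "r / 2 ^ m" "1/p - 1"] by simp
        then show "f (r / 2 ^ m) / 2 ^ m = (1 / r) * ((r / 2 ^ m) powr (1 / p) * pairing n g \<phi> (r / 2 ^ m))"
          using r by (simp add: f_def field_simps)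
      qed
      also have "\<dots> \<le> (1 / r) * (C * (1 + (p - 1) * (\<Sum>m<M. (r / 2 ^ m) * e (r / 2 ^ m))))"
        unfolding C_def e_def using r
        by (intro mult_left_mono pairing_dyadic_sum p q nz X Z) auto
      also have "\<dots> = C * (1 / r + (p - 1) * (\<Sum>m<M. e (r / 2 ^ m) / 2 ^ m))"
      proof -
        have "(\<Sum>m<M. (r / 2 ^ m) * e (r / 2 ^ m)) = r * (\<Sum>m<M. e (r / 2 ^ m) / 2 ^ m)"
          by (simp add: sum_distrib_left)
        moreover have "(1 / r) * (C * (1 + (p - 1) * (r * S))) = C * (1 / r + (p - 1) * S)" for S
          using r by (simp add: field_simps)
        ultimately show ?thesis by simp
      qed
      also have "\<dots> \<le> C * (2 + (p - 1) * (\<Sum>m<M. e (r / 2 ^ m) / 2 ^ m))"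
        using r C0 by (intro mult_left_mono add_right_mono) (auto simp: field_simps)
      finally have "(\<Sum>m<M. f (r / 2 ^ m) / 2 ^ m) \<le> 2 * C + C * ((p - 1) * (\<Sum>m<M. e (r / 2 ^ m) / 2 ^ m))"
        by (simp add: distrib_left mult.commute)
      moreover have "(\<Sum>m<M. w (r / 2 ^ m) / 2 ^ m) = (\<Sum>m<M. f (r / 2 ^ m) / 2 ^ m)
          - C * ((p - 1) * (\<Sum>m<M. e (r / 2 ^ m) / 2 ^ m))"
        by (simp add: w_def diff_divide_distrib sum_subtractf sum_distrib_left)
      ultimately show "(\<Sum>m<M. w (r / 2 ^ m) / 2 ^ m) \<le> 2 * C" by linarith
    qed
    moreover have "integral {1 / 2 ^ M..1} w = integral {1 / 2 ^ M..1} f - C * ((p - 1) * integral {1 / 2 ^ M..1} e)"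
      unfolding w_def using fM ei by (simp add: integral_diff integrable_on_mult_right)
    moreover have "C * ((p - 1) * integral {1 / 2 ^ M..1} e) \<le> C * 1"
      by (intro mult_left_mono ele C0)
    ultimately show ?thesis by simp
  qed
  have I1: "integral {0..1} f \<le> 2 * C" by (rule integral_le_of_truncations[OF f01 small])
  have I2: "integral {1..} f \<le> 82 / (p - 1)"
  proof -
    have E: "((\<lambda>s. 82 / (p - 1) * (exp 1 * exp (- 1 * s))) has_integral 82 / (p - 1) * (exp 1 * (exp (- 1 * 1) / 1))) {1..}"
      by (intro has_integral_mult_right has_integral_exp_minus_to_infinity) simp
    have "integral {1..} f \<le> 82 / (p - 1) * (exp 1 * (exp (- 1 * 1) / 1))"
    proof (rule has_integral_le[OF integrable_integral[OF f1] E])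
      fix s :: real assume s: "s \<in> {1..}"
      have sp: "s powr (1/p - 1) \<le> 1" "0 \<le> s powr (1/p - 1)"
        using s p powr_mono[of "1/p - 1" 0 s] by auto
      have "f s \<le> s powr (1/p - 1) * (82 / (p - 1) * exp (- (s - 1)))"
        unfolding f_def using s by (intro mult_left_mono pairing_large_time[where q = q] p q nz X Z) auto
      also have "\<dots> \<le> 1 * (82 / (p - 1) * exp (- (s - 1)))"
        using sp p by (intro mult_right_mono) auto
      finally show "f s \<le> 82 / (p - 1) * (exp 1 * exp (- 1 * s))"
        by (simp add: exp_add[symmetric])
    qed
    then show ?thesis by (simp add: exp_minus)
  qed
  have "integral ({0..1} \<union> {1..}) f = integral {0..1} f + integral {1..} f"
    by (rule integral_Un[OF f01 f1]) (auto intro: negligible_subset[of "{1}"])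
  moreover have "{0..1} \<union> {1..} = {0::real..}" by auto
  ultimately have "integral {0..} f \<le> 2 * C + 82 / (p - 1)" using I1 I2 by simp
  also have "\<dots> \<le> 172 / (p - 1)\<^sup>2"
  proof -
    define d where "d = p - 1"
    have d: "0 < d" "d < 1" using p by (auto simp: d_def)
    have "10 * q \<le> 25 / d\<^sup>2"
    proof -
      have "10 * q = 10 * p / d" by (simp add: q d_def)
      also have "\<dots> \<le> 25 / d" using p d by (intro divide_right_mono) auto
      also have "\<dots> \<le> 25 / d\<^sup>2" using d by (intro divide_left_mono) (auto simp: power2_eq_square)
      finally show ?thesis .
    qed
    then have "sqrt (10 * q) \<le> sqrt (25 / d\<^sup>2)" by (rule real_sqrt_le_mono)
    also have "\<dots> = 5 / d" using d by (simp add: real_sqrt_divide)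
    finally have "sqrt (10 * q) / d \<le> (5 / d) / d" using d by (intro divide_right_mono) auto
    then have "2 * C \<le> 90 / d\<^sup>2" by (simp add: C_def d_def power2_eq_square)
    moreover have "82 / d \<le> 82 / d\<^sup>2" using d by (intro divide_left_mono) (auto simp: power2_eq_square)
    ultimately show ?thesis by (simp add: d_def add_divide_distrib[symmetric])
  qed
  finally show ?thesis by (simp add: f_def[abs_def])
qed

section \<open>The gradient estimate\<close>

lemma noise_Pair: "noise n \<theta> (\<lambda>x. (f x, g x)) x = (noise n \<theta> f x, noise n \<theta> g x)"
  by (simp add: noise_def sum_prod)

lemma cdiff_Pair_const: "cdiff j (\<lambda>x. (f x, c)) x = (cdiff j f x, 0)"
  by (simp add: cdiff_def zero_prod_def)

lemma norm_Pair_powr_le: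
  assumes p: "1 < p" "p < 2" and a: "0 \<le> a"
  shows "norm (v, a :: real) powr p \<le> norm v powr p + a powr p"
proof -
  have "(norm v)\<^sup>2 + a\<^sup>2 = (norm v powr p) powr (2/p) + (a powr p) powr (2/p)"
    using p a by (simp add: powr_powr)
  also have "\<dots> \<le> (norm v powr p + a powr p) powr (2/p)"
    using sum_powr_le_powr_sum[of "{True, False}" "2/p" "\<lambda>b. if b then norm v powr p else a powr p"] p by simp
  finally have le: "(norm v)\<^sup>2 + a\<^sup>2 \<le> (norm v powr p + a powr p) powr (2/p)" .
  have "norm (v, a) powr p = ((norm v)\<^sup>2 + a\<^sup>2) powr (p/2)"
    using a by (simp add: norm_Pair powr_half_sqrt[symmetric] powr_powr)
  also have "\<dots> \<le> ((norm v powr p + a powr p) powr (2/p)) powr (p/2)"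
    using p le by (intro powr_mono2) auto
  also have "\<dots> = norm v powr p + a powr p"
    using p by (simp add: powr_powr)
  finally show ?thesis .
qed

text \<open>
  To make the heat flow nonvanishing, a small constant \<open>a\<close> is appended to \<open>g\<close> as an extra orthogonal coordinate. It is
  invariant under the flow and invisible to differences, hence to the pairing, and the strict inequality in the
  hypothesis leaves room for it in \<open>L\<^sub>p\<close>. The constant is \<open>72 * 172\<close>, where \<open>1/72\<close> is the lower bound for the
  reproducing constant.
\<close>

lemma gradient_dual_bound:
  fixes F :: "(nat \<Rightarrow> real) \<Rightarrow> 'a::real_inner" and \<phi> :: "nat \<Rightarrow> (nat \<Rightarrow> real) \<Rightarrow> 'a"
  assumes p: "1 < p" "p < 2" and q: "q = p / (p - 1)"
    and X: "moment n p (num_power n (1/p) F) < 1"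
    and Z: "avg n (\<lambda>x. (l2norm {1..n} \<phi> x) powr q) \<le> 1"
  shows "(\<Sum>j\<in>{1..n}. avg n (\<lambda>x. inner (cdiff j F x) (\<phi> j x))) \<le> 12384 / (p - 1)\<^sup>2"
proof -
  define g where "g = num_power n (1/p) F"
  define \<kappa> where "\<kappa> = Gamma (1/p) * (2 powr (-1/p) - 3 powr (-1/p))"
  define c where "c A = (\<Sum>j\<in>{1..n}. avg n (\<lambda>x. inner (cdiff j (\<lambda>x. rwalsh A x *\<^sub>R walsh_coeff n F A) x) (\<phi> j x)))" for A
  define P where "P = (\<Sum>j\<in>{1..n}. avg n (\<lambda>x. inner (cdiff j F x) (\<phi> j x)))"
  define h where "h A s = s powr (1/p - 1) * ((exp (- (2 * s) * real (card A)) - exp (- (3 * s) * real (card A))) * real (card A) powr (1/p))"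
    for A :: "nat set" and s
  have c_empty: "c {} = 0" by (simp add: c_def rwalsh_def cdiff_def)
  have hA: "(\<lambda>s. c A * h A s) absolutely_integrable_on {0..} \<and> integral {0..} (\<lambda>s. c A * h A s) = c A * \<kappa>"
    if A: "A \<in> Pow {1..n}" for A
  proof (cases "A = {}")
    case True
    then show ?thesis by (simp add: c_empty)
  next
    case False
    then have a: "0 < real (card A)" using A finite_subset[of A "{1..n}"] by (auto simp: card_gt_0_iff)
    show ?thesis
      using reproducing_constant[OF p a] unfolding h_def \<kappa>_def
      by (auto intro!: set_integrable_mult_right)
  qed
  have pair: "s powr (1/p - 1) * pairing n g \<phi> s = (\<Sum>A\<in>Pow {1..n}. c A * h A s)" for s
    unfolding g_def pairing_num_power(1) c_def[symmetric] h_def sum_distrib_left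
    by (intro sum.cong refl) (simp add: mult_ac)
  have int: "(\<lambda>s. s powr (1/p - 1) * pairing n g \<phi> s) absolutely_integrable_on {0..}"
    unfolding pair using hA by (intro absolutely_integrable_sum) auto
  have "integral {0..} (\<lambda>s. s powr (1/p - 1) * pairing n g \<phi> s) = (\<Sum>A\<in>Pow {1..n}. integral {0..} (\<lambda>s. c A * h A s))"
    unfolding pair using hA by (intro integral_sum) (auto simp: set_lebesgue_integral_eq_integral)
  also have "\<dots> = P * \<kappa>"
  proof -
    have "P = (\<Sum>A\<in>Pow {1..n}. c A)" unfolding P_def c_def by (rule pairing_num_power(2))
    then have "P * \<kappa> = (\<Sum>A\<in>Pow {1..n}. c A * \<kappa>)" by (simp only: sum_distrib_right)
    moreover have "(\<Sum>A\<in>Pow {1..n}. integral {0..} (\<lambda>s. c A * h A s)) = (\<Sum>A\<in>Pow {1..n}. c A * \<kappa>)"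
      by (intro sum.cong refl) (use hA in blast)
    ultimately show ?thesis by simp
  qed
  finally have I: "integral {0..} (\<lambda>s. s powr (1/p - 1) * pairing n g \<phi> s) = P * \<kappa>" .
  \<comment> \<open>With this value the \<open>p\<close>-th moments of \<open>g\<close> and of \<open>a\<close> add up to \<open>1\<close>.\<close>
  define a where "a = (1 - moment n p g) powr (1/p)"
  have a: "0 < a" "a powr p = 1 - moment n p g"
    using X p by (auto simp: a_def g_def powr_powr)
  define g' where "g' x = (g x, a)" for x
  define \<phi>' where "\<phi>' j x = (\<phi> j x, 0::real)" for j x
  have heat': "heat n s g' = (\<lambda>x. (heat n s g x, a))" for s
    by (rule ext) (simp add: g'_def[abs_def] noise_Pair)
  have "pairing n g' \<phi>' s = pairing n g \<phi> s" for s
    unfolding pairing_def heat' \<phi>'_def[abs_def] noise_Pair cdiff_Pair_const by simp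
  then have pair': "pairing n g' \<phi>' = pairing n g \<phi>" by (rule ext)
  have "integral {0..} (\<lambda>s. s powr (1/p - 1) * pairing n g' \<phi>' s) \<le> 172 / (p - 1)\<^sup>2"
  proof (rule integral_pairing_le[OF p q])
    show "heat n s g' x \<noteq> 0" for s x using a by (simp add: heat' zero_prod_def)
    have "moment n p g' \<le> avg n (\<lambda>x. norm (g x) powr p + a powr p)"
      unfolding g'_def using a by (intro avg_mono norm_Pair_powr_le p) auto
    also have "\<dots> = 1" unfolding avg_add by (simp add: a)
    finally show "moment n p g' \<le> 1" .
    show "avg n (\<lambda>x. (L2_set (\<lambda>j. norm (\<phi>' j x)) {1..n}) powr q) \<le> 1"
      using Z by (simp add: \<phi>'_def norm_Pair)
    show "(\<lambda>s. s powr (1/p - 1) * pairing n g' \<phi>' s) absolutely_integrable_on {0..}"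
      using int by (simp add: pair')
  qed
  then have le: "P * \<kappa> \<le> 172 / (p - 1)\<^sup>2" by (simp add: pair' I)
  have \<kappa>: "1/72 \<le> \<kappa>" unfolding \<kappa>_def by (rule reproducing_constant_ge[OF p])
  show ?thesis
  proof (cases "P \<le> 0")
    case True
    then show ?thesis unfolding P_def[symmetric] by (rule order_trans) auto
  next
    case False
    then have "P * (1/72) \<le> P * \<kappa>" using \<kappa> by (intro mult_left_mono) auto
    then have "P \<le> 72 * (172 / (p - 1)\<^sup>2)" using le by linarith
    then show ?thesis by (simp add: P_def)
  qed
qed

text \<open>
  Duality with the extremal field \<open>\<phi> = |\<nabla>F|\<^bsup>p-2\<^esup> \<nabla>F\<close>, normalised in \<open>L\<^sub>q\<close>. The auxiliary \<open>\<epsilon>\<close> covers the case that the right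
  side vanishes and provides the strict inequality needed above.
\<close>

theorem gradient_bound:
  fixes F :: "(nat \<Rightarrow> real) \<Rightarrow> 'a::real_inner"
  assumes p: "1 < p" "p < 2"
  shows "avg n (\<lambda>x. (l2norm {1..n} (\<lambda>j. cdiff j F) x) powr p)
    \<le> (12384 / (p - 1)\<^sup>2) powr p * moment n p (num_power n (1/p) F)"
proof -
  define q where "q = p / (p - 1)"
  define B where "B = 12384 / (p - 1)\<^sup>2"
  define d where "d x = l2norm {1..n} (\<lambda>j. cdiff j F) x" for x
  define T where "T = avg n (\<lambda>x. d x powr p)"
  define N where "N = moment n p (num_power n (1/p) F) powr (1/p)"
  have d0: "0 \<le> d x" for x by (simp add: d_def)
  have T0: "0 \<le> T" unfolding T_def by (intro avg_nonneg) auto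
  have N0: "0 \<le> N" by (simp add: N_def)
  have B0: "0 \<le> B" by (simp add: B_def)
  have av0: "0 \<le> moment n p (num_power n (1/p) F)" by (intro avg_nonneg) auto
  have q: "1 < q" "1/p + 1/q = 1" "(p - 1) * q = p" using p by (auto simp: q_def field_simps)
  have "T powr (1/p) \<le> B * N"
  proof (cases "T = 0")
    case True
    then show ?thesis using B0 N0 by simp
  next
    case False
    then have Tpos: "0 < T" using T0 by simp
    define \<phi> where "\<phi> j x = (T powr (-1/q) * d x powr (p - 2)) *\<^sub>R cdiff j F x" for j x
    have L2: "l2norm {1..n} \<phi> x = T powr (-1/q) * d x powr (p - 1)" for x
    proof -
      have "l2norm {1..n} \<phi> x = T powr (-1/q) * (d x powr (p - 2) * d x)"
        unfolding mult.assoc[symmetric] unfolding d_def by (subst L2_set_right_distrib) (auto simp: \<phi>_def d_def)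
      also have "d x powr (p - 2) * d x = d x powr (p - 1)"
        using powr_mult_base[OF d0, of x "p - 2"] by (simp add: mult.commute)
      finally show ?thesis .
    qed
    have Z: "avg n (\<lambda>x. (l2norm {1..n} \<phi> x) powr q) \<le> 1"
    proof -
      have "(l2norm {1..n} \<phi> x) powr q = (1 / T) * d x powr p" for x
        unfolding L2 using q Tpos by (simp add: powr_mult powr_powr powr_neg_one)
      then have "avg n (\<lambda>x. (l2norm {1..n} \<phi> x) powr q) = (1 / T) * T"
        by (simp only: avg_cmult T_def)
      then show ?thesis using Tpos by simp
    qed
    have P: "(\<Sum>j\<in>{1..n}. avg n (\<lambda>x. inner (cdiff j F x) (\<phi> j x))) = T powr (1/p)"
    proof -
      have "(\<Sum>j\<in>{1..n}. inner (cdiff j F x) (\<phi> j x)) = T powr (-1/q) * d x powr p" for x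
      proof -
        have "(\<Sum>j\<in>{1..n}. inner (cdiff j F x) (\<phi> j x)) = (T powr (-1/q) * d x powr (p - 2)) * (\<Sum>j\<in>{1..n}. (norm (cdiff j F x))\<^sup>2)"
          by (simp add: \<phi>_def sum_distrib_left power2_norm_eq_inner)
        also have "(\<Sum>j\<in>{1..n}. (norm (cdiff j F x))\<^sup>2) = d x * d x"
          unfolding d_def L2_set_sq[symmetric] by (simp add: power2_eq_square)
        also have "T powr (-1/q) * d x powr (p - 2) * (d x * d x) = T powr (-1/q) * (d x * (d x * d x powr (p - 2)))"
          by (simp add: mult_ac)
        also have "d x * (d x * d x powr (p - 2)) = d x powr p"
          using powr_mult_base[OF d0, of x "p - 2"] powr_mult_base[OF d0, of x "p - 1"] by simp
        finally show ?thesis .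
      qed
      then have "(\<Sum>j\<in>{1..n}. avg n (\<lambda>x. inner (cdiff j F x) (\<phi> j x))) = T powr (-1/q) * T"
        by (simp only: avg_sum[symmetric] avg_cmult T_def)
      also have "\<dots> = T powr (1 + -1/q)"
        using Tpos powr_mult_base[of T "-1/q"] by (simp add: mult.commute)
      also have "1 + -1/q = 1/p" using q(2) by simp
      finally show ?thesis .
    qed
    have "T powr (1/p) \<le> B * (N + \<epsilon>)" if e: "0 < \<epsilon>" for \<epsilon>
    proof -
      define l where "l = 1 / (N + \<epsilon>)"
      have l: "0 < l" using N0 e by (simp add: l_def)
      have "moment n p (num_power n (1/p) (\<lambda>x. l *\<^sub>R F x)) = l powr p * moment n p (num_power n (1/p) F)"
        using l by (simp add: num_power_scaleR powr_mult avg_cmult)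
      also have "\<dots> = (l * N) powr p"
        using p l av0 by (simp add: N_def powr_mult powr_powr)
      also have "\<dots> < 1"
      proof -
        have "l * N < 1" using N0 e by (simp add: l_def)
        then have "(l * N) powr p < 1 powr p" using l N0 p by (intro powr_less_mono2) auto
        then show ?thesis by simp
      qed
      finally have "(\<Sum>j\<in>{1..n}. avg n (\<lambda>x. inner (cdiff j (\<lambda>x. l *\<^sub>R F x) x) (\<phi> j x))) \<le> B"
        unfolding B_def by (intro gradient_dual_bound[OF p q_def _ Z])
      then have "l * (\<Sum>j\<in>{1..n}. avg n (\<lambda>x. inner (cdiff j F x) (\<phi> j x))) \<le> B"
        by (simp add: cdiff_scaleR avg_cmult sum_distrib_left)
      then show ?thesis using N0 e unfolding P l_def by (simp add: field_simps)
    qed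
    then have "T powr (1/p) \<le> B * N + \<epsilon>" if e: "0 < \<epsilon>" for \<epsilon>
    proof -
      have "T powr (1/p) \<le> B * (N + \<epsilon> / (B + 1))" using \<open>\<And>\<epsilon>. 0 < \<epsilon> \<Longrightarrow> T powr (1/p) \<le> B * (N + \<epsilon>)\<close> e B0 by simp
      also have "\<dots> = B * N + B / (B + 1) * \<epsilon>" by (simp add: distrib_left)
      also have "\<dots> \<le> B * N + 1 * \<epsilon>" using e B0 by (intro add_left_mono mult_right_mono) auto
      finally show ?thesis by simp
    qed
    then show ?thesis by (rule field_le_epsilon)
  qed
  then have "(T powr (1/p)) powr p \<le> (B * N) powr p"
    using p by (intro powr_mono2) auto
  then show ?thesis
    using p T0 av0 B0 by (simp add: powr_powr powr_mult N_def) (simp add: T_def d_def B_def)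
qed

section \<open>A real inner product space of finitely supported families\<close>

text \<open>
  A single type is needed that contains the families of all derivatives of order \<open>k\<close> for all \<open>n\<close> and \<open>k\<close>, with a Euclidean
  norm. Families with finite support serve this purpose.
\<close>

typedef fam = "{f :: nat list \<Rightarrow> complex. finite {i. f i \<noteq> 0}}"
  morphisms coord Abs_fam
  by (intro exI[of _ "\<lambda>_. 0"]) auto

setup_lifting type_definition_fam

lemma finite_coord: "finite {i. coord v i \<noteq> 0}"
  using coord by simp

lemma fam_eqI: "(\<And>i. coord v i = coord w i) \<Longrightarrow> v = w"
  by (metis coord_inject ext)

instantiation fam :: real_vector
begin

lift_definition zero_fam :: fam is "\<lambda>_. 0" by simp
lift_definition plus_fam :: "fam \<Rightarrow> fam \<Rightarrow> fam" is "\<lambda>f g i. f i + g i"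
proof -
  fix f g :: "nat list \<Rightarrow> complex" assume "finite {i. f i \<noteq> 0}" "finite {i. g i \<noteq> 0}"
  then show "finite {i. f i + g i \<noteq> 0}"
    by (rule_tac finite_subset[of _ "{i. f i \<noteq> 0} \<union> {i. g i \<noteq> 0}"]) auto
qed
lift_definition minus_fam :: "fam \<Rightarrow> fam \<Rightarrow> fam" is "\<lambda>f g i. f i - g i"
proof -
  fix f g :: "nat list \<Rightarrow> complex" assume "finite {i. f i \<noteq> 0}" "finite {i. g i \<noteq> 0}"
  then show "finite {i. f i - g i \<noteq> 0}"
    by (rule_tac finite_subset[of _ "{i. f i \<noteq> 0} \<union> {i. g i \<noteq> 0}"]) auto
qed
lift_definition uminus_fam :: "fam \<Rightarrow> fam" is "\<lambda>f i. - f i" by simp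
lift_definition scaleR_fam :: "real \<Rightarrow> fam \<Rightarrow> fam" is "\<lambda>c f i. c *\<^sub>R f i"
proof -
  fix c :: real and f :: "nat list \<Rightarrow> complex" assume "finite {i. f i \<noteq> 0}"
  then show "finite {i. c *\<^sub>R f i \<noteq> 0}" by (rule rev_finite_subset) auto
qed

instance
proof
  fix a b c :: fam and r s :: real
  show "a + b + c = a + (b + c)" by transfer (simp add: add.assoc)
  show "a + b = b + a" by transfer (simp add: add.commute)
  show "0 + a = a" by transfer simp
  show "- a + a = 0" by transfer simp
  show "a - b = a + - b" by transfer simp
  show "r *\<^sub>R (a + b) = r *\<^sub>R a + r *\<^sub>R b" by transfer (simp add: scaleR_add_right)
  show "(r + s) *\<^sub>R a = r *\<^sub>R a + s *\<^sub>R a" by transfer (simp add: scaleR_add_left)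
  show "r *\<^sub>R s *\<^sub>R a = (r * s) *\<^sub>R a" by transfer simp
  show "1 *\<^sub>R a = a" by transfer simp
qed

end

instantiation fam :: real_inner
begin

definition inner_fam :: "fam \<Rightarrow> fam \<Rightarrow> real" where
  "inner_fam v w = (\<Sum>i\<in>{i. coord v i \<noteq> 0}. inner (coord v i) (coord w i))"
definition norm_fam :: "fam \<Rightarrow> real" where
  "norm_fam v = sqrt (inner v v)"
definition sgn_fam :: "fam \<Rightarrow> fam" where
  "sgn_fam v = v /\<^sub>R norm v"
definition dist_fam :: "fam \<Rightarrow> fam \<Rightarrow> real" where
  "dist_fam v w = norm (v - w)"
definition uniformity_fam :: "(fam \<times> fam) filter" where
  "uniformity_fam = (INF e\<in>{0<..}. principal {(x, y). dist x y < e})"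
definition open_fam :: "fam set \<Rightarrow> bool" where
  "open_fam U = (\<forall>x\<in>U. eventually (\<lambda>(x', y). x' = x \<longrightarrow> y \<in> U) uniformity)"

lemma inner_fam_superset:
  assumes "finite S" "{i. coord v i \<noteq> 0} \<subseteq> S"
  shows "inner v w = (\<Sum>i\<in>S. inner (coord v i) (coord w i))"
  unfolding inner_fam_def using assms by (intro sum.mono_neutral_left) auto

instance
proof
  fix a b c :: fam and r s :: real
  show "dist a b = norm (a - b)" by (rule dist_fam_def)
  show "sgn a = a /\<^sub>R norm a" by (rule sgn_fam_def)
  show "uniformity = (INF e\<in>{0<..}. principal {(x, y :: fam). dist x y < e})" by (rule uniformity_fam_def)
  show "open U = (\<forall>x\<in>U. eventually (\<lambda>(x', y). x' = x \<longrightarrow> y \<in> U) uniformity)" for U :: "fam set"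
    by (rule open_fam_def)
  show "norm a = sqrt (inner a a)" by (rule norm_fam_def)
  define S where "S = {i. coord a i \<noteq> 0} \<union> {i. coord b i \<noteq> 0} \<union> {i. coord c i \<noteq> 0}"
  have S: "finite S" "{i. coord a i \<noteq> 0} \<subseteq> S" "{i. coord b i \<noteq> 0} \<subseteq> S"
      "{i. coord (a + b) i \<noteq> 0} \<subseteq> S" "{i. coord (r *\<^sub>R a) i \<noteq> 0} \<subseteq> S"
    using finite_coord by (auto simp: S_def plus_fam.rep_eq scaleR_fam.rep_eq)
  show "inner a b = inner b a"
    by (simp add: inner_fam_superset[OF S(1,2)] inner_fam_superset[OF S(1,3)] inner_commute)
  show "inner (a + b) c = inner a c + inner b c"
    by (simp add: inner_fam_superset[OF S(1,2)] inner_fam_superset[OF S(1,3)] inner_fam_superset[OF S(1,4)]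
        plus_fam.rep_eq inner_add_left sum.distrib)
  show "inner (r *\<^sub>R a) b = r * inner a b"
    by (simp add: inner_fam_superset[OF S(1,2)] inner_fam_superset[OF S(1,5)] scaleR_fam.rep_eq sum_distrib_left)
  show "0 \<le> inner a a" unfolding inner_fam_def by (intro sum_nonneg) auto
  show "(inner a a = 0) = (a = 0)"
  proof
    assume "inner a a = 0"
    then have "\<forall>i\<in>{i. coord a i \<noteq> 0}. inner (coord a i) (coord a i) = 0"
      unfolding inner_fam_def using finite_coord by (subst (asm) sum_nonneg_eq_0_iff) auto
    then show "a = 0" by (intro fam_eqI) (auto simp: zero_fam.rep_eq)
  qed (simp add: inner_fam_def zero_fam.rep_eq)
qed

end

lemma coord_sum: "coord (\<Sum>i\<in>I. v i) js = (\<Sum>i\<in>I. coord (v i) js)"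
  by (induction I rule: infinite_finite_induct) (auto simp: zero_fam.rep_eq plus_fam.rep_eq)

lemma norm_fam_superset:
  assumes "finite S" "{i. coord v i \<noteq> 0} \<subseteq> S"
  shows "(norm v)\<^sup>2 = (\<Sum>i\<in>S. (cmod (coord v i))\<^sup>2)"
  unfolding power2_norm_eq_inner inner_fam_superset[OF assms] ..

section \<open>Iterated derivatives\<close>

lemma D_eq_cdiff: "D = cdiff"
  by (simp add: fun_eq_iff D_def cdiff_def scaleR_conv_of_real)

lemma finite_index_tuples: "finite (index_tuples n k)"
  unfolding index_tuples_def by (rule finite_lists_length_eq) simp

definition tuple_derivs :: "nat \<Rightarrow> nat \<Rightarrow> ((nat \<Rightarrow> real) \<Rightarrow> complex) \<Rightarrow> (nat \<Rightarrow> real) \<Rightarrow> fam" where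
  "tuple_derivs n k f x = Abs_fam (\<lambda>js. if js \<in> index_tuples n k then D_iter js f x else 0)"

lemma coord_tuple_derivs:
  "coord (tuple_derivs n k f x) js = (if js \<in> index_tuples n k then D_iter js f x else 0)"
proof -
  have "finite {js. (if js \<in> index_tuples n k then D_iter js f x else 0) \<noteq> 0}"
    by (rule finite_subset[OF _ finite_index_tuples[of n k]]) auto
  then show ?thesis by (simp add: tuple_derivs_def Abs_fam_inverse)
qed

lemma norm_tuple_derivs: "(norm (tuple_derivs n k f x))\<^sup>2 = (\<Sum>js\<in>index_tuples n k. (cmod (D_iter js f x))\<^sup>2)"
  by (subst norm_fam_superset[OF finite_index_tuples[of n k]]) (auto simp: coord_tuple_derivs)

lemma index_tuples_Suc: "index_tuples n (Suc k) = (\<lambda>(j, js). j # js) ` ({1..n} \<times> index_tuples n k)"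
  unfolding index_tuples_def by (auto simp: length_Suc_conv image_iff)

lemma coord_cdiff: "coord (cdiff j u x) js = cdiff j (\<lambda>y. coord (u y) js) x"
  by (simp add: cdiff_def scaleR_fam.rep_eq minus_fam.rep_eq)

text \<open>
  Taking one more gradient of the family of derivatives of order \<open>k\<close> gives that of order \<open>k + 1\<close>, with the right norm;
  this is what makes the induction on \<open>k\<close> possible.
\<close>

lemma gradient_tuple_derivs:
  "l2norm {1..n} (\<lambda>j. cdiff j (tuple_derivs n k f)) x = norm (tuple_derivs n (Suc k) f x)"
proof -
  have "coord (cdiff j (tuple_derivs n k f) x) js = (if js \<in> index_tuples n k then D_iter (j # js) f x else 0)" for j js
    unfolding coord_cdiff by (simp add: coord_tuple_derivs D_iter_def D_eq_cdiff cdiff_def)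
  then have 1: "(norm (cdiff j (tuple_derivs n k f) x))\<^sup>2 = (\<Sum>js\<in>index_tuples n k. (cmod (D_iter (j # js) f x))\<^sup>2)" for j
    by (subst norm_fam_superset[OF finite_index_tuples[of n k]]) auto
  have "(\<Sum>j\<in>{1..n}. (norm (cdiff j (tuple_derivs n k f) x))\<^sup>2) =
      (\<Sum>(j, js)\<in>{1..n} \<times> index_tuples n k. (cmod (D_iter (j # js) f x))\<^sup>2)"
    unfolding 1 by (rule sum.cartesian_product)
  also have "\<dots> = (\<Sum>js\<in>index_tuples n (Suc k). (cmod (D_iter js f x))\<^sup>2)"
    unfolding index_tuples_Suc by (subst sum.reindex) (auto simp: inj_on_def case_prod_beta)
  finally show ?thesis by (simp add: L2_set_def norm_tuple_derivs[symmetric])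
qed

lemma walsh_coeff_cdiff:
  assumes j: "j \<in> {1..n}" and A: "A \<subseteq> {1..n}"
  shows "walsh_coeff n (cdiff j f) A = (if j \<in> A then walsh_coeff n f A else 0)"
proof -
  have fin: "finite A" using A finite_subset by blast
  have "avg n (\<lambda>x. rwalsh A x *\<^sub>R f (flip j x)) = avg n (\<lambda>x. rwalsh A (flip j x) *\<^sub>R f x)"
    using avg_flip[OF j, of "\<lambda>x. rwalsh A (flip j x) *\<^sub>R f x"] by simp
  also have "\<dots> = (if j \<in> A then - walsh_coeff n f A else walsh_coeff n f A)"
    using avg_scaleR[of n "-1" "\<lambda>x. rwalsh A x *\<^sub>R f x"] by (simp add: rwalsh_flip[OF fin] walsh_coeff_def)
  finally have e: "avg n (\<lambda>x. rwalsh A x *\<^sub>R f (flip j x)) = (if j \<in> A then - walsh_coeff n f A else walsh_coeff n f A)" .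
  have "walsh_coeff n (cdiff j f) A = avg n (\<lambda>x. (1/2) *\<^sub>R (rwalsh A x *\<^sub>R f x - rwalsh A x *\<^sub>R f (flip j x)))"
    by (simp add: walsh_coeff_def cdiff_def scaleR_diff_right mult.commute)
  also have "\<dots> = (1/2) *\<^sub>R (walsh_coeff n f A - (if j \<in> A then - walsh_coeff n f A else walsh_coeff n f A))"
    unfolding avg_scaleR avg_diff e walsh_coeff_def ..
  finally show ?thesis by (simp add: scaleR_2[symmetric])
qed

lemma cdiff_num_power:
  assumes j: "j \<in> {1..n}"
  shows "cdiff j (num_power n a f) x = num_power n a (cdiff j f) x"
proof -
  have "num_power n a f = (\<lambda>x. \<Sum>A\<in>Pow {1..n}. (real (card A) powr a) *\<^sub>R (rwalsh A x *\<^sub>R walsh_coeff n f A))"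
    by (simp add: num_power_def fun_eq_iff)
  then have "cdiff j (num_power n a f) x = (\<Sum>A\<in>Pow {1..n}. (real (card A) powr a) *\<^sub>R cdiff j (\<lambda>x. rwalsh A x *\<^sub>R walsh_coeff n f A) x)"
    by (simp only: cdiff_sum cdiff_scaleR)
  also have "\<dots> = num_power n a (cdiff j f) x"
    unfolding num_power_def
    by (intro sum.cong refl) (auto simp: walsh_coeff_cdiff[OF j] cdiff_rwalsh finite_subset[of _ "{1..n}"])
  finally show ?thesis .
qed

lemma D_iter_num_power: "set js \<subseteq> {1..n} \<Longrightarrow> D_iter js (num_power n a f) = num_power n a (D_iter js f)"
proof (induction js)
  case Nil
  then show ?case by (simp add: D_iter_def)
next
  case (Cons j js)
  then have "D_iter (j # js) (num_power n a f) = cdiff j (num_power n a (D_iter js f))"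
    by (simp add: D_iter_def D_eq_cdiff)
  also have "\<dots> = num_power n a (cdiff j (D_iter js f))"
    using Cons.prems by (intro ext cdiff_num_power) auto
  finally show ?case by (simp add: D_iter_def D_eq_cdiff)
qed

lemma coord_num_power: "coord (num_power n a u x) js = num_power n a (\<lambda>y. coord (u y) js) x"
  by (simp add: num_power_def walsh_coeff_def avg_def coord_sum scaleR_fam.rep_eq)

lemma num_power_tuple_derivs: "num_power n a (tuple_derivs n k f) x = tuple_derivs n k (num_power n a f) x"
proof (rule fam_eqI)
  fix js
  show "coord (num_power n a (tuple_derivs n k f) x) js = coord (tuple_derivs n k (num_power n a f) x) js"
  proof (cases "js \<in> index_tuples n k")
    case True
    then have "set js \<subseteq> {1..n}" by (simp add: index_tuples_def)
    then show ?thesis using True by (simp add: coord_num_power coord_tuple_derivs D_iter_num_power)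
  next
    case False
    then show ?thesis by (simp add: coord_num_power coord_tuple_derivs) (simp add: num_power_def walsh_coeff_def)
  qed
qed

lemma norm_tuple_derivs_0: "norm (tuple_derivs n 0 f x) = cmod (f x)"
proof -
  have "(norm (tuple_derivs n 0 f x))\<^sup>2 = (cmod (f x))\<^sup>2"
  proof -
    have "index_tuples n 0 = {[]}" by (auto simp: index_tuples_def)
    then show ?thesis unfolding norm_tuple_derivs by (simp add: D_iter_def)
  qed
  then show ?thesis by simp
qed

text \<open>
  One order of differentiation is traded for one factor \<open>\<Delta>\<^bsup>1/p\<^esup>\<close>, which moves inside the remaining derivatives.
\<close>

lemma tuple_derivs_bound:
  assumes p: "1 < p" "p < 2"
  shows "moment n p (tuple_derivs n (Suc k) f)
    \<le> ((12384 / (p - 1)\<^sup>2) ^ Suc k) powr p * moment n p (num_power n (real (Suc k) / p) f)"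
proof (induction k arbitrary: f)
  have step: "moment n p (tuple_derivs n (Suc k) f)
    \<le> (12384 / (p - 1)\<^sup>2) powr p * moment n p (tuple_derivs n k (num_power n (1/p) f))" for k f
    using gradient_bound[OF p, of n "tuple_derivs n k f"] by (simp only: gradient_tuple_derivs num_power_tuple_derivs)
  {
    case 0
    show ?case using step[of 0 f] by (simp add: norm_tuple_derivs_0)
  next
    case (Suc k)
    have e: "1 / p + real (Suc k) / p = real (Suc (Suc k)) / p" "real (Suc k) / p + 1 / p = real (Suc (Suc k)) / p"
      using p by (auto simp: field_simps)
    have "moment n p (tuple_derivs n (Suc (Suc k)) f)
      \<le> (12384 / (p - 1)\<^sup>2) powr p * moment n p (tuple_derivs n (Suc k) (num_power n (1/p) f))"
      by (rule step)
    also have "\<dots> \<le> (12384 / (p - 1)\<^sup>2) powr p * (((12384 / (p - 1)\<^sup>2) ^ Suc k) powr p *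
        moment n p (num_power n (real (Suc k) / p) (num_power n (1/p) f)))"
      by (intro mult_left_mono Suc) auto
    also have "\<dots> = ((12384 / (p - 1)\<^sup>2) * (12384 / (p - 1)\<^sup>2) ^ Suc k) powr p *
        avg n (\<lambda>x. cmod (num_power n (real (Suc (Suc k)) / p) f x) powr p)"
      by (simp only: num_power_num_power e powr_mult mult.assoc)
    finally show ?case by simp
  }
qed

section \<open>Translation to the normed spaces of the statement\<close>

lemma Lp_norm_avg: "Lp_norm n p f = (moment n p f) powr (1 / p)"
  by (simp add: Lp_norm_def cube_measure_def integral_uniform_count_measure card_cube avg_def divide_inverse mult.commute)

lemma fourier_coeff_walsh_coeff: "fourier_coeff n f A = walsh_coeff n f A"
  by (simp add: fourier_coeff_def cube_measure_def walsh_coeff_def avg_def rwalsh_def walsh_def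
      lebesgue_integral_point_measure_finite uniform_count_measure_def card_cube scaleR_sum_right
      scaleR_conv_of_real sum_distrib_left mult_ac divide_inverse)

lemma Delta_power_num_power: "Delta_power n (complex_of_real a) f = num_power n a f"
proof
  fix x
  have "num_power n a f x = (\<Sum>A\<in>Pow {1..n} - {{}}. (real (card A) powr a * rwalsh A x) *\<^sub>R walsh_coeff n f A)"
    unfolding num_power_def by (rule sum.mono_neutral_right) auto
  also have "Pow {1..n} - {{}} = {A. A \<noteq> {} \<and> A \<subseteq> {1..n}}" by auto
  finally show "Delta_power n (complex_of_real a) f x = num_power n a f x"
    unfolding Delta_power_def fourier_coeff_walsh_coeff
    by (auto intro!: sum.cong simp: walsh_def rwalsh_def scaleR_conv_of_real powr_of_real[symmetric] mult_ac)
qed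

lemma tuple_derivs_Lp_bound:
  assumes p: "1 < p" "p < 2" and k: "1 \<le> k"
  shows "Lp_norm n p (\<lambda>x. sqrt (\<Sum>js\<in>index_tuples n k. (cmod (D_iter js f x))\<^sup>2))
    \<le> 12384 ^ k * (p - 1) powr (- 2 * real k) * Lp_norm n p (Delta_power n (complex_of_real (real k / p)) f)"
proof -
  define B where "B = 12384 / (p - 1)\<^sup>2"
  obtain k' where k': "k = Suc k'" using k by (cases k) auto
  have "norm (sqrt (\<Sum>js\<in>index_tuples n k. (cmod (D_iter js f x))\<^sup>2)) = norm (tuple_derivs n k f x)" for x
    by (simp add: norm_tuple_derivs[symmetric])
  then have "Lp_norm n p (\<lambda>x. sqrt (\<Sum>js\<in>index_tuples n k. (cmod (D_iter js f x))\<^sup>2)) =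
      (moment n p (tuple_derivs n k f)) powr (1/p)"
    by (simp only: Lp_norm_avg)
  also have "\<dots> \<le> ((B ^ k) powr p * moment n p (num_power n (real k / p) f)) powr (1/p)"
    using p tuple_derivs_bound[OF p, of n k' f]
    by (intro powr_mono2 avg_nonneg) (auto simp: B_def k')
  also have "\<dots> = B ^ k * Lp_norm n p (Delta_power n (complex_of_real (real k / p)) f)"
  proof -
    have "0 \<le> B ^ k" by (simp add: B_def)
    then show ?thesis using p unfolding Lp_norm_avg Delta_power_num_power by (simp add: powr_mult powr_powr)
  qed
  also have "B ^ k = 12384 ^ k * (p - 1) powr (- 2 * real k)"
  proof -
    have "(p - 1) powr (- 2 * real k) = 1 / (p - 1) ^ (2 * k)"
      using powr_minus_divide[of "p - 1" "2 * real k"] powr_realpow[of "p - 1" "2 * k"] p by simp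
    then show ?thesis by (simp add: B_def power_divide power_mult)
  qed
  finally show ?thesis .
qed

section \<open>Optimality of the exponent\<close>

text \<open>
  From some index on, \<open>a |b\<^sub>k|\<close> equals \<open>k |b\<^sub>k| - (k+1) |b\<^sub>k\<^sub>+\<^sub>1|\<close> for the binomial coefficients \<open>b\<^sub>k\<close>, so the series
  telescopes.
\<close>

lemma summable_abs_gbinomial:
  fixes a :: real
  assumes a: "0 < a"
  shows "summable (\<lambda>k. \<bar>a gchoose k\<bar>)"
proof -
  define b where "b k = \<bar>a gchoose k\<bar>" for k
  define N where "N = nat \<lceil>a\<rceil>"
  have rec: "a * b k = real k * b k - real (Suc k) * b (Suc k)" if "N \<le> k" for k
  proof -
    have "a \<le> real k" using that by (simp add: N_def)
    have "real (Suc k) * (a gchoose Suc k) = (a - real k) * (a gchoose k)"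
      using gbinomial_absorb_comp[of a k] gbinomial_absorption[of k a] by simp
    then have "\<bar>real (Suc k) * (a gchoose Suc k)\<bar> = \<bar>(a - real k) * (a gchoose k)\<bar>" by simp
    then have "real (Suc k) * b (Suc k) = (real k - a) * b k"
      using \<open>a \<le> real k\<close> by (simp add: b_def abs_mult)
    then show ?thesis by (simp add: algebra_simps)
  qed
  have "summable (\<lambda>k. b (k + N))"
  proof (rule summableI_nonneg_bounded)
    show "0 \<le> b (k + N)" for k by (simp add: b_def)
    fix m
    have "a * (\<Sum>k<m. b (k + N)) = (\<Sum>k<m. real (k + N) * b (k + N) - real (Suc k + N) * b (Suc k + N))"
      by (simp add: sum_distrib_left rec)
    also have "\<dots> = real N * b N - real (m + N) * b (m + N)"
      using sum_lessThan_telescope'[of "\<lambda>k. real (k + N) * b (k + N)" m] by simp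
    also have "\<dots> \<le> real N * b N" by (simp add: b_def)
    finally show "(\<Sum>k<m. b (k + N)) \<le> real N * b N / a"
      using a by (simp add: field_simps)
  qed
  then have "summable b" by (simp add: summable_iff_shift)
  then show ?thesis by (simp add: b_def[abs_def])
qed

text \<open>
  Jensen's inequality with the weights normalised to total mass \<open>1\<close>.
\<close>

lemma moment_weighted_sum_le:
  fixes f :: "'i \<Rightarrow> (nat \<Rightarrow> real) \<Rightarrow> 'a::real_normed_vector"
  assumes p: "1 \<le> p" and f: "\<And>i. i \<in> I \<Longrightarrow> moment n p (f i) \<le> M" and M: "0 \<le> M" and S: "(\<Sum>i\<in>I. \<bar>w i\<bar>) \<le> S"
  shows "moment n p (\<lambda>x. \<Sum>i\<in>I. w i *\<^sub>R f i x) \<le> S powr p * M"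
proof -
  define W where "W = (\<Sum>i\<in>I. \<bar>w i\<bar>)"
  have W0: "0 \<le> W" by (simp add: W_def sum_nonneg)
  have le: "norm (\<Sum>i\<in>I. w i *\<^sub>R f i x) \<le> (\<Sum>i\<in>I. \<bar>w i\<bar> * norm (f i x))" for x
    by (rule order_trans[OF norm_sum]) simp
  have "moment n p (\<lambda>x. \<Sum>i\<in>I. w i *\<^sub>R f i x) \<le> W powr p * M"
  proof (cases "W = 0")
    case True
    then have "w i = 0" if "i \<in> I" "finite I" for i using that by (simp add: W_def sum_nonneg_eq_0_iff)
    then have "(\<Sum>i\<in>I. w i *\<^sub>R f i x) = 0" for x by (cases "finite I") auto
    then show ?thesis using p True by simp
  next
    case False
    then have W: "0 < W" using W0 by simp
    have "moment n p (\<lambda>x. \<Sum>i\<in>I. w i *\<^sub>R f i x) \<le> avg n (\<lambda>x. W powr p * (\<Sum>i\<in>I. \<bar>w i\<bar> / W * norm (f i x) powr p))"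
    proof (rule avg_mono)
      fix x
      have "norm (\<Sum>i\<in>I. w i *\<^sub>R f i x) \<le> W * (\<Sum>i\<in>I. \<bar>w i\<bar> / W * norm (f i x))"
        using le[of x] W by (simp add: sum_distrib_left)
      then have "norm (\<Sum>i\<in>I. w i *\<^sub>R f i x) powr p \<le> (W * (\<Sum>i\<in>I. \<bar>w i\<bar> / W * norm (f i x))) powr p"
        using p by (intro powr_mono2) auto
      also have "\<dots> = W powr p * (\<Sum>i\<in>I. \<bar>w i\<bar> / W * norm (f i x)) powr p"
        by (rule powr_mult)
      also have "\<dots> \<le> W powr p * (\<Sum>i\<in>I. \<bar>w i\<bar> / W * norm (f i x) powr p)"
        using W p by (intro mult_left_mono Jensen_powr) (auto simp: W_def simp flip: sum_divide_distrib)
      finally show "norm (\<Sum>i\<in>I. w i *\<^sub>R f i x) powr p \<le> W powr p * (\<Sum>i\<in>I. \<bar>w i\<bar> / W * norm (f i x) powr p)" .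
    qed
    also have "\<dots> = W powr p * (\<Sum>i\<in>I. \<bar>w i\<bar> / W * moment n p (f i))"
      by (simp only: avg_cmult avg_sum)
    also have "\<dots> \<le> W powr p * (\<Sum>i\<in>I. \<bar>w i\<bar> / W * M)"
      using W f by (intro mult_left_mono sum_mono) auto
    also have "(\<Sum>i\<in>I. \<bar>w i\<bar> / W * M) = M"
      using W by (simp add: W_def flip: sum_distrib_right sum_divide_distrib)
    finally show ?thesis .
  qed
  also have "\<dots> \<le> S powr p * M"
    using p W0 S M unfolding W_def by (intro mult_right_mono powr_mono2) auto
  finally show ?thesis .
qed

text \<open>
  This is \<open>Q = 1 - \<Delta>/n\<close>, written as a mean of the conditional expectations that forget one coordinate, so that it
  is visibly a contraction.
\<close>

definition flip_mean :: "nat \<Rightarrow> ((nat \<Rightarrow> real) \<Rightarrow> 'a::real_vector) \<Rightarrow> (nat \<Rightarrow> real) \<Rightarrow> 'a" where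
  "flip_mean n f x = (1 / real n) *\<^sub>R (\<Sum>j\<in>{1..n}. (1/2) *\<^sub>R (f x + f (flip j x)))"

lemma moment_flip_mean_le:
  fixes f :: "(nat \<Rightarrow> real) \<Rightarrow> 'a::real_normed_vector"
  assumes p: "1 \<le> p" and n: "1 \<le> n"
  shows "moment n p (flip_mean n f) \<le> moment n p f"
proof -
  define g where "g = (\<lambda>(j, b) x. if b then f x else f (flip j x))"
  have "flip_mean n f x = (\<Sum>i\<in>{1..n} \<times> {True, False}. (1 / (2 * real n)) *\<^sub>R g i x)" for x
  proof -
    have "(\<Sum>i\<in>{1..n} \<times> {True, False}. (1 / (2 * real n)) *\<^sub>R g i x) =
        (\<Sum>j\<in>{1..n}. \<Sum>b\<in>{True, False}. (1 / (2 * real n)) *\<^sub>R g (j, b) x)"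
      by (subst sum.cartesian_product) (simp add: split_beta)
    then show ?thesis by (simp add: flip_mean_def g_def scaleR_sum_right scaleR_add_right mult.commute)
  qed
  moreover have "moment n p (g i) \<le> moment n p f" if "i \<in> {1..n} \<times> {True, False}" for i
    using that avg_flip[of _ n "\<lambda>x. norm (f x) powr p"] by (auto simp: g_def split: prod.splits)
  ultimately show ?thesis
    using moment_weighted_sum_le[OF p, of "{1..n} \<times> {True, False}" n g "moment n p f" "\<lambda>_. 1 / (2 * real n)" 1] n
    by (simp add: avg_nonneg)
qed

lemma flip_mean_expand:
  assumes n: "1 \<le> n" and x: "x \<in> cube n"
    and u: "\<And>y. y \<in> cube n \<Longrightarrow> u y = (\<Sum>A\<in>Pow {1..n}. (c A * rwalsh A y) *\<^sub>R v A)"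
  shows "flip_mean n u x = (\<Sum>A\<in>Pow {1..n}. (((1 - real (card A) / real n) * c A) * rwalsh A x) *\<^sub>R v A)"
proof -
  have "(1/2) *\<^sub>R (u x + u (flip j x)) = u x - cdiff j u x" for j
    by (simp add: cdiff_def algebra_simps) (metis scaleR_half_double scaleR_add_right)
  then have "flip_mean n u x = (1 / real n) *\<^sub>R (real n *\<^sub>R u x - (\<Sum>j\<in>{1..n}. cdiff j u x))"
    by (simp add: flip_mean_def sum_subtractf sum_constant_scaleR)
  also have "\<dots> = u x - (1 / real n) *\<^sub>R (\<Sum>j\<in>{1..n}. cdiff j u x)"
    using n by (simp add: scaleR_diff_right)
  also have "\<dots> = (\<Sum>A\<in>Pow {1..n}. (((1 - real (card A) / real n) * c A) * rwalsh A x) *\<^sub>R v A)"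
  proof -
    have e: "(\<Sum>j\<in>{1..n}. cdiff j u x) = (\<Sum>A\<in>Pow {1..n}. (real (card A) * c A * rwalsh A x) *\<^sub>R v A)"
      using x u by (rule sum_cdiff_expand)
    show ?thesis
      unfolding e unfolding u[OF x] scaleR_sum_right sum_subtractf[symmetric]
    proof (intro sum.cong refl)
      fix A
      have s: "(1 - real (card A) / real n) * c A * rwalsh A x = c A * rwalsh A x - (1 / real n) * (real (card A) * c A * rwalsh A x)"
        by (simp add: left_diff_distrib)
      show "(c A * rwalsh A x) *\<^sub>R v A - (1 / real n) *\<^sub>R (real (card A) * c A * rwalsh A x) *\<^sub>R v A =
          ((1 - real (card A) / real n) * c A * rwalsh A x) *\<^sub>R v A"
        unfolding s scaleR_diff_left scaleR_scaleR ..
    qed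
  qed
  finally show ?thesis .
qed

text \<open>
  Binomial expansion of \<open>n\<^bsup>-a\<^esup> \<Delta>\<^sup>a = (1 - Q)\<^sup>a\<close>. Subtracting the mean first removes the eigenvalue \<open>1\<close> of \<open>Q\<close>, which lies on the
  boundary of the disc of convergence; all other eigenvalues lie in \<open>[0, 1)\<close>. The constant is uniform in \<open>n\<close> because the binomial
  coefficients are absolutely summable.
\<close>

lemma moment_num_power_le:
  fixes f :: "(nat \<Rightarrow> real) \<Rightarrow> 'a::real_normed_vector"
  assumes p: "1 \<le> p" and a: "0 < a" and n: "1 \<le> n"
  shows "moment n p (num_power n a f) \<le> (2 * (\<Sum>k. \<bar>a gchoose k\<bar>) * real n powr a) powr p * moment n p f"
proof -
  let ?q = "\<lambda>A::nat set. 1 - real (card A) / real n"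
  let ?i = "\<lambda>A::nat set. if A = {} then 0 else 1 :: real"
  define S where "S = (\<Sum>k. \<bar>a gchoose k\<bar>)"
  define f0 where "f0 x = f x - avg n f" for x
  define P where "P k = (flip_mean n ^^ k) f0" for k
  have q: "\<bar>1 - real (card A) / real n\<bar> < 1" if "A \<in> Pow {1..n} - {{}}" for A
  proof -
    have "card A \<le> n" using that card_mono[of "{1..n}" A] by simp
    moreover have "0 < card A" using that finite_subset[of A "{1..n}"] by (auto simp: card_gt_0_iff)
    ultimately show ?thesis using n by (simp add: field_simps)
  qed
  have f0: "f0 x = (\<Sum>A\<in>Pow {1..n}. (?i A * rwalsh A x) *\<^sub>R walsh_coeff n f A)" if x: "x \<in> cube n" for x
  proof -
    have "(\<Sum>A\<in>Pow {1..n}. (?i A * rwalsh A x) *\<^sub>R walsh_coeff n f A) =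
      (\<Sum>A\<in>Pow {1..n} - {{}}. rwalsh A x *\<^sub>R walsh_coeff n f A)"
      by (rule sum.mono_neutral_cong_right) auto
    also have "\<dots> = (\<Sum>A\<in>Pow {1..n}. rwalsh A x *\<^sub>R walsh_coeff n f A) - rwalsh {} x *\<^sub>R walsh_coeff n f {}"
      by (subst sum_diff1) auto
    also have "\<dots> = f0 x"
      unfolding walsh_inversion[OF x, of f, symmetric] by (simp add: f0_def walsh_coeff_def rwalsh_def)
    finally show ?thesis ..
  qed
  have P: "P k x = (\<Sum>A\<in>Pow {1..n}. ((?q A ^ k * ?i A) * rwalsh A x) *\<^sub>R walsh_coeff n f A)"
    if "x \<in> cube n" for k x
    using that
  proof (induction k arbitrary: x)
    case 0
    then show ?case by (simp add: P_def f0)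
  next
    case (Suc k)
    have "P (Suc k) x = flip_mean n (P k) x" by (simp add: P_def)
    also have "\<dots> = (\<Sum>A\<in>Pow {1..n}. ((?q A * (?q A ^ k * ?i A)) * rwalsh A x) *\<^sub>R walsh_coeff n f A)"
      by (rule flip_mean_expand[OF n Suc.prems Suc.IH])
    finally show ?case by (simp add: mult.assoc)
  qed
  have "moment n p f0 \<le> 2 powr p * moment n p f"
  proof -
    have "kern n (\<lambda>_. 0) x y = 1 / 2 ^ n" for x y by (simp add: kern_def power_divide)
    then have "noise n (\<lambda>_. 0) f = (\<lambda>x. avg n f)"
      by (simp add: noise_def avg_def scaleR_sum_right divide_inverse fun_eq_iff)
    then have "moment n p (\<lambda>x. avg n f) \<le> moment n p f"
      using moment_noise_le[of "\<lambda>_. 0" p n f] p by simp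
    then have "moment n p (if b then f else (\<lambda>x. avg n f)) \<le> moment n p f" for b by simp
    then show ?thesis
      using moment_weighted_sum_le[OF p, of "{True, False}" n "\<lambda>b. if b then f else (\<lambda>x. avg n f)"
        "moment n p f" "\<lambda>b. if b then 1 else -1" 2]
      by (simp add: f0_def[abs_def] avg_nonneg)
  qed
  moreover have "moment n p (P k) \<le> moment n p f0" for k
  proof (induction k)
    case (Suc k)
    then show ?case using order_trans[OF moment_flip_mean_le[OF p n, of "P k"]] by (simp add: P_def)
  qed (simp add: P_def)
  ultimately have mP: "moment n p (P k) \<le> 2 powr p * moment n p f" for k
    using order_trans by blast
  define T where "T K x = (\<Sum>k<K. ((a gchoose k) * (-1) ^ k) *\<^sub>R P k x)" for K x
  have T_le: "moment n p (T K) \<le> S powr p * (2 powr p * moment n p f)" for K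
    unfolding T_def[abs_def]
  proof (rule moment_weighted_sum_le[OF p mP])
    have "(\<Sum>k<K. \<bar>(a gchoose k) * (-1) ^ k\<bar>) = (\<Sum>k<K. \<bar>a gchoose k\<bar>)" by (simp add: abs_mult)
    also have "\<dots> \<le> S" unfolding S_def using summable_abs_gbinomial[OF a] by (intro sum_le_suminf) auto
    finally show "(\<Sum>k<K. \<bar>(a gchoose k) * (-1) ^ k\<bar>) \<le> S" .
  qed (simp add: avg_nonneg)
  have lim: "(\<lambda>K. T K x) \<longlonglongrightarrow> real n powr (- a) *\<^sub>R num_power n a f x" if x: "x \<in> cube n" for x
  proof -
    have "T K x = (\<Sum>A\<in>Pow {1..n}. ((\<Sum>k<K. (a gchoose k) * (- ?q A) ^ k) * ?i A * rwalsh A x) *\<^sub>R walsh_coeff n f A)" for K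
    proof -
      have "T K x = (\<Sum>k<K. \<Sum>A\<in>Pow {1..n}. ((a gchoose k) * (- ?q A) ^ k * ?i A * rwalsh A x) *\<^sub>R walsh_coeff n f A)"
      proof -
        have e: "((a gchoose k) * (-1) ^ k) *\<^sub>R ((?q A ^ k * ?i A * rwalsh A x) *\<^sub>R walsh_coeff n f A)
          = ((a gchoose k) * (- ?q A) ^ k * ?i A * rwalsh A x) *\<^sub>R walsh_coeff n f A" for k A
          unfolding power_minus[of "1 - real (card A) / real n" k] by (simp add: mult_ac)
        show ?thesis unfolding T_def P[OF x] scaleR_sum_right e ..
      qed
      also have "\<dots> = (\<Sum>A\<in>Pow {1..n}. \<Sum>k<K. ((a gchoose k) * (- ?q A) ^ k * ?i A * rwalsh A x) *\<^sub>R walsh_coeff n f A)"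
        by (rule sum.swap)
      finally show ?thesis by (simp add: scaleR_sum_left sum_distrib_right)
    qed
    moreover have "(\<lambda>K. \<Sum>A\<in>Pow {1..n}. ((\<Sum>k<K. (a gchoose k) * (- ?q A) ^ k) * ?i A * rwalsh A x) *\<^sub>R walsh_coeff n f A)
      \<longlonglongrightarrow> (\<Sum>A\<in>Pow {1..n}. ((real n powr (- a) * real (card A) powr a) * rwalsh A x) *\<^sub>R walsh_coeff n f A)"
    proof (rule tendsto_sum, rule tendsto_scaleR[OF _ tendsto_const], rule tendsto_mult[OF _ tendsto_const])
      fix A assume A: "A \<in> Pow {1..n}"
      show "(\<lambda>K. (\<Sum>k<K. (a gchoose k) * (- ?q A) ^ k) * ?i A) \<longlonglongrightarrow> real n powr (- a) * real (card A) powr a"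
      proof (cases "A = {}")
        case False
        then have "\<bar>1 - real (card A) / real n\<bar> < 1" using q A by simp
        then have "(\<lambda>k. (a gchoose k) * (- ?q A) ^ k) sums (1 + - ?q A) powr a"
          by (intro gen_binomial_real) simp
        moreover have "(1 + - ?q A) powr a = real n powr (- a) * real (card A) powr a"
          using n by (simp add: powr_divide powr_minus_divide)
        ultimately show ?thesis using False by (simp add: sums_def)
      qed simp
    qed
    ultimately show ?thesis by (simp add: num_power_def scaleR_sum_right mult_ac)
  qed
  have "(\<lambda>K. moment n p (T K)) \<longlonglongrightarrow> moment n p (\<lambda>x. real n powr (- a) *\<^sub>R num_power n a f x)"
    unfolding avg_def using p
    by (intro tendsto_powr' tendsto_scaleR tendsto_sum tendsto_const tendsto_norm lim) auto
  then have "moment n p (\<lambda>x. real n powr (- a) *\<^sub>R num_power n a f x) \<le> S powr p * (2 powr p * moment n p f)"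
    by (rule LIMSEQ_le_const2) (use T_le in auto)
  then have "(real n powr a) powr p * ((real n powr (- a)) powr p * moment n p (num_power n a f))
      \<le> (real n powr a) powr p * (S powr p * (2 powr p * moment n p f))"
    by (intro mult_left_mono) (simp_all add: powr_mult avg_cmult)
  moreover have "(real n powr a) powr p * (real n powr (- a)) powr p = 1"
    using n by (simp add: powr_powr flip: powr_add)
  ultimately show ?thesis
    by (simp add: S_def powr_mult mult.assoc[symmetric]) (simp add: mult_ac)
qed

abbreviation (input) derivs_norm :: "nat list set \<Rightarrow> ((nat \<Rightarrow> real) \<Rightarrow> complex) \<Rightarrow> (nat \<Rightarrow> real) \<Rightarrow> real" where
  "derivs_norm T f \<equiv> \<lambda>x. sqrt (\<Sum>js\<in>T. (cmod (D_iter js f x))\<^sup>2)"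

definition signs :: "nat \<Rightarrow> nat set \<Rightarrow> nat \<Rightarrow> real" where
  "signs n S = (\<lambda>j\<in>{1..n}. if j \<in> S then -1 else 1)"

definition peak :: "nat \<Rightarrow> (nat \<Rightarrow> real) \<Rightarrow> complex" where
  "peak n x = (if x = signs n {} then 1 else 0)"

lemma signs_cube: "signs n S \<in> cube n"
  by (auto simp: signs_def cube_def)

lemma flip_signs: "j \<in> {1..n} \<Longrightarrow> flip j (signs n S) = signs n (if j \<in> S then S - {j} else insert j S)"
  by (auto simp: signs_def flip_def fun_eq_iff)

lemma inj_signs: "inj_on (signs n) (Pow {1..n})"
proof (rule inj_onI)
  fix S T assume ST: "S \<in> Pow {1..n}" "T \<in> Pow {1..n}" and e: "signs n S = signs n T"
  have "j \<in> S \<longleftrightarrow> j \<in> T" if "j \<in> {1..n}" for j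
    using fun_cong[OF e, of j] that by (simp add: signs_def split: if_splits)
  then show "S = T" using ST by blast
qed

text \<open>
  The derivative of the indicator of a vertex in the directions \<open>js\<close> is supported on the points that differ from the vertex
  only in these directions.
\<close>

lemma D_iter_peak_0:
  assumes "set js \<subseteq> {1..n}" "S \<subseteq> {1..n}" "\<not> S \<subseteq> set js"
  shows "D_iter js (peak n) (signs n S) = 0"
  using assms
proof (induction js arbitrary: S)
  case Nil
  then have "S \<noteq> {}" by auto
  then have "signs n S \<noteq> signs n {}" using inj_onD[OF inj_signs, of n S "{}"] Nil by blast
  then show ?case by (simp add: D_iter_def peak_def)
next
  case (Cons j js)
  let ?S' = "if j \<in> S then S - {j} else insert j S"
  have j: "j \<in> {1..n}" "set js \<subseteq> {1..n}" using Cons.prems by auto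
  have "?S' \<subseteq> {1..n}" "\<not> ?S' \<subseteq> set js" "\<not> S \<subseteq> set js" using Cons.prems j by auto
  then have "D_iter js (peak n) (signs n S) = 0" "D_iter js (peak n) (signs n ?S') = 0"
    using Cons.IH[OF j(2)] Cons.prems(2) by blast+
  then show ?case using flip_signs[OF j(1), of S] by (simp add: D_iter_def D_def)
qed

lemma D_iter_peak:
  assumes "set js \<subseteq> {1..n}" "distinct js"
  shows "cmod (D_iter js (peak n) (signs n (set js))) = 1 / 2 ^ length js"
  using assms
proof (induction js)
  case Nil
  then show ?case by (simp add: D_iter_def peak_def)
next
  case (Cons j js)
  have j: "j \<in> {1..n}" "set js \<subseteq> {1..n}" "j \<notin> set js" "distinct js" using Cons.prems by auto
  have "D_iter js (peak n) (signs n (set (j # js))) = 0"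
    by (rule D_iter_peak_0[OF j(2)]) (use j in auto)
  moreover have "flip j (signs n (set (j # js))) = signs n (set js)"
    using j by (simp add: flip_signs)
  ultimately have "D_iter (j # js) (peak n) (signs n (set (j # js))) = - D_iter js (peak n) (signs n (set js)) / 2"
    by (simp add: D_iter_def D_def)
  then show ?case using Cons.IH[OF j(2,4)] by (simp add: norm_divide)
qed

lemma Lp_norm_peak:
  assumes p: "0 < p" shows "Lp_norm n p (peak n) = (1 / 2 ^ n) powr (1 / p)"
proof -
  have "(\<Sum>x\<in>cube n. cmod (peak n x) powr p) = (\<Sum>x\<in>cube n. if x = signs n {} then 1 else 0)"
    by (intro sum.cong) (auto simp: peak_def)
  also have "\<dots> = 1" using signs_cube[of n "{}"] by simp
  finally show ?thesis by (simp add: Lp_norm_avg avg_def divide_inverse)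
qed

text \<open>
  There are \<open>n choose k\<close> vertices at Hamming distance \<open>k\<close> from the peak, and at each of them one
  derivative of order \<open>k\<close> is of modulus \<open>2\<^sup>-\<^sup>k\<close>.
\<close>

lemma Lp_norm_derivs_peak_ge:
  assumes p: "0 < p"
  shows "(1 / 2 ^ n * real (n choose k)) powr (1 / p) * (1 / 2 ^ k)
    \<le> Lp_norm n p (derivs_norm (distinct_index_tuples n k) (peak n))"
proof -
  define g where "g x = sqrt (\<Sum>js\<in>distinct_index_tuples n k. (cmod (D_iter js (peak n) x))\<^sup>2)" for x
  define J where "J = {S. S \<subseteq> {1..n} \<and> card S = k}"
  have fin: "finite (distinct_index_tuples n k)"
    by (rule finite_subset[OF _ finite_index_tuples[of n k]]) (auto simp: distinct_index_tuples_def)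
  have g: "1 / 2 ^ k \<le> g (signs n S)" if S: "S \<in> J" for S
  proof -
    have "finite S" using S finite_subset[of S "{1..n}"] by (auto simp: J_def)
    define js where "js = sorted_list_of_set S"
    have js: "set js = S" "distinct js" "length js = k"
      using S \<open>finite S\<close> by (auto simp: js_def J_def)
    then have mem: "js \<in> distinct_index_tuples n k"
      using S by (auto simp: distinct_index_tuples_def index_tuples_def J_def)
    have "(1 / 2 ^ k)\<^sup>2 = (cmod (D_iter js (peak n) (signs n S)))\<^sup>2"
      using D_iter_peak[of js n] js S by (simp add: J_def)
    also have "\<dots> \<le> (\<Sum>js\<in>distinct_index_tuples n k. (cmod (D_iter js (peak n) (signs n S)))\<^sup>2)"
      by (rule member_le_sum[OF mem _ fin]) simp
    finally show ?thesis unfolding g_def by (rule real_le_rsqrt)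
  qed
  have inj: "inj_on (signs n) J"
    by (rule inj_on_subset[OF inj_signs]) (auto simp: J_def)
  have "(1 / 2 ^ n * real (n choose k)) * (1 / 2 ^ k) powr p = (1 / 2 ^ n) * (\<Sum>S\<in>J. (1 / 2 ^ k) powr p)"
    by (simp add: J_def n_subsets)
  also have "\<dots> \<le> (1 / 2 ^ n) * (\<Sum>S\<in>J. norm (g (signs n S)) powr p)"
    using p g by (intro mult_left_mono sum_mono powr_mono2) (auto intro: order_trans[OF _ abs_ge_self])
  also have "(\<Sum>S\<in>J. norm (g (signs n S)) powr p) = (\<Sum>x\<in>signs n ` J. norm (g x) powr p)"
    by (simp add: sum.reindex[OF inj])
  also have "(1 / 2 ^ n) * \<dots> \<le> (1 / 2 ^ n) * (\<Sum>x\<in>cube n. norm (g x) powr p)"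
    by (intro mult_left_mono sum_mono2) (auto simp: signs_cube)
  also have "\<dots> = moment n p g" by (simp add: avg_def divide_inverse)
  finally have "((1 / 2 ^ n * real (n choose k)) * (1 / 2 ^ k) powr p) powr (1 / p) \<le> Lp_norm n p g"
    unfolding Lp_norm_avg using p by (intro powr_mono2) auto
  moreover have "((1 / 2 ^ n * real (n choose k)) * (1 / 2 ^ k) powr p) powr (1 / p)
      = (1 / 2 ^ n * real (n choose k)) powr (1 / p) * (1 / 2 ^ k)"
    using p by (subst powr_mult) (simp add: powr_powr)
  ultimately show ?thesis by (simp add: g_def[abs_def])
qed

text \<open>
  For the peak, the inequality would force \<open>n\<^bsup>k/p\<^esup>\<close> to be at most of order \<open>n\<^sup>\<gamma>\<close>.
\<close>

lemma distinct_derivs_unbounded: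
  assumes k: "1 \<le> k" and p: "1 < p" and \<gamma>: "0 < \<gamma>" "\<gamma> < real k / p"
  shows "\<not> (\<exists>C::real. \<forall>n::nat. n \<ge> 1 \<longrightarrow> (\<forall>f :: (nat \<Rightarrow> real) \<Rightarrow> complex.
      Lp_norm n p (derivs_norm (distinct_index_tuples n k) f)
        \<le> C * Lp_norm n p (Delta_power n (complex_of_real \<gamma>) f)))"
proof
  assume "\<exists>C::real. \<forall>n::nat. n \<ge> 1 \<longrightarrow> (\<forall>f :: (nat \<Rightarrow> real) \<Rightarrow> complex.
      Lp_norm n p (derivs_norm (distinct_index_tuples n k) f)
        \<le> C * Lp_norm n p (Delta_power n (complex_of_real \<gamma>) f))"
  then obtain C where C: "\<And>n f. 1 \<le> n \<Longrightarrow>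
      Lp_norm n p (derivs_norm (distinct_index_tuples n k) f)
        \<le> C * Lp_norm n p (Delta_power n (complex_of_real \<gamma>) f)" by blast
  define S where "S = (\<Sum>k. \<bar>\<gamma> gchoose k\<bar>)"
  define R where "R = real k powr (real k / p) * 2 ^ k * (\<bar>C\<bar> * (2 * S))"
  have bound: "real n powr (real k / p - \<gamma>) \<le> R" if n: "k \<le> n" for n
  proof -
    have n1: "1 \<le> n" using k n by simp
    define \<nu> where "\<nu> = (1 / 2 ^ n :: real) powr (1 / p)"
    have \<nu>: "0 < \<nu>" by (simp add: \<nu>_def)
    have L: "Lp_norm n p (num_power n \<gamma> (peak n)) \<le> 2 * S * real n powr \<gamma> * \<nu>"
    proof -
      have S0: "0 \<le> S" unfolding S_def using summable_abs_gbinomial[OF \<gamma>(1)] by (intro suminf_nonneg) auto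
      have "moment n p (num_power n \<gamma> (peak n)) \<le> (2 * S * real n powr \<gamma>) powr p * moment n p (peak n)"
        unfolding S_def using p \<gamma> n1 by (intro moment_num_power_le) auto
      then have "Lp_norm n p (num_power n \<gamma> (peak n)) \<le> ((2 * S * real n powr \<gamma>) powr p * moment n p (peak n)) powr (1 / p)"
        unfolding Lp_norm_avg using p by (intro powr_mono2 avg_nonneg) auto
      also have "\<dots> = (2 * S * real n powr \<gamma>) * Lp_norm n p (peak n)"
        using p S0 unfolding Lp_norm_avg by (subst powr_mult) (simp add: powr_powr)
      finally show ?thesis using p by (simp add: Lp_norm_peak \<nu>_def)
    qed
    have "(real n / real k) ^ k \<le> real (n choose k)" by (rule binomial_ge_n_over_k_pow_k[OF n])
    then have "((real n / real k) ^ k) powr (1 / p) \<le> real (n choose k) powr (1 / p)"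
      using p by (intro powr_mono2) auto
    moreover have "((real n / real k) ^ k) powr (1 / p) = real n powr (real k / p) / real k powr (real k / p)"
      using k n1 by (simp add: powr_realpow[symmetric] powr_powr powr_divide)
    ultimately have "\<nu> * (real n powr (real k / p) / real k powr (real k / p)) * (1 / 2 ^ k) \<le> \<nu> * real (n choose k) powr (1 / p) * (1 / 2 ^ k)"
      using \<nu> by (intro mult_right_mono mult_left_mono) auto
    also have "\<dots> = (1 / 2 ^ n * real (n choose k)) powr (1 / p) * (1 / 2 ^ k)"
      by (simp only: \<nu>_def powr_mult)
    also have "\<dots> \<le> Lp_norm n p (derivs_norm (distinct_index_tuples n k) (peak n))"
      using p by (intro Lp_norm_derivs_peak_ge) auto
    also have "\<dots> \<le> C * Lp_norm n p (num_power n \<gamma> (peak n))"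
      using C[OF n1, of "peak n"] by (simp only: Delta_power_num_power)
    also have "\<dots> \<le> \<bar>C\<bar> * Lp_norm n p (num_power n \<gamma> (peak n))"
      by (intro mult_right_mono) (auto simp: Lp_norm_def)
    also have "\<dots> \<le> \<bar>C\<bar> * (2 * S * real n powr \<gamma> * \<nu>)"
      by (intro mult_left_mono L) auto
    finally have "\<nu> * (real n powr (real k / p) / real k powr (real k / p) * (1 / 2 ^ k)) \<le> \<nu> * (\<bar>C\<bar> * (2 * S) * real n powr \<gamma>)"
      by (simp add: mult_ac)
    then have "real n powr (real k / p) / real k powr (real k / p) * (1 / 2 ^ k) \<le> \<bar>C\<bar> * (2 * S) * real n powr \<gamma>"
      using \<nu> by (simp only: mult_le_cancel_left_pos)
    then have "real n powr (real k / p) \<le> R * real n powr \<gamma>"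
      using k by (simp add: R_def field_simps)
    then show ?thesis using n1 by (simp add: powr_diff divide_le_eq)
  qed
  define d where "d = real k / p - \<gamma>"
  have d: "0 < d" using \<gamma> by (simp add: d_def)
  define n where "n = max k (nat \<lceil>(\<bar>R\<bar> + 1) powr (1 / d)\<rceil>)"
  have "(\<bar>R\<bar> + 1) powr (1 / d) \<le> real (nat \<lceil>(\<bar>R\<bar> + 1) powr (1 / d)\<rceil>)" by (rule real_nat_ceiling_ge)
  also have "\<dots> \<le> real n" by (simp add: n_def)
  finally have "((\<bar>R\<bar> + 1) powr (1 / d)) powr d \<le> real n powr d"
    using d by (intro powr_mono2) auto
  then have "\<bar>R\<bar> + 1 \<le> real n powr d" using d by (simp add: powr_powr)
  moreover have "real n powr d \<le> R" unfolding d_def by (rule bound) (simp add: n_def)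
  ultimately show False by linarith
qed

theorem theorem1p3:
  fixes k :: nat
  assumes "k \<ge> 1"
  shows
    "(\<exists>c::real. \<forall>p::real. 1 < p \<and> p < 2 \<longrightarrow>
        (\<forall>n::nat. n \<ge> 1 \<longrightarrow> (\<forall>f :: (nat \<Rightarrow> real) \<Rightarrow> complex.
          Lp_norm n p (\<lambda>x. sqrt (\<Sum>js\<in>index_tuples n k. (cmod (D_iter js f x))\<^sup>2))
            \<le> c * (p - 1) powr (- 2 * real k)
                * Lp_norm n p (Delta_power n (complex_of_real (real k / p)) f))))
     \<and>
     (\<forall>p::real. 1 < p \<and> p < 2 \<longrightarrow>
        (\<forall>\<gamma>::real. 0 < \<gamma> \<and> \<gamma> < real k / p \<longrightarrow>
          \<not> (\<exists>C::real. \<forall>n::nat. n \<ge> 1 \<longrightarrow> (\<forall>f :: (nat \<Rightarrow> real) \<Rightarrow> complex.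
              Lp_norm n p (\<lambda>x. sqrt (\<Sum>js\<in>distinct_index_tuples n k. (cmod (D_iter js f x))\<^sup>2))
                \<le> C * Lp_norm n p (Delta_power n (complex_of_real \<gamma>) f)))))"
proof (intro conjI exI[of _ "12384 ^ k"] allI impI)
  fix p :: real and n :: nat and f :: "(nat \<Rightarrow> real) \<Rightarrow> complex"
  assume "1 < p \<and> p < 2"
  then show "Lp_norm n p (\<lambda>x. sqrt (\<Sum>js\<in>index_tuples n k. (cmod (D_iter js f x))\<^sup>2))
      \<le> 12384 ^ k * (p - 1) powr (- 2 * real k) * Lp_norm n p (Delta_power n (complex_of_real (real k / p)) f)"
    using tuple_derivs_Lp_bound[OF _ _ assms] by blast
next
  fix p \<gamma> :: real
  assume "1 < p \<and> p < 2" "0 < \<gamma> \<and> \<gamma> < real k / p"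
  then show "\<not> (\<exists>C::real. \<forall>n::nat. n \<ge> 1 \<longrightarrow> (\<forall>f :: (nat \<Rightarrow> real) \<Rightarrow> complex.
      Lp_norm n p (\<lambda>x. sqrt (\<Sum>js\<in>distinct_index_tuples n k. (cmod (D_iter js f x))\<^sup>2))
        \<le> C * Lp_norm n p (Delta_power n (complex_of_real \<gamma>) f)))"
    by (intro distinct_derivs_unbounded assms) auto
qed

end
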